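(* For any positive integer $N$ and any partition $\lambda$ with $|\lambda|<2N$, $$\int_{U(2N)}P_\lambda(U)\,\overline{\omega_{Sp}(U)}\,dU=\int_{USp(2N)}P_\lambda(U)\,dU,$$ where $\omega_{Sp}(U)=\prod_{1\le i<k\le 2N}\frac{1}{1-x_ix_k}$ with $x_1,\dots,x_{2N}$ the eigenvalues of $U$, and both integrals are against Haar probability measures.
   Context: For a partition $\lambda=1^{\lambda_1}2^{\lambda_2}\cdots k^{\lambda_k}$ ($\lambda_j$ parts equal to $j$), $|\lambda|=\sum_j j\lambda_j$ and $P_\lambda(U)=\prod_{j}\mathrm{Tr}(U^j)^{\lambda_j}$. $U(2N)$ is the unitary group and $USp(2N)$ the unitary symplectic group of $2N\times 2N$ matrices.
   Formalization: The integrand over U(2N) is not integrable (for N=1, ω_Sp(U)=1/(1−det U)), so the left-hand integral is read as the limit as r→1⁻ of the integrals of P_λ(U) times the conjugate of ω_Sp(rU), where the eigenvalues x_i are replaced by r·x_i. *)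

theory Defs
  imports "HOL-Probability.Probability_Measure" "HOL-Computational_Algebra.Computational_Algebra"
begin

(* On vectors and matrices the library's multiplication and power are componentwise, hence the
   iteration of the matrix product here. *)
definition matrix_power :: "complex^'m^'m \<Rightarrow> nat \<Rightarrow> complex^'m^'m"
  where "matrix_power A j = (((**) A) ^^ j) (mat 1)"

definition conj_transpose :: "complex^'m^'m \<Rightarrow> complex^'m^'m"
  where "conj_transpose A = map_matrix cnj (transpose A)"

definition unitary_group :: "(complex^'m^'m) set"
  where "unitary_group =
    {A. conj_transpose A ** A = mat 1 \<and> A ** conj_transpose A = mat 1}"

(* The standard symplectic form, with block rows (0, 1) and (-1, 0).  Matrices of size 2N are
   indexed by a sum type 'n + 'n with CARD('n) = N. *)
definition symplectic_form :: "complex^('n::finite + 'n)^('n + 'n)"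
  where "symplectic_form =
    (\<chi> a b. case (a, b) of
        (Inl i, Inr j) \<Rightarrow> (if i = j then 1 else 0)
      | (Inr i, Inl j) \<Rightarrow> (if i = j then - 1 else 0)
      | _ \<Rightarrow> 0)"

definition unitary_symplectic_group :: "(complex^('n::finite + 'n)^('n + 'n)) set"
  where "unitary_symplectic_group =
    {A \<in> unitary_group. transpose A ** symplectic_form ** A = symplectic_form}"

definition haar_prob :: "(complex^'m^'m) set \<Rightarrow> (complex^'m^'m) measure \<Rightarrow> bool"
  where "haar_prob G M \<longleftrightarrow>
    prob_space M \<and> space M = G \<and> sets M = sets (restrict_space borel G) \<and>
    (\<forall>g\<in>G. distr M M (\<lambda>h. g ** h) = M)"

definition charpoly :: "complex^'m^'m \<Rightarrow> complex poly"
  where "charpoly A = det (mat [:0, 1:] - map_matrix (\<lambda>a. [:a:]) A)"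

(* The eigenvalues, repeated according to algebraic multiplicity, in an unspecified order. *)
definition eigenvalues :: "complex^'m^'m \<Rightarrow> complex list"
  where "eigenvalues A = (SOME xs. mset xs = proots (charpoly A))"

(* On the unitary group omega_Sp has a non-integrable singularity wherever a product of two
   eigenvalues is 1: for size 2 it is 1 / (1 - det U) with det U uniform on the unit circle.
   Integrals against it are those of its power series in the eigenvalues, i.e. the limit of the
   integrals against omega_Sp (r U) (eigenvalues r x_i) as r tends to 1 from below. *)
definition omega_Sp :: "complex^'m^'m \<Rightarrow> complex"
  where "omega_Sp A =
    (\<Prod>k<CARD('m). \<Prod>i<k. 1 / (1 - eigenvalues A ! i * eigenvalues A ! k))"

(* A partition is a finite multiset of positive integers: the number of parts equal to j is
   count lam j, and the size of the partition is sum_mset lam. *)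
definition is_partition :: "nat multiset \<Rightarrow> bool"
  where "is_partition lam \<longleftrightarrow> 0 \<notin># lam"

definition power_sum :: "nat multiset \<Rightarrow> complex^'m^'m \<Rightarrow> complex"
  where "power_sum lam U = (\<Prod>j\<in>set_mset lam. trace (matrix_power U j) ^ count lam j)"

lemma mset_eigenvalues: "mset (eigenvalues A) = proots (charpoly A)"
  unfolding eigenvalues_def by (rule someI_ex) (rule ex_mset)

lemma degree_charpoly: "degree (charpoly (A :: complex^'m^'m)) = CARD('m)"
proof -
  define B where "B = mat [:0, 1:] - map_matrix (\<lambda>a. [:a:]) A"
  let ?t = "\<lambda>p. of_int (sign p) * (\<Prod>i\<in>UNIV. B $ i $ p i)"
  let ?P = "{p. p permutes (UNIV :: 'm set)}"
  have entry: "B $ i $ j = (if i = j then [:- A $ i $ j, 1:] else [:- A $ i $ j:])" for i j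
    by (simp add: B_def mat_def)
  have deg_id: "degree (?t id) = CARD('m)"
    by (simp add: entry sign_id degree_prod_sum_eq)
  have small: "degree (?t p) < CARD('m)" if p: "p \<in> ?P - {id}" for p
  proof -
    obtain a where a: "p a \<noteq> a" using p by (auto simp: fun_eq_iff)
    have "degree (?t p) \<le> degree (\<Prod>i\<in>UNIV. B $ i $ p i)"
      by (cases "sign p = 1") (auto simp: sign_def)
    also have "\<dots> \<le> (\<Sum>i\<in>UNIV. degree (B $ i $ p i))"
      by (rule degree_prod_sum_le[unfolded o_def]) simp
    also have "\<dots> < (\<Sum>i\<in>(UNIV::'m set). 1)"
    proof (rule sum_strict_mono_ex1)
      show "\<forall>i\<in>UNIV. degree (B $ i $ p i) \<le> 1" by (simp add: entry)
      have "degree (B $ a $ p a) < 1" using a by (simp add: entry)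
      then show "\<exists>i\<in>UNIV. degree (B $ i $ p i) < 1" by blast
    qed simp
    finally show ?thesis by simp
  qed
  have "charpoly A = ?t id + (\<Sum>p\<in>?P - {id}. ?t p)"
    unfolding charpoly_def B_def[symmetric] det_def
    by (rule sum.remove) (auto simp: permutes_id)
  moreover have "degree (\<Sum>p\<in>?P - {id}. ?t p) < CARD('m)"
    by (rule degree_sum_less) (use small in auto)
  ultimately show ?thesis
    using deg_id by (simp only: degree_add_eq_left)
qed

lemma length_eigenvalues: "length (eigenvalues (A :: complex^'m^'m)) = CARD('m)"
  by (metis degree_charpoly mset_eigenvalues size_mset size_proots_complex)

end

theory Submission
  imports Defs
begin

text \<open>
  Both sides are computed. Write \<open>p\<^sub>j = Tr U\<^sup>j\<close>. Differentiating the invariance of a Haar measure along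
  one-parameter subgroups, applied to the functions \<open>(U\<^sup>j)\<^sub>a\<^sub>b p\<^sub>\<lambda>\<close>, gives loop equations:
  \<open>D \<cdot> E[p\<^sub>j p\<^sub>\<lambda>]\<close> plus \<open>|\<lambda>| + j - 1\<close> cut-and-join terms of the same degree equals terms of lower degree,
  where \<open>D = 2N\<close> for the unitary and \<open>D = 2N + 1\<close> for the symplectic group. As long as the
  degree is at most \<open>D\<close>, a solution of the homogeneous equation vanishes where its modulus is maximal,
  so the moments are determined by induction on the degree. In the unitary case
  \<open>E[p\<^sub>\<lambda> cnj p\<^sub>\<mu>] = \<delta>\<^sub>\<lambda>\<^sub>\<mu> z\<^sub>\<lambda>\<close> solves the equations; in the symplectic case the solution is
  given by independent real Gaussians \<open>p\<^sub>j\<close> of variance \<open>j\<close> and mean \<open>- [j even]\<close>. Finally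
  \<open>\<omega>\<^sub>S\<^sub>p = exp (\<Sum>\<^sub>j (p\<^sub>j\<^sup>2 - p\<^sub>2\<^sub>j) / 2j)\<close>, and its expansion in the \<open>p\<^sub>\<lambda>\<close> has exactly these Gaussian moments
  divided by \<open>z\<^sub>\<lambda>\<close> as coefficients, so pairing it with \<open>p\<^sub>\<lambda>\<close> over the unitary group gives the
  symplectic moment times \<open>r\<close> to the power \<open>|\<lambda>|\<close>.
\<close>

text \<open>Loop equations replace characters and Weyl integration: they use left invariance alone,
  and only along subgroups with a closed form. For a unit vector v the projection P onto v generates
  exp(itP) = 1 + (e^{it} - 1) P; in the symplectic case P is paired with a projection Q that carries
  the inverse phase. Each such subgroup gives an equation that is complex linear in its generator,
  so polarization in v extends it from these few directions to the whole complexified Lie algebra.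
  Matrix entries of U^j are differentiated, not traces, because summing over entry and direction
  together splits the trace of a power into two traces (a cut) and merges two powers into one (a
  join). The symplectic constant exceeds 2N by one because the Lie algebra has a second, J-twisted
  part, whose leading term contributes one more copy of Tr U^j. On the unitary group itself all
  eigenvalues have modulus 1 and the kernel has no convergent expansion there; at radius r < 1 the
  expansion converges with a bound that is uniform in U.\<close>

no_notation fps_nth (infixl "$" 75)

section \<open>Cut-and-join equations on partitions\<close>

definition partitions_of :: "nat \<Rightarrow> nat multiset set"
  where "partitions_of n = {lam. is_partition lam \<and> sum_mset lam = n}"

lemma is_partition_simps [simp]:
  "is_partition {#}"
  "is_partition (add_mset j q) \<longleftrightarrow> 0 < j \<and> is_partition q"
  by (auto simp: is_partition_def)

lemma is_partition_diff [simp]: "is_partition q \<Longrightarrow> is_partition (q - {#i#})"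
  by (auto simp: is_partition_def dest: in_diffD)

lemma sum_mset_remove1: "(i::nat) \<in># q \<Longrightarrow> sum_mset (q - {#i#}) = sum_mset q - i"
  by (simp add: sum_mset_diff)

lemma le_sum_mset: "(i::nat) \<in># q \<Longrightarrow> i \<le> sum_mset q"
  by (metis insert_DiffM le_add1 sum_mset.add_mset)

lemma size_le_sum_mset: "is_partition q \<Longrightarrow> size q \<le> sum_mset q"
  by (induction q) auto

lemma set_mset_partition_subset: "is_partition q \<Longrightarrow> sum_mset q \<le> M \<Longrightarrow> set_mset q \<subseteq> {1..M}"
proof
  fix x assume "is_partition q" "sum_mset q \<le> M" "x \<in># q"
  then show "x \<in> {1..M}"
    using le_sum_mset[of x q] by (cases x) (auto simp: is_partition_def)
qed

lemma finite_partitions_of [simp]: "finite (partitions_of n)"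
proof (rule finite_subset)
  show "partitions_of n \<subseteq> (\<Union>k\<in>{..n}. multisets_of_size {1..n} k)"
    using set_mset_partition_subset size_le_sum_mset
    by (auto simp: partitions_of_def multisets_of_size_def)
qed auto

lemma partitions_of_0: "partitions_of 0 = {{#}}"
  by (auto simp: partitions_of_def is_partition_def) (metis multiset_nonemptyE)

text \<open>Multiplicities vanish outside the multiset, so sums over different partitions can be
  moved to one common range \<open>{1..M}\<close>, where they are split, shifted and compared as
  ordinary sums.\<close>

lemma sum_mset_eq_sum_count:
  fixes F :: "nat \<Rightarrow> complex"
  assumes "set_mset q \<subseteq> {1..M}"
  shows "(\<Sum>i\<in>#q. F i) = (\<Sum>i=1..M. of_nat (count q i) * F i)"
  using assms
proof (induction q)
  case (add x q)
  have "(\<Sum>i=1..M. of_nat (count (add_mset x q) i) * F i)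
      = (\<Sum>i=1..M. of_nat (count q i) * F i + (if i = x then F x else 0))"
    by (rule sum.cong) (auto simp: algebra_simps)
  then show ?case using add by (simp add: sum.distrib sum.delta')
qed simp

text \<open>A maximum principle. The equation is available for every way of splitting a part j off a
  partition, so any part of a maximizer of the modulus will do. The comparison of \<open>n\<close>
  with \<open>D\<close> made here is the origin of all degree bounds.\<close>

lemma cut_join_unique:
  fixes e :: "nat multiset \<Rightarrow> complex"
  assumes n: "0 < n" "n \<le> D"
    and eq: "\<And>j q. 0 < j \<Longrightarrow> is_partition q \<Longrightarrow> j + sum_mset q = n \<Longrightarrow>
      of_nat D * e (add_mset j q) + (\<Sum>k=1..<j. e (add_mset k (add_mset (j - k) q)))
        + (\<Sum>i\<in>#q. of_nat i * e (add_mset (i + j) (q - {#i#}))) = 0"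
    and lam: "lam \<in> partitions_of n"
  shows "e lam = 0"
proof -
  define M where "M = Max ((\<lambda>l. norm (e l)) ` partitions_of n)"
  have M: "norm (e l) \<le> M" if "l \<in> partitions_of n" for l
    unfolding M_def by (rule Max_ge) (use that in auto)
  have "M \<in> (\<lambda>l. norm (e l)) ` partitions_of n"
    unfolding M_def by (rule Max_in) (use lam in auto)
  then obtain l where l: "l \<in> partitions_of n" "M = norm (e l)" by auto
  then have "l \<noteq> {#}" using n by (auto simp: partitions_of_def)
  then obtain j q where jq: "l = add_mset j q" by (meson multiset_cases)
  have j: "0 < j" and q: "is_partition q" and s: "j + sum_mset q = n"
    using l unfolding jq partitions_of_def by auto
  have M0: "0 \<le> M" using l by simp
  have a: "norm (\<Sum>k=1..<j. e (add_mset k (add_mset (j - k) q))) \<le> (\<Sum>k=1..<j. M)"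
    by (rule sum_norm_le) (use j q s in \<open>auto intro!: M simp: partitions_of_def\<close>)
  have sub: "set_mset q \<subseteq> {1..n}" using set_mset_partition_subset[OF q] s by auto
  have "norm (\<Sum>i\<in>#q. of_nat i * e (add_mset (i + j) (q - {#i#}))) \<le>
      (\<Sum>i=1..n. of_nat (count q i) * (of_nat i * M))"
    unfolding sum_mset_eq_sum_count[OF sub]
  proof (rule sum_norm_le)
    fix i
    show "norm (of_nat (count q i) * (of_nat i * e (add_mset (i + j) (q - {#i#}))))
        \<le> real (count q i) * (real i * M)"
    proof (cases "i \<in># q")
      case True
      then have "add_mset (i + j) (q - {#i#}) \<in> partitions_of n"
        using j q s le_sum_mset[OF True] by (auto simp: partitions_of_def sum_mset_remove1)
      then show ?thesis by (auto simp: norm_mult intro!: mult_left_mono M)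
    qed (simp add: not_in_iff)
  qed
  also have "\<dots> = real (sum_mset q) * M"
  proof -
    have "of_nat (sum_mset q) = (\<Sum>i\<in>#q. of_nat i :: complex)"
      by (induction q) auto
    also have "\<dots> = of_real (\<Sum>i=1..n. of_nat (count q i) * of_nat i)"
      unfolding sum_mset_eq_sum_count[OF sub] by simp
    finally have "real (sum_mset q) = (\<Sum>i=1..n. of_nat (count q i) * of_nat i)"
      by (metis of_real_eq_iff of_real_of_nat_eq)
    then show ?thesis by (simp add: sum_distrib_right mult.assoc)
  qed
  finally have b: "norm (\<Sum>i\<in>#q. of_nat i * e (add_mset (i + j) (q - {#i#}))) \<le> real (sum_mset q) * M" .
  define S1 S2 where "S1 = (\<Sum>k=1..<j. e (add_mset k (add_mset (j - k) q)))"
    and "S2 = (\<Sum>i\<in>#q. of_nat i * e (add_mset (i + j) (q - {#i#})))"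
  have "of_nat D * e l = - (S1 + S2)"
    using eq[OF j q s] unfolding jq S1_def S2_def eq_neg_iff_add_eq_0 add.assoc .
  then have "norm (of_nat D * e l) \<le> norm S1 + norm S2"
    using norm_triangle_ineq[of S1 S2] by (simp only: norm_minus_cancel)
  also have "\<dots> \<le> real (j - 1) * M + real (sum_mset q) * M"
    using a b unfolding S1_def[symmetric] S2_def[symmetric] by simp
  finally have "norm (of_nat D * e l) \<le> real (j - 1) * M + real (sum_mset q) * M" .
  \<comment> \<open>The j - 1 cuts have weight one and the joins have total weight
    \<open>sum_mset q\<close>; together this is n - 1, strictly less than \<open>D\<close>.\<close>
  then have "real D * M \<le> (real n - 1) * M"
    unfolding s[symmetric] using l j by (simp add: norm_mult algebra_simps of_nat_diff)
  then have "(real D - real n + 1) * M \<le> 0" by (simp add: algebra_simps)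
  then have "M \<le> 0" using n
    by (simp add: mult_le_0_iff)
  then show ?thesis using M[OF lam] M0 by simp
qed

section \<open>Products over part sizes: Hall inner product and Gaussian moments\<close>

definition multiplicity_prod :: "(nat \<Rightarrow> nat \<Rightarrow> complex) \<Rightarrow> nat multiset \<Rightarrow> complex"
  where "multiplicity_prod f lam = (\<Prod>j\<in>set_mset lam. f j (count lam j))"

text \<open>Isolates the factor of the part size j, which is all that adding or removing a part j
  changes. Since \<open>f j 0 = 1\<close>, sizes that do not occur contribute nothing, and no case
  distinction on whether j occurs in the partition is needed.\<close>

lemma multiplicity_prod_split:
  assumes f: "\<And>j. f j 0 = 1" and eq: "\<And>i. i \<noteq> j \<Longrightarrow> count p i = count q i"
  shows "multiplicity_prod f p = f j (count p j) * (\<Prod>i\<in>set_mset q - {j}. f i (count q i))"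
proof -
  have "multiplicity_prod f p = (\<Prod>i\<in>insert j (set_mset p). f i (count p i))"
    unfolding multiplicity_prod_def
    by (rule prod.mono_neutral_left) (auto simp: f not_in_iff)
  also have "\<dots> = f j (count p j) * (\<Prod>i\<in>set_mset p - {j}. f i (count p i))"
    by (simp add: prod.insert_remove)
  also have "(\<Prod>i\<in>set_mset p - {j}. f i (count p i)) = (\<Prod>i\<in>set_mset q - {j}. f i (count q i))"
  proof (rule prod.cong)
    have "i \<in># p \<longleftrightarrow> i \<in># q" if "i \<noteq> j" for i
      using eq[OF that] by (metis count_greater_zero_iff)
    then show "set_mset p - {j} = set_mset q - {j}" by auto
  qed (use eq in auto)
  finally show ?thesis .
qed

text \<open>This is z_lambda, the order of the centralizer of a permutation of cycle type lambda, as
  a complex number.\<close>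

definition zfac :: "nat multiset \<Rightarrow> complex"
  where "zfac = multiplicity_prod (\<lambda>j c. of_nat (j ^ c * fact c))"

lemma zfac_empty [simp]: "zfac {#} = 1"
  by (simp add: zfac_def multiplicity_prod_def)

lemma zfac_add_mset: "zfac (add_mset j q) = of_nat j * of_nat (Suc (count q j)) * zfac q"
  unfolding zfac_def
  by (subst (1 2) multiplicity_prod_split[where j = j and q = q]) (auto simp: algebra_simps)

lemma zfac_nonzero: "is_partition q \<Longrightarrow> zfac q \<noteq> 0"
  by (induction q) (simp_all add: zfac_add_mset del: of_nat_Suc)

text \<open>The \<open>c\<close>-th moment of a real Gaussian with variance \<open>j\<close> and mean \<open>-1\<close> (\<open>j\<close> even) or \<open>0\<close> (\<open>j\<close> odd);
  the recursion is Gaussian integration by parts.\<close>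

fun sp_moment_factor :: "nat \<Rightarrow> nat \<Rightarrow> complex" where
  "sp_moment_factor j 0 = 1"
| "sp_moment_factor j (Suc 0) = - of_bool (even j)"
| "sp_moment_factor j (Suc (Suc c)) = - of_bool (even j) * sp_moment_factor j (Suc c)
     + of_nat j * of_nat (Suc c) * sp_moment_factor j c"

lemma sp_moment_factor_Suc: "sp_moment_factor j (Suc c) = - of_bool (even j) * sp_moment_factor j c
     + of_nat j * of_nat c * sp_moment_factor j (c - 1)"
  by (cases c) auto

definition sp_moment :: "nat multiset \<Rightarrow> complex"
  where "sp_moment = multiplicity_prod sp_moment_factor"

lemma sp_moment_empty [simp]: "sp_moment {#} = 1"
  by (simp add: sp_moment_def multiplicity_prod_def)

text \<open>Mean times the remaining moment plus variance times a derivative. If j does not occur in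
  q, then \<open>q - {#j#}\<close> is just q, but the factor \<open>count q j\<close> removes that
  term.\<close>

lemma sp_moment_add_mset: "sp_moment (add_mset j q) =
    - of_bool (even j) * sp_moment q + of_nat j * of_nat (count q j) * sp_moment (q - {#j#})"
  unfolding sp_moment_def
  by (subst (1 2 3) multiplicity_prod_split[where j = j and q = q])
     (auto simp: algebra_simps sp_moment_factor_Suc)

definition zdelta :: "nat multiset \<Rightarrow> nat multiset \<Rightarrow> complex"
  where "zdelta lam mu = (if lam = mu then zfac lam else 0)"

lemma zdelta_commute: "zdelta lam mu = zdelta mu lam"
  by (auto simp: zdelta_def)

text \<open>Adjointness for the Hall inner product: multiplication by p_j on the left becomes the
  operator j d/dp_j on the right.\<close>

lemma zdelta_add_mset:
  "zdelta (add_mset j q) mu = of_nat j * of_nat (count mu j) * zdelta q (mu - {#j#})"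
proof (cases "j \<in># mu")
  case True
  then obtain nu where "mu = add_mset j nu" by (metis insert_DiffM)
  then show ?thesis by (auto simp: zdelta_def zfac_add_mset)
next
  case False
  then show ?thesis by (auto simp: zdelta_def not_in_iff)
qed

lemma zdelta_add_mset_right:
  "zdelta lam (add_mset j q) = of_nat j * of_nat (count lam j) * zdelta (lam - {#j#}) q"
  by (metis zdelta_add_mset zdelta_commute)

section \<open>The candidate moments solve the loop equations\<close>

lemma sum_shift_above:
  fixes f :: "nat \<Rightarrow> complex"
  assumes "\<And>i. i > M \<Longrightarrow> f i = 0"
  shows "(\<Sum>m\<in>{m\<in>{1..M}. j < m}. f m) = (\<Sum>i=1..M. f (i + j))"
proof -
  have "(\<Sum>i=1..M. f (i + j)) = (\<Sum>m\<in>(\<lambda>i. i + j) ` {1..M}. f m)"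
    by (subst sum.reindex) (auto simp: inj_on_def)
  also have "\<dots> = (\<Sum>m\<in>{m\<in>{1..M}. j < m}. f m)"
  proof (rule sum.mono_neutral_right)
    show "{m \<in> {1..M}. j < m} \<subseteq> (\<lambda>i. i + j) ` {1..M}"
      by (auto simp: image_iff intro!: bexI[where x = "_ - j"])
    show "\<forall>i\<in>(\<lambda>i. i + j) ` {1..M} - {m \<in> {1..M}. j < m}. f i = 0"
      by (auto intro!: assms)
  qed simp
  finally show ?thesis by simp
qed

text \<open>Adjointness moves one part from the left argument to \<open>mu\<close>. A cut into k and
  j - k becomes the term m = k < j, the leading term becomes m = j, and the join of i with j becomes
  the term m = i + j > j, where a second use of adjointness restores i in q.\<close>

lemma zdelta_loop_equation:
  assumes j: "0 < j" and q: "is_partition q" and mu: "is_partition mu"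
  shows "d * zdelta (add_mset j q) mu + (\<Sum>k=1..<j. zdelta (add_mset k (add_mset (j - k) q)) mu)
        + (\<Sum>i\<in>#q. of_nat i * zdelta (add_mset (i + j) (q - {#i#})) mu)
      = (\<Sum>m\<in>#mu. of_nat m * (if m < j then zdelta (add_mset (j - m) q) (mu - {#m#})
           else if m = j then d * zdelta q (mu - {#m#})
           else zdelta q (add_mset (m - j) (mu - {#m#}))))" (is "?L1 + ?L2 + ?L3 = ?R")
proof -
  define M where "M = sum_mset q + sum_mset mu + j"
  have sq: "set_mset q \<subseteq> {1..M}" and smu: "set_mset mu \<subseteq> {1..M}"
    by (rule set_mset_partition_subset; simp add: M_def q mu)+
  have jM: "j \<in> {1..M}" using j by (auto simp: M_def)
  let ?f = "\<lambda>m. of_nat (count mu m) * (of_nat m * zdelta (add_mset (j - m) q) (mu - {#m#}))"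
  let ?g = "\<lambda>m. of_nat (count mu m) * (of_nat m * (d * zdelta q (mu - {#m#})))"
  let ?h = "\<lambda>m. of_nat (count mu m) * (of_nat m * zdelta q (add_mset (m - j) (mu - {#m#})))"
  have "?R = (\<Sum>m=1..M. (if m < j then ?f m else 0) + (if m = j then ?g m else 0) + (if j < m then ?h m else 0))"
    unfolding sum_mset_eq_sum_count[OF smu] by (rule sum.cong) auto
  also have "\<dots> = (\<Sum>m=1..M. if m < j then ?f m else 0) + (\<Sum>m=1..M. if m = j then ?g m else 0)
        + (\<Sum>m=1..M. if j < m then ?h m else 0)"
    by (simp add: sum.distrib)
  also have "(\<Sum>m=1..M. if m < j then ?f m else 0) = ?L2"
  proof -
    have "(\<Sum>m=1..M. if m < j then ?f m else 0) = (\<Sum>m\<in>{m\<in>{1..M}. m < j}. ?f m)"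
      by (rule sum.inter_filter[symmetric]) simp
    also have "{m\<in>{1..M}. m < j} = {1..<j}" using jM by auto
    also have "(\<Sum>m=1..<j. ?f m) = ?L2"
      by (rule sum.cong) (auto simp: zdelta_add_mset[where q = "add_mset _ _"])
    finally show ?thesis .
  qed
  also have "(\<Sum>m=1..M. if m = j then ?g m else 0) = ?L1"
    using jM by (simp add: zdelta_add_mset)
  also have "(\<Sum>m=1..M. if j < m then ?h m else 0) = (\<Sum>m\<in>{m\<in>{1..M}. j < m}. ?h m)"
    by (rule sum.inter_filter[symmetric]) simp
  also have "\<dots> = (\<Sum>i=1..M. ?h (i + j))"
  proof (rule sum_shift_above)
    fix i assume "M < i"
    then have "i \<notin># mu" using smu by auto
    then show "?h i = 0" by (simp add: not_in_iff)
  qed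
  also have "\<dots> = ?L3"
    unfolding sum_mset_eq_sum_count[OF sq]
    by (rule sum.cong) (auto simp: zdelta_add_mset zdelta_add_mset_right)
  finally show ?thesis by simp
qed

text \<open>The k-th term stands for the trace of U^(2k - j), where exponents l and -l give the same
  value. Each l below j with the parity of j is therefore hit twice, by (j - l)/2 and (j + l)/2; the
  exponent 0 occurs once, for even j, and has its own value c.\<close>

lemma sum_parity_strip:
  fixes F :: "nat \<Rightarrow> complex"
  shows "(\<Sum>k=1..<j. if 2 * k = j then c else F (if j < 2 * k then 2 * k - j else j - 2 * k))
      = 2 * (\<Sum>l\<in>{l\<in>{1..<j}. even (l + j)}. F l) + of_bool (even j \<and> 0 < j) * c"
proof -
  let ?A = "{l\<in>{1..<j}. even (l + j)}"
  let ?f = "\<lambda>k. if 2 * k = j then c else F (if j < 2 * k then 2 * k - j else j - 2 * k)"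
  have "sum ?f {1..<j} = sum ?f {k\<in>{1..<j}. 2 * k < j} + sum ?f {k\<in>{1..<j}. j < 2 * k}
      + sum ?f {k\<in>{1..<j}. 2 * k = j}"
    by (subst sum.union_disjoint[symmetric]; (force intro!: sum.cong)?)+
  also have "sum ?f {k\<in>{1..<j}. 2 * k < j} = (\<Sum>l\<in>?A. F l)"
  proof (rule sum.reindex_bij_witness[where i = "\<lambda>l. (j - l) div 2" and j = "\<lambda>k. j - 2 * k"])
    fix l assume "l \<in> ?A"
    then have "1 \<le> l" "l < j" "even (l + j)" by simp_all
    then obtain b where "l + j = 2 * b" by (elim evenE)
    then have "j - l = 2 * (b - l)" by linarith
    then show "j - 2 * ((j - l) div 2) = l" "(j - l) div 2 \<in> {k \<in> {1..<j}. 2 * k < j}"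
      using \<open>l + j = 2 * b\<close> \<open>1 \<le> l\<close> \<open>l < j\<close> by auto
  qed auto
  also have "sum ?f {k\<in>{1..<j}. j < 2 * k} = (\<Sum>l\<in>?A. F l)"
  proof (rule sum.reindex_bij_witness[where i = "\<lambda>l. (j + l) div 2" and j = "\<lambda>k. 2 * k - j"])
    fix l assume "l \<in> ?A"
    then have "1 \<le> l" "l < j" "even (l + j)" by simp_all
    then obtain b where "l + j = 2 * b" by (elim evenE)
    then show "2 * ((j + l) div 2) - j = l" "(j + l) div 2 \<in> {k \<in> {1..<j}. j < 2 * k}"
      using \<open>1 \<le> l\<close> \<open>l < j\<close> by (auto simp: add.commute[of j])
  qed auto
  also have "sum ?f {k\<in>{1..<j}. 2 * k = j} = of_bool (even j \<and> 0 < j) * c"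
  proof (cases "even j \<and> 0 < j")
    case True
    then have "{k\<in>{1..<j}. 2 * k = j} = {j div 2}" by auto
    then show ?thesis using True by simp
  next
    case False
    then have E: "{k\<in>{1..<j}. 2 * k = j} = {}" by auto
    show ?thesis unfolding E using False by simp
  qed
  finally show ?thesis by simp
qed

lemma card_even_below: "card {l\<in>{1..<j}. even (l + j) \<and> even l} = (if even j then j div 2 - 1 else 0)"
proof (cases "even j")
  case True
  then obtain b where b: "j = 2 * b" by blast
  have "{l\<in>{1..<j}. even (l + j) \<and> even l} = (\<lambda>k. 2 * k) ` {1..<b}"
    using b by (auto elim!: evenE)
  then show ?thesis using b by (simp add: card_image inj_on_def)
next
  case False
  then have "{l\<in>{1..<j}. even (l + j) \<and> even l} = {}" by auto
  then show ?thesis using False by (simp only: card.empty) simp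
qed

text \<open>Gaussian integration by parts reduces every term to the moment of q itself or to moments
  with parts of q removed. The contributions then cancel type by type, for every value of d.\<close>

lemma sp_moment_loop_equation:
  fixes d :: complex
  assumes j: "0 < j" and q: "is_partition q"
  shows "(d + 1) * sp_moment (add_mset j q)
      + (\<Sum>k=1..<j. sp_moment (add_mset k (add_mset (j - k) q))
          + (if 2 * k = j then d * sp_moment q
             else sp_moment (add_mset (if j < 2 * k then 2 * k - j else j - 2 * k) q)))
      + (\<Sum>i\<in>#q. of_nat i * (sp_moment (add_mset (i + j) (q - {#i#}))
          - (if i = j then d * sp_moment (q - {#i#})
             else sp_moment (add_mset (if i < j then j - i else i - j) (q - {#i#}))))) = 0"
proof -
  define M where "M = sum_mset q + j"
  have sq: "set_mset q \<subseteq> {1..M}"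
    by (rule set_mset_partition_subset) (simp_all add: M_def q)
  have jM: "j \<in> {1..M}" using j by (auto simp: M_def)
  let ?G = sp_moment
  let ?A = "{l\<in>{1..<j}. even (l + j)}"
  define F where "F l = ?G (add_mset l q)" for l
  \<comment> \<open>\<open>K i\<close> is the variance term of removing one part i,
    \<open>Z i\<close> that of removing both i and i + j, and \<open>T\<close> collects the cuts in
    which one of the two new parts is paired with a part of q.\<close>
  define K where "K i = of_nat i * of_nat (count q i) * ?G (q - {#i#})" for i
  define e :: "nat \<Rightarrow> complex" where "e l = of_bool (even l)" for l
  define T where "T = (\<Sum>k=1..<j. of_nat k * of_nat (count q k) * ?G (add_mset (j - k) (q - {#k#})))"
  define Z where "Z i = of_nat i * of_nat (count q i) * of_nat (i + j) * of_nat (count q (i + j))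
      * ?G (q - {#i#} - {#i + j#})" for i
  have FK: "F l = - e l * ?G q + K l" for l
    by (simp add: F_def K_def e_def sp_moment_add_mset)
  have cut: "(\<Sum>k=1..<j. ?G (add_mset k (add_mset (j - k) q)))
      = - (\<Sum>l\<in>?A. F l) + T + e j * of_nat (j div 2) * ?G q"
  proof -
    \<comment> \<open>If k = j - k, the other new part is one more copy of k that integration by
      parts can remove; this gives the extra \<open>of_nat k * ?G q\<close>.\<close>
    have "?G (add_mset k (add_mset (j - k) q)) = - e k * F (j - k)
        + of_nat k * of_nat (count q k) * ?G (add_mset (j - k) (q - {#k#}))
        + (if 2 * k = j then of_nat k * ?G q else 0)" if "k \<in> {1..<j}" for k
    proof (cases "2 * k = j")
      case True
      then have jk: "j - k = k" by simp
      show ?thesis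
      proof (cases "k \<in># q")
        case inq: True
        then show ?thesis
          using True by (simp add: jk sp_moment_add_mset[of k "add_mset k q"] F_def e_def algebra_simps)
      next
        case False
        then show ?thesis
          using True by (simp add: jk sp_moment_add_mset[of k "add_mset k q"] F_def e_def not_in_iff)
      qed
    next
      case False
      then have "j - k \<noteq> k" using that by auto
      then have "count (add_mset (j - k) q) k = count q k"
          "add_mset (j - k) q - {#k#} = add_mset (j - k) (q - {#k#}) \<or> count q k = 0"
        by (auto simp: multiset_eq_iff)
      then show ?thesis using False
        by (auto simp: sp_moment_add_mset[of k "add_mset (j - k) q"] F_def e_def)
    qed
    then have "(\<Sum>k=1..<j. ?G (add_mset k (add_mset (j - k) q)))
        = (\<Sum>k=1..<j. - e k * F (j - k)) + T + (\<Sum>k=1..<j. if 2 * k = j then of_nat k * ?G q else 0)"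
      unfolding T_def sum.distrib[symmetric] by (intro sum.cong) auto
    also have "(\<Sum>k=1..<j. - e k * F (j - k)) = - (\<Sum>l\<in>?A. F l)"
    proof -
      have "(\<Sum>k=1..<j. e k * F (j - k)) = (\<Sum>k=1..<j. if even k then F (j - k) else 0)"
        by (rule sum.cong) (auto simp: e_def)
      also have "\<dots> = (\<Sum>k\<in>{k\<in>{1..<j}. even k}. F (j - k))"
        by (rule sum.inter_filter[symmetric]) simp
      also have "\<dots> = (\<Sum>l\<in>?A. F l)"
        by (rule sum.reindex_bij_witness[where i = "\<lambda>l. j - l" and j = "\<lambda>k. j - k"]) auto
      finally show ?thesis by (simp add: sum_negf)
    qed
    also have "(\<Sum>k=1..<j. if 2 * k = j then of_nat k * ?G q else 0) = e j * of_nat (j div 2) * ?G q"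
    proof (cases "even j")
      case True
      then have "{k\<in>{1..<j}. 2 * k = j} = {j div 2}" using j by auto
      then show ?thesis using True by (subst sum.inter_filter[symmetric]) (auto simp: e_def)
    next
      case False
      then have "(\<Sum>k=1..<j. if 2 * k = j then of_nat k * ?G q else 0) = 0"
        by (intro sum.neutral) auto
      then show ?thesis using False by (simp add: e_def)
    qed
    finally show ?thesis .
  qed
  have join: "(\<Sum>i\<in>#q. of_nat i * ?G (add_mset (i + j) (q - {#i#})))
      = - (\<Sum>i=1..M. e (i + j) * K i) + (\<Sum>i=1..M. Z i)"
    unfolding sum_mset_eq_sum_count[OF sq] sum_negf[symmetric] sum.distrib[symmetric]
    by (rule sum.cong) (use j in \<open>auto simp: sp_moment_add_mset K_def Z_def e_def algebra_simps\<close>)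
  let ?f = "\<lambda>i. of_nat (count q i) * (of_nat i * ?G (add_mset (j - i) (q - {#i#})))"
  let ?h = "\<lambda>i. of_nat (count q i) * (of_nat i * ?G (add_mset (i - j) (q - {#i#})))"
  have "(\<Sum>i\<in>#q. of_nat i * (if i = j then d * ?G (q - {#i#})
             else ?G (add_mset (if i < j then j - i else i - j) (q - {#i#}))))
      = (\<Sum>i=1..M. (if i < j then ?f i else 0) + (if i = j then d * K i else 0) + (if j < i then ?h i else 0))"
    unfolding sum_mset_eq_sum_count[OF sq] by (rule sum.cong) (auto simp: K_def)
  also have "\<dots> = (\<Sum>i=1..M. if i < j then ?f i else 0) + (\<Sum>i=1..M. if i = j then d * K i else 0)
      + (\<Sum>i=1..M. if j < i then ?h i else 0)"
    by (simp add: sum.distrib)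
  also have "(\<Sum>i=1..M. if i < j then ?f i else 0) = T"
  proof -
    have "{i\<in>{1..M}. i < j} = {1..<j}" using jM by auto
    then show ?thesis by (subst sum.inter_filter[symmetric]) (auto simp: T_def algebra_simps)
  qed
  also have "(\<Sum>i=1..M. if i = j then d * K i else 0) = d * K j"
    using jM by simp
  also have "(\<Sum>i=1..M. if j < i then ?h i else 0) = (\<Sum>i\<in>{i\<in>{1..M}. j < i}. ?h i)"
    by (rule sum.inter_filter[symmetric]) simp
  also have "\<dots> = (\<Sum>i\<in>{i\<in>{1..M}. j < i}. - e (i + j) * K i
       + of_nat (count q i) * of_nat i * of_nat (i - j) * of_nat (count q (i - j)) * ?G (q - {#i - j#} - {#i#}))"
    by (rule sum.cong) (use j in \<open>auto simp: sp_moment_add_mset K_def e_def algebra_simps diff_right_commute\<close>)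
  also have "\<dots> = - (\<Sum>i\<in>{i\<in>{1..M}. j < i}. e (i + j) * K i)
      + (\<Sum>i\<in>{i\<in>{1..M}. j < i}. of_nat (count q i) * of_nat i * of_nat (i - j) * of_nat (count q (i - j)) * ?G (q - {#i - j#} - {#i#}))"
    by (simp only: sum.distrib sum_negf mult_minus_left)
  also have "(\<Sum>i\<in>{i\<in>{1..M}. j < i}. of_nat (count q i) * of_nat i * of_nat (i - j) * of_nat (count q (i - j)) * ?G (q - {#i - j#} - {#i#}))
      = (\<Sum>i=1..M. Z i)"
  proof (subst sum_shift_above)
    fix i assume "M < i"
    then have "i \<notin># q" using sq by auto
    then show "of_nat (count q i) * of_nat i * of_nat (i - j) * of_nat (count q (i - j)) * ?G (q - {#i - j#} - {#i#}) = 0"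
      by (simp add: not_in_iff)
  qed (simp add: Z_def algebra_simps)
  finally have split: "(\<Sum>i\<in>#q. of_nat i * (if i = j then d * ?G (q - {#i#})
             else ?G (add_mset (if i < j then j - i else i - j) (q - {#i#}))))
      = T + d * K j + (- (\<Sum>i\<in>{i\<in>{1..M}. j < i}. e (i + j) * K i) + (\<Sum>i=1..M. Z i))" .
  have U: "{1..M} = {1..j} \<union> {i\<in>{1..M}. j < i}" using jM by auto
  have "(\<Sum>i\<in>{1..j} \<union> {i\<in>{1..M}. j < i}. e (i + j) * K i)
      = (\<Sum>i=1..j. e (i + j) * K i) + (\<Sum>i\<in>{i\<in>{1..M}. j < i}. e (i + j) * K i)"
    by (rule sum.union_disjoint) auto
  then have "(\<Sum>i=1..M. e (i + j) * K i) = (\<Sum>i=1..j. e (i + j) * K i) + (\<Sum>i\<in>{i\<in>{1..M}. j < i}. e (i + j) * K i)"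
    unfolding U[symmetric] .
  moreover have "(\<Sum>i=1..j. e (i + j) * K i) = (\<Sum>i=1..<j. e (i + j) * K i) + K j"
  proof -
    have "{1..j} = insert j {1..<j}" using j by auto
    then show ?thesis by (simp add: e_def)
  qed
  moreover have "(\<Sum>i=1..<j. e (i + j) * K i) = (\<Sum>l\<in>?A. K l)"
  proof -
    have "(\<Sum>i=1..<j. e (i + j) * K i) = (\<Sum>l=1..<j. if even (l + j) then K l else 0)"
      by (rule sum.cong) (simp_all add: e_def)
    also have "\<dots> = (\<Sum>l\<in>?A. K l)"
      by (rule sum.inter_filter[symmetric]) simp
    finally show ?thesis .
  qed
  ultimately have K_sum: "(\<Sum>i=1..M. e (i + j) * K i) = (\<Sum>l\<in>?A. K l) + K j + (\<Sum>i\<in>{i\<in>{1..M}. j < i}. e (i + j) * K i)"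
    by simp
  have e_sum: "(\<Sum>l\<in>?A. e l) = e j * (of_nat (j div 2) - 1)"
  proof -
    have "(\<Sum>l\<in>?A. e l) = of_nat (card {l\<in>?A. even l})"
      unfolding e_def of_bool_def
      by (subst sum.inter_filter[symmetric]) auto
    also have "{l\<in>?A. even l} = {l\<in>{1..<j}. even (l + j) \<and> even l}" by auto
    also have "of_nat (card \<dots>) = e j * (of_nat (j div 2) - 1)"
      unfolding card_even_below e_def using j by (auto simp: of_nat_diff elim!: evenE)
    finally show ?thesis .
  qed
  have F_sum: "(\<Sum>l\<in>?A. F l) = - (e j * (of_nat (j div 2) - 1)) * ?G q + (\<Sum>l\<in>?A. K l)"
    unfolding FK sum.distrib e_sum[symmetric] by (simp add: sum_distrib_right sum_negf)
  have mid: "(\<Sum>k=1..<j. if 2 * k = j then d * ?G q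
             else ?G (add_mset (if j < 2 * k then 2 * k - j else j - 2 * k) q))
      = 2 * (\<Sum>l\<in>?A. F l) + e j * (d * ?G q)"
    using sum_parity_strip[of j "d * ?G q" F] j unfolding F_def[symmetric] e_def by simp
  have dist: "(\<Sum>i\<in>#q. of_nat i * (?G (add_mset (i + j) (q - {#i#})) - B i))
      = (\<Sum>i\<in>#q. of_nat i * ?G (add_mset (i + j) (q - {#i#}))) - (\<Sum>i\<in>#q. of_nat i * B i)" for B
    unfolding sum_mset_eq_sum_count[OF sq] by (simp add: sum_subtractf algebra_simps)
  \<comment> \<open>\<open>T\<close> and the sums of \<open>Z\<close> cancel between cuts and joins
    on one side and the subtracted terms on the other, and the \<open>K\<close> terms cancel by
    parity. For even j the coefficient of \<open>?G q\<close> is -(d + 1) - (j/2 - 1) + j/2 + d = 0,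
    which is where the mean -1 fits.\<close>
  show ?thesis
    unfolding sum.distrib dist cut mid join split
    unfolding K_sum F_sum F_def[symmetric] FK[of j]
    by (simp add: algebra_simps)
qed

section \<open>Traces of powers and eigenvalues\<close>

lemma matrix_power_0 [simp]: "matrix_power A 0 = mat 1"
  by (simp add: matrix_power_def)

lemma matrix_power_Suc: "matrix_power A (Suc j) = A ** matrix_power A j"
  by (simp add: matrix_power_def)

lemma matrix_power_commute: "A ** matrix_power A j = matrix_power A j ** A"
  by (induction j) (auto simp: matrix_power_Suc matrix_mul_assoc)

lemma matrix_power_add: "matrix_power A (i + j) = matrix_power A i ** matrix_power A j"
  by (induction i) (auto simp: matrix_power_Suc matrix_mul_assoc)

lemma power_sum_empty [simp]: "power_sum {#} U = 1"
  by (simp add: power_sum_def)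

lemma power_sum_add_mset: "power_sum (add_mset j q) U = trace (matrix_power U j) * power_sum q U"
proof -
  have "power_sum lam U = (\<Prod>j\<in>#lam. trace (matrix_power U j))" for lam
    by (simp add: power_sum_def image_prod_mset_multiplicity)
  then show ?thesis by simp
qed

section \<open>Determinants over power series and Newton's identities\<close>

lemma det_hom:
  fixes h :: "'a::comm_ring_1 \<Rightarrow> 'b::comm_ring_1" and B :: "'a^'m^'m"
  assumes h0: "h 0 = 0" and h1: "h 1 = 1" and add: "\<And>x y. h (x + y) = h x + h y"
    and mult: "\<And>x y. h (x * y) = h x * h y"
  shows "det (map_matrix h B) = h (det B)"
proof -
  have sum: "h (sum f S) = (\<Sum>i\<in>S. h (f i))" for f :: "'c \<Rightarrow> 'a" and S
    by (induction S rule: infinite_finite_induct) (auto simp: h0 add)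
  have prod: "h (prod f S) = (\<Prod>i\<in>S. h (f i))" for f :: "'c \<Rightarrow> 'a" and S
    by (induction S rule: infinite_finite_induct) (auto simp: h1 mult)
  have "h (- 1) = - 1"
    using add[of 1 "- 1"] by (simp add: h0 h1 eq_neg_iff_add_eq_0 add.commute)
  then have sgn: "h (of_int (sign p)) = of_int (sign p)" for p :: "'m \<Rightarrow> 'm"
    by (auto simp: sign_def h1)
  show ?thesis
    by (simp add: det_def sum prod mult sgn)
qed

lemma fps_deriv_prod:
  fixes f :: "'c \<Rightarrow> 'a::comm_ring_1 fps"
  assumes "finite S"
  shows "fps_deriv (prod f S) = (\<Sum>i\<in>S. fps_deriv (f i) * prod f (S - {i}))"
  using assms
proof (induction S)
  case (insert x S)
  have "(\<Sum>i\<in>S. fps_deriv (f i) * prod f (insert x S - {i})) = (\<Sum>i\<in>S. f x * (fps_deriv (f i) * prod f (S - {i})))"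
  proof (rule sum.cong)
    fix i assume "i \<in> S"
    then have "insert x S - {i} = insert x (S - {i})" using insert by auto
    then show "fps_deriv (f i) * prod f (insert x S - {i}) = f x * (fps_deriv (f i) * prod f (S - {i}))"
      using insert by (simp add: algebra_simps)
  qed simp
  then show ?case
    using insert by (simp add: sum_distrib_left algebra_simps)
qed simp

lemma fps_deriv_det:
  fixes M :: "'a::comm_ring_1 fps^'m^'m"
  shows "fps_deriv (det M) = (\<Sum>i\<in>UNIV. det (\<chi> r. if r = i then map_matrix fps_deriv M $ i else M $ r))"
proof -
  have "fps_deriv (det M) = (\<Sum>p | p permutes UNIV. \<Sum>i\<in>UNIV.
      of_int (sign p) * (fps_deriv (M $ i $ p i) * (\<Prod>r\<in>UNIV - {i}. M $ r $ p r)))"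
    unfolding det_def
    by (auto simp: fps_deriv_prod fps_deriv_sum sum_distrib_left sign_def intro!: sum.cong)
  also have "\<dots> = (\<Sum>i\<in>UNIV. \<Sum>p | p permutes UNIV.
      of_int (sign p) * (fps_deriv (M $ i $ p i) * (\<Prod>r\<in>UNIV - {i}. M $ r $ p r)))"
    by (rule sum.swap)
  also have "\<dots> = (\<Sum>i\<in>UNIV. det (\<chi> r. if r = i then map_matrix fps_deriv M $ i else M $ r))"
    unfolding det_def
  proof (intro sum.cong refl arg_cong2[where f = times])
    fix i p
    have "(\<Prod>r\<in>UNIV. (\<chi> r. if r = i then map_matrix fps_deriv M $ i else M $ r) $ r $ p r)
        = fps_deriv (M $ i $ p i) * (\<Prod>r\<in>UNIV - {i}. (\<chi> r. if r = i then map_matrix fps_deriv M $ i else M $ r) $ r $ p r)"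
      by (subst prod.remove[of _ i]) auto
    also have "(\<Prod>r\<in>UNIV - {i}. (\<chi> r. if r = i then map_matrix fps_deriv M $ i else M $ r) $ r $ p r) = (\<Prod>r\<in>UNIV - {i}. M $ r $ p r)"
      by (rule prod.cong) auto
    finally show "fps_deriv (M $ i $ p i) * (\<Prod>r\<in>UNIV - {i}. M $ r $ p r) =
      (\<Prod>r\<in>UNIV. (\<chi> r. if r = i then map_matrix fps_deriv M $ i else M $ r) $ r $ p r)" by simp
  qed
  finally show ?thesis .
qed

text \<open>Row i of the product is a combination of the rows of \<open>M\<close>; by multilinearity
  only the multiple of row i itself survives, the others repeat a row.\<close>

lemma det_replace_row:
  fixes M C :: "'a::comm_ring_1^'m^'m"
  shows "det (\<chi> r. if r = i then (C ** M) $ i else M $ r) = C $ i $ i * det M"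
proof -
  have row: "(C ** M) $ i = (\<Sum>k\<in>UNIV. C $ i $ k *s M $ k)"
    by (vector matrix_matrix_mult_def sum_component)
  have "det (\<chi> r. if r = i then (C ** M) $ i else M $ r)
      = (\<Sum>k\<in>UNIV. det (\<chi> r. if r = i then C $ i $ k *s M $ k else M $ r))"
    unfolding row using det_linear_row_sum[of UNIV i "\<lambda>_ k. C $ i $ k *s M $ k" "\<lambda>r. M $ r"] by simp
  also have "\<dots> = (\<Sum>k\<in>UNIV. C $ i $ k * (if k = i then det M else 0))"
  proof (rule sum.cong)
    fix k
    have "det (\<chi> r. if r = i then C $ i $ k *s M $ k else M $ r)
        = C $ i $ k * det (\<chi> r. if r = i then M $ k else M $ r)"
      by (rule det_row_mul)
    also have "det (\<chi> r. if r = i then M $ k else M $ r) = (if k = i then det M else 0)"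
    proof (cases "k = i")
      case True
      then have "(\<chi> r. if r = i then M $ k else M $ r) = M" by (vector)
      then show ?thesis using True by simp
    next
      case False
      then show ?thesis
        by (simp, intro det_identical_rows[where i = i and j = k]) (auto simp: row_def)
    qed
    finally show "det (\<chi> r. if r = i then C $ i $ k *s M $ k else M $ r) = C $ i $ k * (if k = i then det M else 0)" .
  qed simp
  also have "\<dots> = C $ i $ i * det M"
    by (simp add: if_distrib[of "times _"] sum.delta cong: if_cong)
  finally show ?thesis .
qed

text \<open>Jacobi's formula for det(1 - XA). The Neumann series is a left inverse of the matrix
  over power series, so each differentiated row, a row of -A, is a row of (-A R) M, and replacing
  rows one at a time produces the trace of -A R.\<close>

lemma fps_deriv_det_one_minus:
  fixes A :: "complex^'m^'m"
  defines "M \<equiv> (\<chi> i j. (if i = j then 1 else 0) - fps_X * fps_const (A $ i $ j)) :: complex fps^'m^'m"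
  shows "fps_deriv (det M) = - Abs_fps (\<lambda>k. trace (matrix_power A (Suc k))) * det M"
proof -
  \<comment> \<open>the Neumann series of the resolvent\<close>
  define R :: "complex fps^'m^'m" where "R = (\<chi> i j. Abs_fps (\<lambda>k. matrix_power A k $ i $ j))"
  define B :: "complex fps^'m^'m" where "B = map_matrix fps_const A"
  have RM: "R ** M = mat 1"
  proof -
    have "fps_nth ((R ** M) $ i $ j) n = fps_nth (mat 1 $ i $ j) n" for i j n
    proof -
      have "(R ** M) $ i $ j = R $ i $ j - fps_X * (\<Sum>k\<in>UNIV. R $ i $ k * fps_const (A $ k $ j))"
        by (simp add: matrix_matrix_mult_def M_def algebra_simps sum_subtractf sum_distrib_left
             if_distrib[of "times _"] sum.delta cong: if_cong)
      also have "fps_nth \<dots> n = fps_nth (mat 1 $ i $ j) n"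
      proof (cases n)
        case 0
        then show ?thesis by (simp add: R_def mat_def)
      next
        case (Suc m)
        have "(matrix_power A m ** A) $ i $ j = matrix_power A n $ i $ j"
          by (simp add: Suc matrix_power_Suc matrix_power_commute)
        then show ?thesis
          by (simp add: Suc R_def mat_def matrix_matrix_mult_def fps_sum_nth)
      qed
      finally show ?thesis .
    qed
    then show ?thesis by (simp add: vec_eq_iff fps_eq_iff)
  qed
  have deriv: "map_matrix fps_deriv M = - B"
    by (simp add: vec_eq_iff M_def B_def)
  have "fps_deriv (det M) = (\<Sum>i\<in>UNIV. det (\<chi> r. if r = i then ((- B ** R) ** M) $ i else M $ r))"
    unfolding fps_deriv_det deriv matrix_mul_assoc[symmetric] RM matrix_mul_rid ..
  also have "\<dots> = trace (- B ** R) * det M"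
    unfolding det_replace_row by (simp add: trace_def sum_distrib_right)
  also have "trace (- B ** R) = - Abs_fps (\<lambda>k. trace (matrix_power A (Suc k)))"
    by (rule fps_ext) (simp add: trace_def B_def R_def matrix_power_Suc matrix_matrix_mult_def
        fps_sum_nth sum_negf)
  finally show ?thesis .
qed

text \<open>The reversed characteristic polynomial: away from z = 0 both sides come from z^m times
  the characteristic polynomial at 1/z, and polynomials that agree at infinitely many points are
  equal.\<close>

lemma det_one_minus_eigenvalues:
  fixes A :: "complex^'m^'m"
  shows "det ((\<chi> i j. (if i = j then 1 else 0) - fps_X * fps_const (A $ i $ j)) :: complex fps^'m^'m)
      = (\<Prod>x\<in>#mset (eigenvalues A). 1 - fps_const x * fps_X)"
proof -
  define B :: "complex poly^'m^'m" where "B = (\<chi> i j. (if i = j then 1 else 0) - [:0, A $ i $ j:])"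
  define c where "c = lead_coeff (charpoly A)"
  define E where "E = mset (eigenvalues A)"
  have charpoly: "charpoly A = smult c (\<Prod>x\<in>#E. [:- x, 1:])"
    unfolding c_def E_def mset_eigenvalues by (rule complex_poly_decompose_multiset[symmetric])
  have size_E: "size E = CARD('m)" by (simp add: E_def length_eigenvalues)
  have eval: "poly (det B) z = poly (smult c (\<Prod>x\<in>#E. [:1, - x:])) z" if "z \<noteq> 0" for z
  proof -
    have "poly (det B) z = det (map_matrix (\<lambda>p. poly p z) B)"
      by (rule det_hom[symmetric]) auto
    also have "map_matrix (\<lambda>p. poly p z) B
        = (\<chi> i. z *s map_matrix (\<lambda>p. poly p (inverse z)) (mat [:0, 1:] - map_matrix (\<lambda>a. [:a:]) A) $ i)"
      using that by (auto simp: vec_eq_iff B_def mat_def algebra_simps)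
    also have "det \<dots> = z ^ CARD('m) * poly (charpoly A) (inverse z)"
      unfolding charpoly_def det_rows_mul
      by (subst det_hom[symmetric, of "\<lambda>p. poly p (inverse z)"]) (auto simp: vec_lambda_eta)
    also have "\<dots> = c * (z ^ size E * (\<Prod>x\<in>#E. inverse z - x))"
      by (simp add: charpoly size_E poly_prod_mset image_mset.compositionality o_def)
    also have "z ^ size E * (\<Prod>x\<in>#E. inverse z - x) = (\<Prod>x\<in>#E. 1 - x * z)"
      using that by (induction E) (auto simp: field_simps)
    finally show ?thesis
      by (simp add: poly_prod_mset image_mset.compositionality o_def algebra_simps)
  qed
  have "det B = smult c (\<Prod>x\<in>#E. [:1, - x:])"
  proof (rule ccontr)
    assume "det B \<noteq> smult c (\<Prod>x\<in>#E. [:1, - x:])"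
    then have "finite {z. poly (det B - smult c (\<Prod>x\<in>#E. [:1, - x:])) z = 0}"
      by (intro poly_roots_finite) simp
    moreover have "UNIV - {0} \<subseteq> {z. poly (det B - smult c (\<Prod>x\<in>#E. [:1, - x:])) z = 0}"
      using eval by auto
    ultimately show False
      using infinite_UNIV_char_0[where 'a = complex] by (metis finite_Diff2 finite.simps finite_subset)
  qed
  \<comment> \<open>The value at 0 shows that the leading coefficient \<open>c\<close> is 1; so far
    only the degree of \<open>charpoly A\<close> is known.\<close>
  moreover have "poly (det B) 0 = 1"
  proof -
    have "poly (det B) 0 = det (map_matrix (\<lambda>p. poly p 0) B)"
      by (rule det_hom[symmetric]) auto
    also have "map_matrix (\<lambda>p. poly p 0) B = mat 1"
      by (simp add: vec_eq_iff B_def mat_def)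
    finally show ?thesis by simp
  qed
  moreover have "poly (smult c (\<Prod>x\<in>#E. [:1, - x:])) 0 = c"
    by (simp add: poly_prod_mset image_mset.compositionality o_def)
  ultimately have detB: "det B = (\<Prod>x\<in>#E. [:1, - x:])" by simp
  then have "fps_of_poly (det B) = (\<Prod>x\<in>#E. 1 - fps_const x * fps_X)"
  proof -
    have "fps_of_poly (\<Prod>x\<in>#E. [:1, - x:]) = (\<Prod>x\<in>#E. 1 - fps_const x * fps_X)"
      by (induction E) (simp_all add: fps_of_poly_mult fps_of_poly_linear' del: mult_pCons_left)
    then show ?thesis using detB by simp
  qed
  moreover have "det (map_matrix fps_of_poly B) = fps_of_poly (det B)"
    by (rule det_hom) (simp_all add: fps_of_poly_add fps_of_poly_mult)
  moreover have "map_matrix fps_of_poly B = (\<chi> i j. (if i = j then 1 else 0) - fps_X * fps_const (A $ i $ j))"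
  proof -
    have "fps_of_poly [:0, a:] = fps_X * fps_const a" for a :: complex
      by (simp add: fps_of_poly_pCons fps_of_poly_const mult.commute)
    then show ?thesis by (auto simp: vec_eq_iff B_def fps_of_poly_diff fps_of_poly_uminus)
  qed
  ultimately show ?thesis by (simp add: E_def)
qed

text \<open>The generating series of the traces and that of the power sums of eigenvalues are both
  minus the logarithmic derivative of det(1 - XA). The determinant has constant term 1 and can be
  cancelled, so no triangular form of the matrix is involved.\<close>

lemma trace_matrix_power_eigenvalues:
  fixes A :: "complex^'m^'m"
  assumes "0 < j"
  shows "trace (matrix_power A j) = (\<Sum>i<CARD('m). eigenvalues A ! i ^ j)"
proof -
  define E where "E = mset (eigenvalues A)"
  let ?Q = "\<lambda>E. \<Prod>x\<in>#E. (1 - fps_const x * fps_X :: complex fps)"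
  have deriv: "fps_deriv (?Q E) = - Abs_fps (\<lambda>k. \<Sum>x\<in>#E. x ^ Suc k) * ?Q E" for E
  proof (induction E)
    case empty
    then show ?case by (simp add: fps_eq_iff)
  next
    case (add x E)
    define a L S where "a = Abs_fps (\<lambda>k. x ^ Suc k)" and "L = 1 - fps_const x * fps_X"
      and "S = Abs_fps (\<lambda>k. \<Sum>y\<in>#E. y ^ Suc k)"
    have a: "a * L = fps_const x"
    proof (rule fps_ext)
      fix n
      have "a * L = a - fps_X * (fps_const x * a)"
        by (simp add: L_def algebra_simps)
      then show "fps_nth (a * L) n = fps_nth (fps_const x) n"
        by (cases n) (simp_all add: a_def)
    qed
    have "fps_deriv (?Q (add_mset x E)) = - (a * L) * ?Q E + L * fps_deriv (?Q E)"
      unfolding a by (simp add: L_def)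
    also have "\<dots> = - (a + S) * (L * ?Q E)"
      unfolding add S_def[symmetric] by (simp add: algebra_simps)
    also have "a + S = Abs_fps (\<lambda>k. \<Sum>y\<in>#add_mset x E. y ^ Suc k)"
      by (rule fps_ext) (simp add: a_def S_def)
    also have "L * ?Q E = ?Q (add_mset x E)"
      by (simp add: L_def)
    finally show ?case .
  qed
  have "fps_nth (?Q E) 0 = 1" for E by (induction E) simp_all
  then have "?Q E \<noteq> 0" by (metis fps_zero_nth zero_neq_one)
  moreover have "- Abs_fps (\<lambda>k. trace (matrix_power A (Suc k))) * ?Q E = - Abs_fps (\<lambda>k. \<Sum>x\<in>#E. x ^ Suc k) * ?Q E"
    using trans[OF sym[OF fps_deriv_det_one_minus[of A, unfolded det_one_minus_eigenvalues, folded E_def]] deriv[of E]] .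
  ultimately have "Abs_fps (\<lambda>k. trace (matrix_power A (Suc k))) = Abs_fps (\<lambda>k. \<Sum>x\<in>#E. x ^ Suc k)"
    by simp
  then have "trace (matrix_power A j) = (\<Sum>x\<in>#E. x ^ j)"
    using assms by (cases j) (simp_all add: fps_eq_iff)
  also have "\<dots> = sum_list (map (\<lambda>x. x ^ j) (eigenvalues A))"
    unfolding E_def mset_map[symmetric] sum_mset_sum_list ..
  also have "\<dots> = (\<Sum>i<CARD('m). eigenvalues A ! i ^ j)"
    by (simp add: sum_list_sum_nth length_eigenvalues atLeast0LessThan)
  finally show ?thesis .
qed

section \<open>Power sum expansion of the symplectic kernel\<close>

lemma unitary_norm_matrix_vector:
  fixes U :: "complex^'m^'m"
  assumes "U \<in> unitary_group"
  shows "norm (U *v v) = norm v"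
proof -
  have sq: "of_real ((norm w)\<^sup>2) = (\<Sum>i\<in>UNIV. cnj (w $ i) * w $ i)" for w :: "complex^'m"
  proof -
    have "(norm w)\<^sup>2 = (\<Sum>i\<in>UNIV. (norm (w $ i))\<^sup>2)"
      by (simp add: norm_vec_def L2_set_def sum_nonneg)
    then show ?thesis
      by (simp only: of_real_sum complex_norm_square) (simp add: mult.commute)
  qed
  have U: "(\<Sum>i\<in>UNIV. cnj (U $ i $ a) * U $ i $ b) = (if a = b then 1 else 0)" for a b
  proof -
    have "(conj_transpose U ** U) $ a $ b = mat 1 $ a $ b"
      using assms by (simp add: unitary_group_def)
    then show ?thesis by (simp add: matrix_matrix_mult_def conj_transpose_def transpose_def mat_def)
  qed
  have "(\<Sum>i\<in>UNIV. cnj ((U *v v) $ i) * (U *v v) $ i)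
      = (\<Sum>i\<in>UNIV. \<Sum>a\<in>UNIV. \<Sum>b\<in>UNIV. cnj (v $ a) * v $ b * (cnj (U $ i $ a) * U $ i $ b))"
    by (simp add: matrix_vector_mult_def sum_product) (simp add: mult_ac)
  also have "\<dots> = (\<Sum>a\<in>UNIV. \<Sum>b\<in>UNIV. cnj (v $ a) * v $ b * (\<Sum>i\<in>UNIV. cnj (U $ i $ a) * U $ i $ b))"
    unfolding sum_distrib_left by (subst sum.swap, rule sum.cong[OF refl], rule sum.swap)
  also have "\<dots> = (\<Sum>a\<in>UNIV. cnj (v $ a) * v $ a)"
    by (simp add: U if_distrib[of "times _"] cong: if_cong)
  finally have "of_real ((norm (U *v v))\<^sup>2) = (of_real ((norm v)\<^sup>2) :: complex)"
    unfolding sq .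
  then have "(norm (U *v v))\<^sup>2 = (norm v)\<^sup>2" by (simp only: of_real_eq_iff)
  then show ?thesis by simp
qed

text \<open>An eigenvector is stretched by exactly r. Consequently all products of two eigenvalues
  are at most r^2 in modulus, uniformly in U.\<close>

lemma norm_eigenvalue_scaleR_unitary:
  fixes U :: "complex^'m^'m"
  assumes U: "U \<in> unitary_group" and r: "0 \<le> r" and x: "x \<in> set (eigenvalues (r *\<^sub>R U))"
  shows "norm x \<le> r"
proof -
  let ?A = "r *\<^sub>R U"
  have "charpoly ?A \<noteq> 0" using degree_charpoly[of ?A] by (intro notI) simp
  moreover have "x \<in># proots (charpoly ?A)"
    using x unfolding mset_eigenvalues[symmetric] by simp
  ultimately have "poly (charpoly ?A) x = 0" by simp
  moreover have "poly (charpoly ?A) x = det (map_matrix (\<lambda>p. poly p x) (mat [:0, 1:] - map_matrix (\<lambda>a. [:a:]) ?A))"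
    unfolding charpoly_def by (rule det_hom[symmetric]) auto
  moreover have "map_matrix (\<lambda>p. poly p x) (mat [:0, 1:] - map_matrix (\<lambda>a. [:a:]) ?A) = mat x - ?A"
    by (auto simp: vec_eq_iff mat_def)
  ultimately have "det (mat x - ?A) = 0" by simp
  then have "\<not> invertible (mat x - ?A)" by (simp add: invertible_det_nz)
  then obtain v where v: "v \<noteq> 0" "(mat x - ?A) *v v = 0"
    by (meson invertible_left_inverse matrix_left_invertible_ker)
  have "(mat x - ?A) *v v = x *s v - r *\<^sub>R (U *v v)"
    by (simp add: vec_eq_iff matrix_vector_mult_def mat_def sum_subtractf algebra_simps scaleR_sum_right
      if_distrib[of "\<lambda>y. y * _"] if_distrib[of "times _"] cong: if_cong)
  then have "x *s v = r *\<^sub>R (U *v v)" using v by simp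
  moreover have "norm (x *s v) = norm x * norm v"
    by (simp add: norm_vec_def norm_mult L2_set_right_distrib)
  ultimately have "norm x * norm v = r * norm v"
    using unitary_norm_matrix_vector[OF U] r by auto
  then show ?thesis using v by simp
qed

section \<open>Homogeneous components of the kernel in power sums\<close>

lemma matrix_power_scaleR: "matrix_power (r *\<^sub>R U) j = r ^ j *\<^sub>R matrix_power U j"
  by (induction j) (simp_all add: matrix_power_Suc matrix_scalar_ac scalar_matrix_assoc[symmetric])

lemma trace_scaleR: "trace (r *\<^sub>R (A :: complex^'m^'m)) = of_real r * trace A"
  by (simp add: trace_def sum_distrib_left scaleR_conv_of_real[where 'a = complex])

lemma power_sum_scaleR: "power_sum lam (r *\<^sub>R U) = of_real r ^ sum_mset lam * power_sum lam U"
  by (induction lam) (simp_all add: power_sum_add_mset matrix_power_scaleR trace_scaleR power_add)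

text \<open>The degree n part of exp(sum over j of p_j^2/2j - [j even] p_j/j), where the p_2j terms
  are collected as the even j. Each factor is E exp(g p_j / j) for a Gaussian g of variance j and
  mean -[j even], so its expansion in p_j has the moments of g, divided by j^c c!, as
  coefficients.\<close>

definition omega_coeff :: "nat \<Rightarrow> complex^'m^'m \<Rightarrow> complex"
  where "omega_coeff n A = (\<Sum>lam\<in>partitions_of n. sp_moment lam / zfac lam * power_sum lam A)"

lemma omega_coeff_scaleR: "omega_coeff n (r *\<^sub>R A) = of_real r ^ n * omega_coeff n A"
  by (auto simp: omega_coeff_def power_sum_scaleR sum_distrib_left partitions_of_def mult_ac intro!: sum.cong)

text \<open>Multiplying by \<open>j\<close> times the multiplicity of \<open>j\<close> is \<open>p\<^sub>j\<close> times the operator \<open>j \<partial>/\<partial>p\<^sub>j\<close>.\<close>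

lemma sum_partitions_remove_part:
  assumes j: "0 < j" "j \<le> n"
  shows "(\<Sum>lam\<in>partitions_of n. of_nat j * of_nat (count lam j) * (g lam / zfac lam * power_sum lam A))
     = trace (matrix_power A j) * (\<Sum>q\<in>partitions_of (n - j). g (add_mset j q) / zfac q * power_sum q A)"
proof -
  let ?f = "\<lambda>lam. of_nat j * of_nat (count lam j) * (g lam / zfac lam * power_sum lam A)"
  have "(\<Sum>lam\<in>partitions_of n. ?f lam) = (\<Sum>lam\<in>{lam\<in>partitions_of n. j \<in># lam}. ?f lam)"
    by (rule sum.mono_neutral_right) (auto simp: not_in_iff)
  also have "\<dots> = (\<Sum>q\<in>partitions_of (n - j). trace (matrix_power A j) * (g (add_mset j q) / zfac q * power_sum q A))"
  proof (rule sum.reindex_bij_witness[where i = "add_mset j" and j = "\<lambda>lam. lam - {#j#}"])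
    fix lam assume "lam \<in> {lam\<in>partitions_of n. j \<in># lam}"
    then obtain q where q: "lam = add_mset j q" "is_partition q"
      by (metis (no_types, lifting) insert_DiffM is_partition_simps(2) mem_Collect_eq partitions_of_def)
    then have "zfac q \<noteq> 0" by (simp add: zfac_nonzero)
    then show "trace (matrix_power A j) * (g (add_mset j (lam - {#j#})) / zfac (lam - {#j#}) * power_sum (lam - {#j#}) A) = ?f lam"
      using j by (simp add: q zfac_add_mset power_sum_add_mset del: of_nat_Suc)
  qed (use j in \<open>auto simp: partitions_of_def sum_mset_remove1\<close>)
  finally show ?thesis by (simp add: sum_distrib_left)
qed

lemma omega_coeff_0 [simp]: "omega_coeff 0 A = 1"
  by (simp add: omega_coeff_def partitions_of_0)

text \<open>Euler's operator: n is the sum of j times the multiplicity of j, so n times the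
  coefficient is a sum over removed parts. Integrating by parts in the removed part gives p_j^2 in
  degree n - 2j and, for even j = 2l, -p_2l in degree n - 2l: the logarithmic derivative of the
  exponential, read off coefficientwise.\<close>

lemma omega_coeff_recursion:
  "of_nat n * omega_coeff n A = (\<Sum>l=1..n div 2.
      ((trace (matrix_power A l))\<^sup>2 - trace (matrix_power A (2 * l))) * omega_coeff (n - 2 * l) A)"
proof -
  let ?p = "\<lambda>j. trace (matrix_power A j)"
  let ?H = "\<lambda>n. omega_coeff n A"
  have "of_nat n * ?H n = (\<Sum>lam\<in>partitions_of n. \<Sum>j=1..n.
      of_nat j * of_nat (count lam j) * (sp_moment lam / zfac lam * power_sum lam A))"
    unfolding omega_coeff_def sum_distrib_left
  proof (rule sum.cong)
    fix lam assume lam: "lam \<in> partitions_of n"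
    then have sub: "set_mset lam \<subseteq> {1..n}"
      using set_mset_partition_subset by (simp add: partitions_of_def)
    have "of_nat (sum_mset lam) = (\<Sum>i\<in>#lam. of_nat i :: complex)"
      by (induction lam) auto
    moreover have "sum_mset lam = n" using lam by (simp add: partitions_of_def)
    ultimately have "of_nat n = (\<Sum>j=1..n. of_nat j * of_nat (count lam j) :: complex)"
      unfolding sum_mset_eq_sum_count[OF sub] by (simp only: mult.commute)
    then show "of_nat n * (sp_moment lam / zfac lam * power_sum lam A) =
        (\<Sum>j=1..n. of_nat j * of_nat (count lam j) * (sp_moment lam / zfac lam * power_sum lam A))"
      by (simp only: sum_distrib_right)
  qed simp
  also have "\<dots> = (\<Sum>j=1..n. \<Sum>lam\<in>partitions_of n.
      of_nat j * of_nat (count lam j) * (sp_moment lam / zfac lam * power_sum lam A))"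
    by (rule sum.swap)
  also have "\<dots> = (\<Sum>j=1..n. ?p j * (\<Sum>q\<in>partitions_of (n - j). sp_moment (add_mset j q) / zfac q * power_sum q A))"
    by (rule sum.cong[OF refl], rule sum_partitions_remove_part) auto
  also have "\<dots> = (\<Sum>j=1..n. (if j \<le> n div 2 then (?p j)\<^sup>2 * ?H (n - 2 * j) else 0)
      - (if even j then ?p j * ?H (n - j) else 0))"
  proof (rule sum.cong)
    fix j assume j: "j \<in> {1..n}"
    have "(\<Sum>q\<in>partitions_of (n - j). sp_moment (add_mset j q) / zfac q * power_sum q A)
        = (\<Sum>q\<in>partitions_of (n - j). - of_bool (even j) * (sp_moment q / zfac q * power_sum q A)
          + of_nat j * of_nat (count q j) * (sp_moment (q - {#j#}) / zfac q * power_sum q A))"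
      by (rule sum.cong) (auto simp: sp_moment_add_mset algebra_simps add_divide_distrib diff_divide_distrib)
    also have "\<dots> = - of_bool (even j) * ?H (n - j)
        + (\<Sum>q\<in>partitions_of (n - j). of_nat j * of_nat (count q j) * (sp_moment (q - {#j#}) / zfac q * power_sum q A))"
      unfolding omega_coeff_def sum.distrib sum_distrib_left ..
    \<comment> \<open>The variance term removes a second part j. It exists only for 2j <= n;
      otherwise no partition of n - j contains j.\<close>
    also have "(\<Sum>q\<in>partitions_of (n - j). of_nat j * of_nat (count q j) * (sp_moment (q - {#j#}) / zfac q * power_sum q A))
        = (if j \<le> n div 2 then ?p j * ?H (n - 2 * j) else 0)"
    proof (cases "j \<le> n div 2")
      case True
      then have "n - j - j = n - 2 * j" "j \<le> n - j" by auto
      then show ?thesis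
        using j True by (subst sum_partitions_remove_part) (simp_all add: omega_coeff_def)
    next
      case False
      have "count q j = 0" if "q \<in> partitions_of (n - j)" for q
        using that False le_sum_mset[of j q] by (auto simp: partitions_of_def not_in_iff[symmetric])
      then show ?thesis using False by simp
    qed
    finally have E: "(\<Sum>q\<in>partitions_of (n - j). sp_moment (add_mset j q) / zfac q * power_sum q A)
        = - of_bool (even j) * ?H (n - j) + (if j \<le> n div 2 then ?p j * ?H (n - 2 * j) else 0)" .
    show "?p j * (\<Sum>q\<in>partitions_of (n - j). sp_moment (add_mset j q) / zfac q * power_sum q A)
        = (if j \<le> n div 2 then (?p j)\<^sup>2 * ?H (n - 2 * j) else 0) - (if even j then ?p j * ?H (n - j) else 0)"
      unfolding E by (auto simp: algebra_simps power2_eq_square)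
  qed simp
  also have "\<dots> = (\<Sum>j=1..n. if j \<le> n div 2 then (?p j)\<^sup>2 * ?H (n - 2 * j) else 0)
      - (\<Sum>j=1..n. if even j then ?p j * ?H (n - j) else 0)"
    by (rule sum_subtractf)
  also have "(\<Sum>j=1..n. if j \<le> n div 2 then (?p j)\<^sup>2 * ?H (n - 2 * j) else 0) = (\<Sum>l=1..n div 2. (?p l)\<^sup>2 * ?H (n - 2 * l))"
  proof -
    have E: "{j\<in>{1..n}. j \<le> n div 2} = {1..n div 2}" by auto
    show ?thesis unfolding E[symmetric] by (rule sum.inter_filter[symmetric]) simp
  qed
  also have "(\<Sum>j=1..n. if even j then ?p j * ?H (n - j) else 0) = (\<Sum>l=1..n div 2. ?p (2 * l) * ?H (n - 2 * l))"
  proof -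
    have "(\<Sum>j=1..n. if even j then ?p j * ?H (n - j) else 0) = (\<Sum>j\<in>{j\<in>{1..n}. even j}. ?p j * ?H (n - j))"
      by (rule sum.inter_filter[symmetric]) simp
    also have "\<dots> = (\<Sum>l=1..n div 2. ?p (2 * l) * ?H (n - 2 * l))"
      by (rule sum.reindex_bij_witness[where i = "\<lambda>l. 2 * l" and j = "\<lambda>j. j div 2"]) auto
    finally show ?thesis .
  qed
  finally show ?thesis by (simp add: sum_subtractf algebra_simps)
qed

section \<open>Products of geometric series\<close>

lemma fps_deriv_prod_geometric:
  fixes c :: "'c \<Rightarrow> 'a::comm_ring_1"
  assumes "finite I"
  shows "fps_deriv (\<Prod>i\<in>I. Abs_fps (\<lambda>m. c i ^ m))
      = Abs_fps (\<lambda>k. \<Sum>i\<in>I. c i ^ Suc k) * (\<Prod>i\<in>I. Abs_fps (\<lambda>m. c i ^ m))"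
  using assms
proof (induction I)
  case empty
  then show ?case by (simp add: fps_eq_iff)
next
  case (insert x I)
  define a g S W where "a = Abs_fps (\<lambda>k. c x ^ Suc k)" and "g = Abs_fps (\<lambda>m. c x ^ m)"
    and "S = Abs_fps (\<lambda>k. \<Sum>i\<in>I. c i ^ Suc k)" and "W = (\<Prod>i\<in>I. Abs_fps (\<lambda>m. c i ^ m))"
  have "fps_deriv g = a * g"
  proof (rule fps_ext)
    fix n
    have "(\<Sum>i=0..n. c x ^ Suc i * c x ^ (n - i)) = (\<Sum>i=0..n. c x ^ Suc n)"
      by (rule sum.cong) (auto simp: mult.assoc simp flip: power_add)
    then show "fps_nth (fps_deriv g) n = fps_nth (a * g) n"
      by (simp add: g_def a_def fps_mult_nth)
  qed
  then have "fps_deriv (g * W) = (a + S) * (g * W)"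
    using insert.IH unfolding S_def[symmetric] W_def[symmetric] by (simp add: algebra_simps)
  moreover have "a + S = Abs_fps (\<lambda>k. \<Sum>i\<in>insert x I. c i ^ Suc k)"
    using insert.hyps by (auto simp: a_def S_def fps_eq_iff)
  moreover have "g * W = (\<Prod>i\<in>insert x I. Abs_fps (\<lambda>m. c i ^ m))"
    using insert.hyps by (simp add: g_def W_def)
  ultimately show ?case by simp
qed

text \<open>The n-th coefficient is the complete homogeneous polynomial of the ratios, with
  nonnegative coefficients, so replacing every ratio by \<rho> dominates it. The majorant no longer
  depends on the ratios.\<close>

lemma norm_prod_geometric_le:
  fixes c :: "'c \<Rightarrow> complex"
  assumes "finite I" "\<And>i. i \<in> I \<Longrightarrow> norm (c i) \<le> \<rho>"
  shows "norm (fps_nth (\<Prod>i\<in>I. Abs_fps (\<lambda>m. c i ^ m)) n) \<le> fps_nth (\<Prod>i\<in>I. Abs_fps (\<lambda>m. \<rho> ^ m)) n"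
  using assms
proof (induction I arbitrary: n)
  case (insert x I)
  have IH: "norm (fps_nth (\<Prod>i\<in>I. Abs_fps (\<lambda>m. c i ^ m)) n) \<le> fps_nth (\<Prod>i\<in>I. Abs_fps (\<lambda>m. \<rho> ^ m)) n" for n
    by (rule insert.IH) (use insert in auto)
  have \<rho>: "0 \<le> \<rho>" "norm (c x) \<le> \<rho>" using order_trans[OF norm_ge_zero insert.prems[of x]] insert.prems[of x] by auto
  show ?case
    unfolding prod.insert[OF insert.hyps] fps_mult_nth
  proof (rule sum_norm_le)
    fix k
    have "norm (c x ^ k) \<le> \<rho> ^ k" using \<rho> by (simp add: norm_power power_mono)
    then show "norm (fps_nth (Abs_fps (\<lambda>m. c x ^ m)) k * fps_nth (\<Prod>i\<in>I. Abs_fps (\<lambda>m. c i ^ m)) (n - k))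
        \<le> fps_nth (Abs_fps (\<lambda>m. \<rho> ^ m)) k * fps_nth (\<Prod>i\<in>I. Abs_fps (\<lambda>m. \<rho> ^ m)) (n - k)"
      unfolding norm_mult fps_nth_Abs_fps by (rule mult_mono[OF _ IH]) (use \<rho> in auto)
  qed
qed (simp add: fps_one_def)

text \<open>Iterated Cauchy products; absolute summability is carried along because the next Cauchy
  product requires it.\<close>

lemma summable_prod_geometric:
  fixes c :: "'c \<Rightarrow> 'a::{real_normed_field,banach}"
  assumes "finite I" "\<And>i. i \<in> I \<Longrightarrow> norm (c i) < 1"
  shows "summable (\<lambda>n. norm (fps_nth (\<Prod>i\<in>I. Abs_fps (\<lambda>m. c i ^ m)) n)) \<and>
    (\<lambda>n. fps_nth (\<Prod>i\<in>I. Abs_fps (\<lambda>m. c i ^ m)) n) sums (\<Prod>i\<in>I. 1 / (1 - c i))"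
  using assms
proof (induction I)
  case empty
  have "(\<lambda>n. fps_nth (1 :: 'a fps) n) sums 1"
    using sums_single[of 0 "\<lambda>_. 1 :: 'a"] by (simp add: fps_one_def)
  moreover have "summable (\<lambda>n. norm (fps_nth (1 :: 'a fps) n))"
    by (rule summable_finite[of "{0}"]) auto
  ultimately show ?case by simp
next
  case (insert x I)
  define W where "W = (\<Prod>i\<in>I. Abs_fps (\<lambda>m. c i ^ m))"
  have x: "norm (c x) < 1" using insert.prems by simp
  have IH: "summable (\<lambda>n. norm (fps_nth W n))" "(\<lambda>n. fps_nth W n) sums (\<Prod>i\<in>I. 1 / (1 - c i))"
    using insert by (auto simp: W_def)
  have g: "summable (\<lambda>n. norm (c x ^ n))" "(\<lambda>n. c x ^ n) sums (1 / (1 - c x))"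
    using x by (auto simp: norm_power intro: geometric_sums)
  have nth: "fps_nth (\<Prod>i\<in>insert x I. Abs_fps (\<lambda>m. c i ^ m)) n = (\<Sum>i\<le>n. c x ^ i * fps_nth W (n - i))" for n
    using insert.hyps by (simp add: W_def fps_mult_nth atLeast0AtMost)
  have "(\<lambda>n. \<Sum>i\<le>n. c x ^ i * fps_nth W (n - i)) sums ((\<Sum>n. c x ^ n) * (\<Sum>n. fps_nth W n))"
    by (rule Cauchy_product_sums) (use g IH in auto)
  moreover have "summable (\<lambda>n. norm (\<Sum>i\<le>n. c x ^ i * fps_nth W (n - i)))"
  proof (rule summable_comparison_test')
    show "summable (\<lambda>n. \<Sum>i\<le>n. norm (c x ^ i) * norm (fps_nth W (n - i)))"
      using Cauchy_product_sums[of "\<lambda>n. norm (c x ^ n)" "\<lambda>n. norm (fps_nth W n)"] g IH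
      by (auto simp: sums_iff)
    show "norm (norm (\<Sum>i\<le>n. c x ^ i * fps_nth W (n - i))) \<le> (\<Sum>i\<le>n. norm (c x ^ i) * norm (fps_nth W (n - i)))" for n
      by (auto simp: norm_mult intro!: sum_norm_le)
  qed
  ultimately show ?case
    using insert.hyps g IH unfolding nth by (simp add: sums_iff)
qed

lemma sum_pairs_power:
  fixes x :: "nat \<Rightarrow> complex"
  shows "2 * (\<Sum>(k, i)\<in>(SIGMA k:{..<n}. {..<k}). (x i * x k) ^ l) = (\<Sum>i<n. x i ^ l)\<^sup>2 - (\<Sum>i<n. x i ^ (2 * l))"
proof -
  have "2 * (\<Sum>k<n. \<Sum>i<k. (x i * x k) ^ l) = (\<Sum>i<n. x i ^ l)\<^sup>2 - (\<Sum>i<n. x i ^ (2 * l))"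
  proof (induction n)
    case (Suc n)
    have "(\<Sum>i<n. (x i * x n) ^ l) = (\<Sum>i<n. x i ^ l) * x n ^ l"
      by (simp add: power_mult_distrib sum_distrib_right)
    moreover have "x n ^ (2 * l) = x n ^ l * x n ^ l"
      by (simp add: mult_2 power_add)
    ultimately show ?case using Suc
      by (simp add: algebra_simps power2_eq_square)
  qed simp
  then show ?thesis by (simp add: sum.Sigma)
qed

text \<open>Both sides satisfy the recursion given by the same logarithmic derivative. The variable
  of \<open>W\<close> counts pairs of eigenvalues, each of degree two; hence the halved index and
  the vanishing in odd degree.\<close>

lemma omega_coeff_eq_fps_nth:
  fixes A :: "complex^'m^'m"
  defines "W \<equiv> \<Prod>(k, i)\<in>(SIGMA k:{..<CARD('m)}. {..<k}). Abs_fps (\<lambda>m. (eigenvalues A ! i * eigenvalues A ! k) ^ m)"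
  shows "omega_coeff n A = (if even n then fps_nth W (n div 2) else 0)"
proof (induction n rule: less_induct)
  case (less n)
  let ?I = "SIGMA k:{..<CARD('m)}. {..<k}"
  let ?c = "\<lambda>(k, i). eigenvalues A ! i * eigenvalues A ! k"
  let ?q = "\<lambda>l. (trace (matrix_power A l))\<^sup>2 - trace (matrix_power A (2 * l))"
  have W: "W = (\<Prod>p\<in>?I. Abs_fps (\<lambda>m. ?c p ^ m))"
    unfolding W_def by (rule prod.cong) auto
  have q: "2 * (\<Sum>p\<in>?I. ?c p ^ l) = ?q l" if "0 < l" for l
    using sum_pairs_power[where n = "CARD('m)" and x = "\<lambda>i. eigenvalues A ! i" and l = l] that
    by (simp add: trace_matrix_power_eigenvalues case_prod_unfold)
  consider "n = 0" | "odd n" | m where "n = 2 * Suc m"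
    by (metis evenE mult_0_right not0_implies_Suc)
  then show ?case
  proof cases
    case 1
    have "fps_nth (\<Prod>p\<in>J. Abs_fps (\<lambda>m. ?c p ^ m)) 0 = 1" for J
      by (induction J rule: infinite_finite_induct) simp_all
    then show ?thesis using 1 unfolding W by simp
  next
    case 2
    have "of_nat n * omega_coeff n A = (\<Sum>l=1..n div 2. ?q l * omega_coeff (n - 2 * l) A)"
      by (rule omega_coeff_recursion)
    also have "\<dots> = 0"
    proof (intro sum.neutral ballI)
      fix l assume "l \<in> {1..n div 2}"
      then have l: "2 * l \<le> n" "n - 2 * l < n" by auto
      then have "odd (n - 2 * l)" using 2 by simp
      then show "?q l * omega_coeff (n - 2 * l) A = 0" using less[OF l(2)] by simp
    qed
    finally show ?thesis using 2 by (cases "n = 0") auto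
  next
    case 3
    have *: "fps_nth (fps_deriv W) m = fps_nth (Abs_fps (\<lambda>k. \<Sum>p\<in>?I. ?c p ^ Suc k) * W) m"
      unfolding W by (subst fps_deriv_prod_geometric) auto
    define s where "s k = (\<Sum>p\<in>?I. ?c p ^ Suc k)" for k
    from * have "of_nat (Suc m) * fps_nth W (Suc m) = (\<Sum>k=0..m. s k * fps_nth W (m - k))"
      by (simp only: s_def fps_mult_nth fps_deriv_nth fps_nth_Abs_fps Suc_eq_plus1)
    \<comment> \<open>Here n = 2 (m + 1), and this factor 2 is the one in front of the sum over
      pairs in \<open>sum_pairs_power\<close>.\<close>
    moreover have "of_nat n * fps_nth W (Suc m) = 2 * (of_nat (Suc m) * fps_nth W (Suc m))"
      unfolding 3 of_nat_mult by simp
    ultimately have "of_nat n * fps_nth W (Suc m) = (\<Sum>k=0..m. 2 * s k * fps_nth W (m - k))"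
      by (simp only: sum_distrib_left mult.assoc)
    also have "\<dots> = (\<Sum>k=0..m. ?q (Suc k) * fps_nth W (m - k))"
      by (rule sum.cong) (simp_all only: s_def q zero_less_Suc)
    also have "\<dots> = (\<Sum>l=1..Suc m. ?q l * fps_nth W (Suc m - l))"
      using sum.shift_bounds_cl_Suc_ivl[of "\<lambda>l. ?q l * fps_nth W (Suc m - l)" 0 m] by simp
    also have "\<dots> = (\<Sum>l=1..n div 2. ?q l * omega_coeff (n - 2 * l) A)"
    proof (rule sum.cong)
      fix l assume "l \<in> {1..n div 2}"
      then have l: "1 \<le> l" "l \<le> Suc m" using 3 by auto
      have "n - 2 * l = 2 * (Suc m - l)" using 3 by simp
      then have "omega_coeff (n - 2 * l) A = fps_nth W (Suc m - l)"
        using less[of "n - 2 * l"] l 3 by simp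
      then show "?q l * fps_nth W (Suc m - l) = ?q l * omega_coeff (n - 2 * l) A" by simp
    qed (simp add: 3)
    also have "\<dots> = of_nat n * omega_coeff n A" by (rule omega_coeff_recursion[symmetric])
    finally show ?thesis using 3 by (simp del: of_nat_Suc)
  qed
qed

text \<open>The bound b comes from the product with every ratio equal to r^2. It is the same for all
  U, which later allows integration term by term.\<close>

lemma omega_Sp_sums:
  fixes r :: real
  assumes r: "0 \<le> r" "r < 1"
  obtains b where "summable b"
    and "\<And>(U :: complex^'m^'m) n. U \<in> unitary_group \<Longrightarrow> norm (omega_coeff n (r *\<^sub>R U)) \<le> b n"
    and "\<And>U :: complex^'m^'m. U \<in> unitary_group \<Longrightarrow> (\<lambda>n. omega_coeff n (r *\<^sub>R U)) sums omega_Sp (r *\<^sub>R U)"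
proof -
  let ?I = "SIGMA k:{..<CARD('m)}. {..<k}"
  define B where "B = (\<Prod>p\<in>?I. Abs_fps (\<lambda>m. (r\<^sup>2) ^ m))"
  have r2: "norm (r\<^sup>2) < 1" using r by (simp add: power_less_one_iff abs_square_less_1)
  have even_sums: "(\<lambda>n. if even n then f (n div 2) else 0) sums s" if "f sums s" for f :: "nat \<Rightarrow> 'z::real_normed_vector" and s
  proof -
    have "(\<lambda>n. if even (2 * n) then f (2 * n div 2) else 0) sums s" using that by simp
    then show ?thesis
      by (subst (asm) sums_mono_reindex) (auto simp: strict_mono_def elim!: evenE)
  qed
  have "(\<lambda>n. fps_nth B n) sums (\<Prod>p\<in>?I. 1 / (1 - r\<^sup>2))"
    unfolding B_def by (rule summable_prod_geometric[THEN conjunct2]) (use r2 in auto)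
  then have "summable (\<lambda>n. if even n then fps_nth B (n div 2) else 0)"
    by (blast intro: sums_summable even_sums)
  moreover
  {
    fix U :: "complex^'m^'m" assume U: "U \<in> unitary_group"
    let ?A = "r *\<^sub>R U"
    let ?c = "\<lambda>(k, i). eigenvalues ?A ! i * eigenvalues ?A ! k"
    define W where "W = (\<Prod>p\<in>?I. Abs_fps (\<lambda>m. ?c p ^ m))"
    have W': "W = (\<Prod>(k, i)\<in>?I. Abs_fps (\<lambda>m. (eigenvalues ?A ! i * eigenvalues ?A ! k) ^ m))"
      unfolding W_def by (rule prod.cong) auto
    have ev: "norm (eigenvalues ?A ! i) \<le> r" if "i < CARD('m)" for i
      by (rule norm_eigenvalue_scaleR_unitary[OF U r(1)]) (use that in \<open>simp add: length_eigenvalues\<close>)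
    have c: "norm (?c p) \<le> r\<^sup>2" if "p \<in> ?I" for p
      using that r unfolding power2_eq_square by (auto simp: norm_mult intro!: mult_mono ev)
    have coeff: "omega_coeff n ?A = (if even n then fps_nth W (n div 2) else 0)" for n
      unfolding W' by (rule omega_coeff_eq_fps_nth)
    have "norm (omega_coeff n ?A) \<le> (if even n then fps_nth B (n div 2) else 0)" for n
      unfolding coeff W_def B_def using norm_prod_geometric_le[of ?I ?c "r\<^sup>2"] c by auto
    moreover have "(\<lambda>n. fps_nth W n) sums (\<Prod>p\<in>?I. 1 / (1 - ?c p))"
      unfolding W_def
    proof (rule summable_prod_geometric[THEN conjunct2])
      fix p assume "p \<in> ?I"
      show "norm (?c p) < 1" by (rule le_less_trans[OF c[OF \<open>p \<in> ?I\<close>]]) (use r2 in simp)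
    qed simp
    moreover have "(\<Prod>p\<in>?I. 1 / (1 - ?c p)) = omega_Sp ?A"
      unfolding omega_Sp_def by (subst prod.Sigma) (auto intro!: prod.cong)
    ultimately have "\<And>n. norm (omega_coeff n ?A) \<le> (if even n then fps_nth B (n div 2) else 0)"
      "(\<lambda>n. omega_coeff n ?A) sums omega_Sp ?A"
      unfolding coeff using even_sums by auto
  }
  ultimately show ?thesis by (rule that) auto
qed

section \<open>Invariant integration over unitary groups\<close>

lemma matrix_add_rdistrib: "(B + C) ** A = B ** A + C ** (A :: 'a::comm_ring_1^'n^'p)"
  by (vector matrix_matrix_mult_def sum.distrib[symmetric] algebra_simps)

lemma matrix_mult_sum_right: "A ** (\<Sum>i\<in>I. B i) = (\<Sum>i\<in>I. (A :: 'a::comm_ring_1^'n^'p) ** B i)"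
  by (induction I rule: infinite_finite_induct) (simp_all add: matrix_add_ldistrib)

lemma conj_transpose_nth [simp]: "conj_transpose A $ a $ b = cnj (A $ b $ a)"
  by (simp add: conj_transpose_def transpose_def)

lemma conj_transpose_mult: "conj_transpose (A ** B) = conj_transpose B ** conj_transpose A"
  by (simp add: vec_eq_iff matrix_matrix_mult_def mult.commute)

lemma conj_transpose_mat_1 [simp]: "conj_transpose (mat 1) = mat 1"
  by (simp add: vec_eq_iff mat_def)

lemma trace_conj_transpose: "trace (conj_transpose A) = cnj (trace A)"
  by (simp add: trace_def)

lemma unitary_group_mult: "A \<in> unitary_group \<Longrightarrow> B \<in> unitary_group \<Longrightarrow> A ** B \<in> unitary_group"
  unfolding unitary_group_def conj_transpose_mult mem_Collect_eq
  by (metis matrix_mul_assoc matrix_mul_rid)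

lemma norm_unitary_entry_le:
  assumes "U \<in> unitary_group"
  shows "norm (U $ a $ b) \<le> 1"
proof -
  have "U $ a $ b = (U *v axis b 1) $ a"
    by (simp add: matrix_vector_mult_def axis_def if_distrib[of "times _"] cong: if_cong)
  also have "norm \<dots> \<le> norm (U *v axis b 1)" by (rule Finite_Cartesian_Product.norm_nth_le)
  also have "\<dots> = norm (axis b (1::complex))" by (rule unitary_norm_matrix_vector[OF assms])
  also have "\<dots> = 1"
    by (simp add: norm_vec_def L2_set_def axis_def if_distrib[of norm] if_distrib[of "\<lambda>x. x ^ 2"] cong: if_cong)
  finally show ?thesis .
qed

lemma bounded_unitary_group: "bounded (unitary_group :: (complex^'m^'m) set)"
proof (rule boundedI)
  fix U :: "complex^'m^'m" assume U: "U \<in> unitary_group"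
  have "norm U \<le> (\<Sum>a\<in>UNIV. norm (U $ a))"
    unfolding norm_vec_def[of U] by (rule L2_set_le_sum) simp
  also have "\<dots> \<le> (\<Sum>a\<in>(UNIV :: 'm set). \<Sum>b\<in>(UNIV :: 'm set). norm (U $ a $ b))"
    by (rule sum_mono) (simp add: norm_vec_def L2_set_le_sum)
  also have "\<dots> \<le> (\<Sum>a\<in>(UNIV :: 'm set). \<Sum>b\<in>(UNIV :: 'm set). 1)"
    by (intro sum_mono norm_unitary_entry_le U)
  finally show "norm U \<le> (\<Sum>a\<in>(UNIV :: 'm set). \<Sum>b\<in>(UNIV :: 'm set). 1)" .
qed

lemma continuous_on_matrix_mult_left:
  fixes g :: "complex^'m^'m"
  shows "continuous_on S (\<lambda>h :: complex^'m^'m. g ** h)"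
  unfolding matrix_matrix_mult_def by (intro continuous_intros)

lemma continuous_on_matrix_power_entry [continuous_intros]:
  "continuous_on S (\<lambda>U. matrix_power U j $ a $ b)"
proof (induction j arbitrary: a b)
  case (Suc j)
  have "continuous_on S (\<lambda>U. \<Sum>c\<in>UNIV. U $ a $ c * matrix_power U j $ c $ b)"
    by (rule continuous_on_sum, rule continuous_on_mult)
       (intro continuous_on_component continuous_on_id, rule Suc.IH)
  then show ?case by (simp add: matrix_power_Suc matrix_matrix_mult_def)
qed simp

lemma continuous_on_power_sum [continuous_intros]: "continuous_on S (\<lambda>U. power_sum lam U)"
  by (induction lam) (auto simp: power_sum_add_mset trace_def intro!: continuous_intros)

lemma continuous_on_sum_mset [continuous_intros]:
  fixes F :: "'i \<Rightarrow> 'a::topological_space \<Rightarrow> complex"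
  assumes "\<And>i. i \<in># q \<Longrightarrow> continuous_on S (F i)"
  shows "continuous_on S (\<lambda>x. \<Sum>i\<in>#q. F i x)"
  using assms by (induction q) (auto intro!: continuous_intros)

section \<open>Derivatives of matrix powers and power sums along a curve\<close>

lemma has_vector_derivative_matrix_mult:
  fixes A B :: "real \<Rightarrow> complex^'m^'m"
  assumes "\<And>a b. ((\<lambda>t. A t $ a $ b) has_vector_derivative A' $ a $ b) (at t)"
    and "\<And>a b. ((\<lambda>t. B t $ a $ b) has_vector_derivative B' $ a $ b) (at t)"
  shows "((\<lambda>t. (A t ** B t) $ a $ b) has_vector_derivative (A' ** B t + A t ** B') $ a $ b) (at t)"
proof -
  have "((\<lambda>t. \<Sum>c\<in>UNIV. A t $ a $ c * B t $ c $ b) has_vector_derivative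
      (\<Sum>c\<in>UNIV. A t $ a $ c * B' $ c $ b + A' $ a $ c * B t $ c $ b)) (at t)"
    by (intro has_vector_derivative_sum has_vector_derivative_mult assms)
  then show ?thesis by (simp add: matrix_matrix_mult_def sum.distrib add.commute)
qed

lemma has_vector_derivative_matrix_power:
  fixes V :: "real \<Rightarrow> complex^'m^'m"
  assumes V: "\<And>a b. ((\<lambda>t. V t $ a $ b) has_vector_derivative (X ** V t) $ a $ b) (at t)"
  shows "((\<lambda>t. matrix_power (V t) j $ a $ b) has_vector_derivative
    (\<Sum>k<j. matrix_power (V t) k ** X ** matrix_power (V t) (j - k)) $ a $ b) (at t)"
proof (induction j arbitrary: a b)
  case (Suc j)
  let ?W = "matrix_power (V t)"
  have "((\<lambda>t. (V t ** matrix_power (V t) j) $ a $ b) has_vector_derivative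
     (X ** V t ** ?W j + V t ** (\<Sum>k<j. ?W k ** X ** ?W (j - k))) $ a $ b) (at t)"
    by (rule has_vector_derivative_matrix_mult[OF V Suc])
  also have "X ** V t ** ?W j + V t ** (\<Sum>k<j. ?W k ** X ** ?W (j - k))
      = (\<Sum>k<Suc j. ?W k ** X ** ?W (Suc j - k))"
    unfolding sum.lessThan_Suc_shift
    by (simp add: matrix_mult_sum_right matrix_power_Suc matrix_mul_assoc)
  finally show ?case by (simp only: matrix_power_Suc)
qed simp

lemma has_vector_derivative_trace_power:
  fixes V :: "real \<Rightarrow> complex^'m^'m"
  assumes V: "\<And>a b. ((\<lambda>t. V t $ a $ b) has_vector_derivative (X ** V t) $ a $ b) (at t)"
  shows "((\<lambda>t. trace (matrix_power (V t) j)) has_vector_derivative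
    of_nat j * trace (X ** matrix_power (V t) j)) (at t)"
proof -
  let ?W = "matrix_power (V t)"
  have "((\<lambda>t. trace (matrix_power (V t) j)) has_vector_derivative trace (\<Sum>k<j. ?W k ** X ** ?W (j - k))) (at t)"
    unfolding trace_def by (intro has_vector_derivative_sum has_vector_derivative_matrix_power V)
  also have "trace (\<Sum>k<j. ?W k ** X ** ?W (j - k)) = (\<Sum>k<j. trace (?W k ** X ** ?W (j - k)))"
    by (induction j) (simp_all add: trace_def sum.swap[of _ UNIV] sum_component)
  also have "\<dots> = (\<Sum>k<j. trace (X ** ?W j))"
  proof (rule sum.cong)
    fix k assume "k \<in> {..<j}"
    then have "?W j = ?W (j - k) ** ?W k" by (simp flip: matrix_power_add)
    then show "trace (?W k ** X ** ?W (j - k)) = trace (X ** ?W j)"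
      by (metis matrix_mul_assoc trace_mul_sym)
  qed simp
  finally show ?thesis by simp
qed

lemma add_mset_diff_single: "i \<in># q \<Longrightarrow> add_mset j q - {#i#} = add_mset j (q - {#i#})"
  by (metis add_mset_commute add_mset_remove_trivial insert_DiffM)

lemma has_vector_derivative_power_sum:
  fixes V :: "real \<Rightarrow> complex^'m^'m"
  assumes V: "\<And>a b. ((\<lambda>t. V t $ a $ b) has_vector_derivative (X ** V t) $ a $ b) (at t)"
  shows "((\<lambda>t. power_sum lam (V t)) has_vector_derivative
    (\<Sum>i\<in>#lam. of_nat i * trace (X ** matrix_power (V t) i) * power_sum (lam - {#i#}) (V t))) (at t)"
proof (induction lam)
  case (add j q)
  let ?F = "\<lambda>lam. \<Sum>i\<in>#lam. of_nat i * trace (X ** matrix_power (V t) i) * power_sum (lam - {#i#}) (V t)"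
  have "((\<lambda>t. trace (matrix_power (V t) j) * power_sum q (V t)) has_vector_derivative
      trace (matrix_power (V t) j) * ?F q + of_nat j * trace (X ** matrix_power (V t) j) * power_sum q (V t)) (at t)"
    by (rule has_vector_derivative_mult[OF has_vector_derivative_trace_power[OF V] add])
  moreover have "trace (matrix_power (V t) j) * ?F q
      = (\<Sum>i\<in>#q. of_nat i * trace (X ** matrix_power (V t) i) * power_sum (add_mset j q - {#i#}) (V t))"
    unfolding sum_mset_distrib_left
    by (rule arg_cong[where f = sum_mset], rule image_mset_cong) (simp add: add_mset_diff_single power_sum_add_mset)
  ultimately show ?case by (simp add: power_sum_add_mset add.commute)
qed simp

text \<open>Common setting for both groups. Containment in the bounded unitary group makes
  continuous functions integrable; closure under products makes left translations maps of
  \<open>G\<close>.\<close>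

locale unitary_haar =
  fixes G :: "(complex^'m^'m) set" and M :: "(complex^'m^'m) measure"
  assumes haar: "haar_prob G M" and subset: "G \<subseteq> unitary_group"
    and mult_closed: "\<And>g h. g \<in> G \<Longrightarrow> h \<in> G \<Longrightarrow> g ** h \<in> G"
begin

lemma prob_space: "prob_space M" and space_M: "space M = G"
  and sets_M: "sets M = sets (restrict_space borel G)"
  and distr_M: "g \<in> G \<Longrightarrow> distr M M (\<lambda>h. g ** h) = M"
  using haar by (auto simp: haar_prob_def)

lemma measurable_M: "continuous_on UNIV f \<Longrightarrow> f \<in> borel_measurable M"
  using borel_measurable_continuous_onI[of f] measurable_cong_sets[OF sets_M refl]
  by (metis measurable_restrict_space1)

lemma bounded_on_G:
  assumes "continuous_on UNIV f"
  obtains B where "0 \<le> B" "\<And>U. U \<in> G \<Longrightarrow> norm (f U :: complex) \<le> B"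
proof -
  \<comment> \<open>Bounds are taken on the closure of the unitary group, which is compact by
    boundedness alone.\<close>
  have "compact (closure (unitary_group :: (complex^'m^'m) set))"
    using bounded_unitary_group by (simp add: compact_closure)
  then have "compact (f ` closure unitary_group)"
    using assms by (intro compact_continuous_image) (auto intro: continuous_on_subset)
  then have "bounded (f ` closure unitary_group)" by (rule compact_imp_bounded)
  then obtain B where B: "\<And>y. y \<in> f ` closure unitary_group \<Longrightarrow> norm y \<le> B"
    unfolding bounded_iff by blast
  show ?thesis
  proof (rule that[of "max 0 B"])
    fix U assume "U \<in> G"
    then have "U \<in> closure unitary_group" using subset closure_subset by blast
    then show "norm (f U) \<le> max 0 B" using B[of "f U"] by auto
  qed simp
qed

lemma integrable_M: "continuous_on UNIV f \<Longrightarrow> integrable M (f :: _ \<Rightarrow> complex)"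
proof -
  assume f: "continuous_on UNIV f"
  interpret prob_space M by (rule prob_space)
  obtain B where "\<And>U. U \<in> G \<Longrightarrow> norm (f U) \<le> B" using bounded_on_G[OF f] by blast
  then show ?thesis
    by (intro integrable_const_bound[of _ B] measurable_M f) (auto intro!: AE_I2 simp: space_M)
qed

lemma integral_left_mult:
  assumes g: "g \<in> G" and f: "continuous_on UNIV f"
  shows "(LINT U|M. f (g ** U) :: complex) = (LINT U|M. f U)"
proof -
  have "(\<lambda>h. g ** h) \<in> measurable M M"
    unfolding measurable_cong_sets[OF sets_M sets_M]
  proof (rule measurable_restrict_space3)
    show "(\<lambda>h :: complex^'m^'m. g ** h) \<in> borel_measurable borel"
      by (intro borel_measurable_continuous_onI continuous_on_matrix_mult_left)
  qed (use g mult_closed in auto)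
  then have "integral\<^sup>L (distr M M (\<lambda>h. g ** h)) f = (LINT U|M. f (g ** U))"
    by (rule integral_distr) (rule measurable_M[OF f])
  then show ?thesis by (simp add: distr_M g)
qed

text \<open>By invariance the difference quotients along the curve integrate to zero. They converge
  to \<open>f'\<close>, and since the curve stays in \<open>G\<close>, the mean value inequality
  bounds all of them by one bound of \<open>f'\<close> on \<open>G\<close>, so dominated convergence
  applies.\<close>

lemma integral_derivative_eq_0:
  fixes f f' :: "complex^'m^'m \<Rightarrow> complex"
  assumes g: "\<And>t :: real. g t \<in> G" "g 0 = mat 1"
    and der: "\<And>t U. U \<in> G \<Longrightarrow> ((\<lambda>t. f (g t ** U)) has_vector_derivative f' (g t ** U)) (at t)"
    and f: "continuous_on UNIV f" and f': "continuous_on UNIV f'"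
  shows "(LINT U|M. f' U) = 0"
proof -
  obtain B where B: "0 \<le> B" "\<And>U. U \<in> G \<Longrightarrow> norm (f' U) \<le> B" using bounded_on_G[OF f'] by blast
  interpret prob_space M by (rule prob_space)
  define s where "s n U = of_real (real (Suc n)) * (f (g (1 / real (Suc n)) ** U) - f U)" for n U
  have cont: "continuous_on UNIV (\<lambda>U. f (g t ** U))" for t
    by (rule continuous_on_compose2[OF f continuous_on_matrix_mult_left]) simp
  have "(\<lambda>n. integral\<^sup>L M (s n)) \<longlonglongrightarrow> integral\<^sup>L M f'"
  proof (rule integral_dominated_convergence[where w = "\<lambda>_. B"])
    show "f' \<in> borel_measurable M" by (rule measurable_M[OF f'])
    show "s n \<in> borel_measurable M" for n
      unfolding s_def by (intro measurable_M continuous_intros cont f)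
    show "AE U in M. (\<lambda>n. s n U) \<longlonglongrightarrow> f' U"
    proof (rule AE_I2)
      fix U assume "U \<in> space M"
      then have U: "U \<in> G" by (simp add: space_M)
      have "((\<lambda>t. norm (f (g t ** U) - f U - t *\<^sub>R f' U) / norm t) \<longlongrightarrow> 0) (at 0)"
        using der[OF U, of 0] g(2) by (simp add: has_vector_derivative_def has_derivative_iff_norm)
      moreover have "\<forall>\<^sub>F t in at 0. norm (f (g t ** U) - f U - t *\<^sub>R f' U) / norm t
          = norm ((f (g t ** U) - f U) /\<^sub>R t - f' U)"
      proof (rule eventually_mono[OF eventually_neq_at_within])
        fix t :: real assume "t \<noteq> 0"
        then have "(f (g t ** U) - f U) /\<^sub>R t - f' U = (f (g t ** U) - f U - t *\<^sub>R f' U) /\<^sub>R t"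
          by (simp add: scaleR_diff_right)
        then show "norm (f (g t ** U) - f U - t *\<^sub>R f' U) / norm t = norm ((f (g t ** U) - f U) /\<^sub>R t - f' U)"
          by (simp only: norm_scaleR) (simp add: field_simps)
      qed
      ultimately have "((\<lambda>t. norm ((f (g t ** U) - f U) /\<^sub>R t - f' U)) \<longlongrightarrow> 0) (at 0)"
        by (rule Lim_transform_eventually)
      then have "((\<lambda>t. (f (g t ** U) - f U) /\<^sub>R t) \<longlongrightarrow> f' U) (at 0)"
        by (rule LIM_zero_cancel[OF tendsto_norm_zero_cancel])
      moreover have "filterlim (\<lambda>n. 1 / real (Suc n)) (at 0) sequentially"
        unfolding filterlim_at using LIMSEQ_inverse_real_of_nat by (auto simp: inverse_eq_divide)
      ultimately have "((\<lambda>n. (f (g (1 / real (Suc n)) ** U) - f U) /\<^sub>R (1 / real (Suc n))) \<longlongrightarrow> f' U) sequentially"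
        by (rule filterlim_compose)
      then show "(\<lambda>n. s n U) \<longlonglongrightarrow> f' U"
        by (simp add: s_def scaleR_conv_of_real)
    qed
    show "AE U in M. norm (s n U) \<le> B" for n
    proof (rule AE_I2)
      fix U assume "U \<in> space M"
      then have U: "U \<in> G" by (simp add: space_M)
      let ?t = "1 / real (Suc n)"
      have "norm (f (g ?t ** U) - f (g 0 ** U)) \<le> B * norm (?t - 0)"
      proof (rule differentiable_bound[where S = UNIV and f' = "\<lambda>t h. h *\<^sub>R f' (g t ** U)"])
        show "((\<lambda>t. f (g t ** U)) has_derivative (\<lambda>h. h *\<^sub>R f' (g t ** U))) (at t within UNIV)" for t
          using der[OF U] by (simp add: has_vector_derivative_def)
        show "onorm (\<lambda>h. h *\<^sub>R f' (g t ** U)) \<le> B" for t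
          by (rule onorm_bound) (use B U g mult_closed in \<open>auto simp: mult.commute[of B] intro!: mult_left_mono\<close>)
      qed auto
      then have le: "norm (f (g ?t ** U) - f U) \<le> B * norm (?t - 0)" using g(2) by simp
      have "norm (s n U) = real (Suc n) * norm (f (g ?t ** U) - f U)"
        by (simp only: s_def norm_mult norm_of_real abs_of_nat)
      also have "\<dots> \<le> real (Suc n) * (B * norm (?t - 0))"
        by (rule mult_left_mono[OF le]) simp
      also have "\<dots> = B" by (simp del: of_nat_Suc)
      finally show "norm (s n U) \<le> B" .
    qed
  qed simp
  moreover have "integral\<^sup>L M (s n) = 0" for n
    unfolding s_def using integral_left_mult[OF g(1) f, of "1 / real (Suc n)"]
    by (simp add: integrable_M cont f)
  ultimately show ?thesis by (simp add: LIMSEQ_const_iff)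
qed

end

section \<open>From one-parameter subgroups to loop equations\<close>

definition cscale :: "complex \<Rightarrow> complex^'m^'m \<Rightarrow> complex^'m^'m"
  where "cscale c A = (\<chi> a b. c * A $ a $ b)"

lemma cscale_nth [simp]: "cscale c A $ a $ b = c * A $ a $ b"
  by (simp add: cscale_def)

lemma cscale_mult_left: "cscale c A ** B = cscale c (A ** B)"
  by (simp add: vec_eq_iff matrix_matrix_mult_def sum_distrib_left mult.assoc)

lemma cscale_mult_right: "A ** cscale c B = cscale c (A ** B)"
  by (simp add: vec_eq_iff matrix_matrix_mult_def sum_distrib_left mult.left_commute)

lemma cscale_add: "cscale c (A + B) = cscale c A + cscale c B"
  by (simp add: vec_eq_iff distrib_left)

lemma cscale_cscale: "cscale c (cscale d A) = cscale (c * d) A"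
  by (simp add: vec_eq_iff mult.assoc)

lemma cscale_zero_right [simp]: "cscale c 0 = 0"
  by (simp add: vec_eq_iff)

lemma matrix_mult_minus_left: "(- A) ** B = - (A ** (B :: 'a::comm_ring_1^'n^'p))"
  by (simp add: vec_eq_iff matrix_matrix_mult_def sum_negf)

lemma matrix_mult_minus_right: "A ** (- B) = - ((A :: 'a::comm_ring_1^'n^'p) ** B)"
  by (simp add: vec_eq_iff matrix_matrix_mult_def sum_negf)

lemma matrix_mult_triple_nth:
  fixes A B X :: "complex^'m^'m"
  shows "(A ** X ** B) $ a $ b = (\<Sum>c\<in>UNIV. \<Sum>d\<in>UNIV. X $ c $ d * (A $ a $ c * B $ d $ b))"
proof -
  have "(A ** X ** B) $ a $ b = (\<Sum>d\<in>UNIV. \<Sum>c\<in>UNIV. X $ c $ d * (A $ a $ c * B $ d $ b))"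
    by (simp add: matrix_matrix_mult_def sum_distrib_right) (simp add: mult_ac)
  then show ?thesis by (subst sum.swap) simp
qed

lemma trace_mult_nth:
  fixes A B :: "complex^'m^'m"
  shows "trace (A ** B) = (\<Sum>c\<in>UNIV. \<Sum>d\<in>UNIV. A $ c $ d * B $ d $ c)"
  by (simp add: trace_def matrix_matrix_mult_def)

text \<open>The derivative of \<open>(V\<^sup>j)\<^sub>a\<^sub>b p\<^sub>\<lambda> cnj p\<^sub>\<mu>\<close> at a unitary \<open>V\<close> in the direction \<open>X V\<close>, for \<open>X\<close> anti-Hermitian,
  is complex linear in \<open>X\<close>; \<open>loop_integrand\<close> is the coefficient of the entry \<open>X\<^sub>c\<^sub>d\<close>.\<close>

definition loop_integrand ::
    "nat \<Rightarrow> nat multiset \<Rightarrow> nat multiset \<Rightarrow> 'm \<Rightarrow> 'm \<Rightarrow> 'm \<Rightarrow> 'm \<Rightarrow> complex^'m^'m \<Rightarrow> complex"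
  where "loop_integrand j lam mu a b c d V =
    (\<Sum>k<j. matrix_power V k $ a $ c * matrix_power V (j - k) $ d $ b)
        * power_sum lam V * cnj (power_sum mu V)
    + matrix_power V j $ a $ b
        * (\<Sum>i\<in>#lam. of_nat i * matrix_power V i $ d $ c * power_sum (lam - {#i#}) V) * cnj (power_sum mu V)
    - matrix_power V j $ a $ b * power_sum lam V
        * (\<Sum>m\<in>#mu. of_nat m * cnj (matrix_power V m $ c $ d) * cnj (power_sum (mu - {#m#}) V))"

lemma continuous_on_loop_integrand [continuous_intros]:
  "continuous_on S (\<lambda>V. loop_integrand j lam mu a b c d V)"
  unfolding loop_integrand_def
  by (intro continuous_on_add continuous_on_diff continuous_on_mult continuous_on_sum continuous_on_cnj
      continuous_on_sum_mset continuous_on_const continuous_on_power_sum continuous_on_matrix_power_entry)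

lemma sum_mset_linear:
  fixes X :: "complex^'m^'m"
  shows "(\<Sum>i\<in>#q. of_nat i * (\<Sum>c\<in>UNIV. \<Sum>d\<in>UNIV. X $ c $ d * E i c d) * F i)
      = (\<Sum>c\<in>UNIV. \<Sum>d\<in>UNIV. X $ c $ d * (\<Sum>i\<in>#q. of_nat i * E i c d * F i))"
proof (induction q)
  case (add i q)
  have "of_nat i * (\<Sum>c\<in>UNIV. \<Sum>d\<in>UNIV. X $ c $ d * E i c d) * F i
      = (\<Sum>c\<in>UNIV. \<Sum>d\<in>UNIV. X $ c $ d * (of_nat i * E i c d * F i))"
    by (simp add: sum_distrib_left sum_distrib_right mult_ac)
  then show ?case by (simp add: add sum.distrib distrib_left)
qed simp

context unitary_haar
begin

lemma loop_equation_generator: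
  assumes g: "\<And>t :: real. g t \<in> G" "g 0 = mat 1"
    and g_deriv: "\<And>t a b. ((\<lambda>t. g t $ a $ b) has_vector_derivative (X ** g t) $ a $ b) (at t)"
    and anti: "\<And>c d. cnj (X $ c $ d) = - X $ d $ c"
  shows "(\<Sum>c\<in>UNIV. \<Sum>d\<in>UNIV. X $ c $ d * (LINT V|M. loop_integrand j lam mu a b c d V)) = 0"
proof -
  define f where "f V = matrix_power V j $ a $ b * power_sum lam V * cnj (power_sum mu V)" for V :: "complex^'m^'m"
  define f' where "f' V = (\<Sum>c\<in>UNIV. \<Sum>d\<in>UNIV. X $ c $ d * loop_integrand j lam mu a b c d V)" for V
  have "(LINT V|M. f' V) = 0"
  proof (rule integral_derivative_eq_0[where g = g])
    show "continuous_on UNIV f" "continuous_on UNIV f'"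
      unfolding f_def f'_def by (intro continuous_intros)+
    fix t and U :: "complex^'m^'m"
    let ?V = "\<lambda>t. g t ** U"
    let ?W = "matrix_power (?V t)"
    have V: "((\<lambda>t. ?V t $ a $ b) has_vector_derivative (X ** ?V t) $ a $ b) (at t)" for a b
    proof -
      have "((\<lambda>t. (g t ** U) $ a $ b) has_vector_derivative ((X ** g t) ** U + g t ** 0) $ a $ b) (at t)"
        by (rule has_vector_derivative_matrix_mult[OF g_deriv]) simp
      then show ?thesis by (simp add: matrix_mul_assoc)
    qed
    define A where "A = (\<Sum>k<j. ?W k ** X ** ?W (j - k)) $ a $ b"
    define B where "B lam = (\<Sum>i\<in>#lam. of_nat i * trace (X ** ?W i) * power_sum (lam - {#i#}) (?V t))" for lam
    have "((\<lambda>t. f (?V t)) has_vector_derivative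
      (?W j $ a $ b * power_sum lam (?V t)) * cnj (B mu)
        + (?W j $ a $ b * B lam + A * power_sum lam (?V t)) * cnj (power_sum mu (?V t))) (at t)"
      unfolding f_def A_def B_def
      by (intro has_vector_derivative_mult has_vector_derivative_cnj
          has_vector_derivative_matrix_power has_vector_derivative_power_sum V)
    moreover have "A = (\<Sum>c\<in>UNIV. \<Sum>d\<in>UNIV. X $ c $ d * (\<Sum>k<j. ?W k $ a $ c * ?W (j - k) $ d $ b))"
    proof -
      have "A = (\<Sum>k<j. \<Sum>c\<in>UNIV. \<Sum>d\<in>UNIV. X $ c $ d * (?W k $ a $ c * ?W (j - k) $ d $ b))"
        by (simp add: A_def sum_component matrix_mult_triple_nth)
      also have "\<dots> = (\<Sum>c\<in>UNIV. \<Sum>d\<in>UNIV. \<Sum>k<j. X $ c $ d * (?W k $ a $ c * ?W (j - k) $ d $ b))"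
        by (subst sum.swap, rule sum.cong[OF refl], rule sum.swap)
      finally show ?thesis by (simp add: sum_distrib_left)
    qed
    moreover have "B lam = (\<Sum>c\<in>UNIV. \<Sum>d\<in>UNIV. X $ c $ d *
        (\<Sum>i\<in>#lam. of_nat i * ?W i $ d $ c * power_sum (lam - {#i#}) (?V t)))"
      unfolding B_def trace_mult_nth by (rule sum_mset_linear)
    \<comment> \<open>Conjugation would make this factor antilinear in X. Anti-Hermiticity replaces
      \<open>cnj (X $ c $ d)\<close> by \<open>- X $ d $ c\<close>, which restores complex linearity
      and produces the minus sign in \<open>loop_integrand\<close>.\<close>
    moreover have "cnj (B mu) = - (\<Sum>c\<in>UNIV. \<Sum>d\<in>UNIV. X $ c $ d *
        (\<Sum>i\<in>#mu. of_nat i * cnj (?W i $ c $ d) * cnj (power_sum (mu - {#i#}) (?V t))))"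
    proof -
      have tr: "cnj (trace (X ** Y)) = - (\<Sum>c\<in>UNIV. \<Sum>d\<in>UNIV. X $ c $ d * cnj (Y $ c $ d))" for Y
      proof -
        have "cnj (trace (X ** Y)) = - (\<Sum>c\<in>UNIV. \<Sum>d\<in>UNIV. X $ d $ c * cnj (Y $ d $ c))"
          by (simp add: trace_mult_nth anti sum_negf)
        then show ?thesis by (subst sum.swap) simp
      qed
      have "cnj (B mu) = - (\<Sum>i\<in>#mu. of_nat i * (\<Sum>c\<in>UNIV. \<Sum>d\<in>UNIV. X $ c $ d * cnj (?W i $ c $ d))
          * cnj (power_sum (mu - {#i#}) (?V t)))"
      proof -
        have "cnj (\<Sum>i\<in>#q. of_nat i * trace (X ** ?W i) * F i) = - (\<Sum>i\<in>#q. of_nat i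
            * (\<Sum>c\<in>UNIV. \<Sum>d\<in>UNIV. X $ c $ d * cnj (?W i $ c $ d)) * cnj (F i))" for q F
          by (induction q) (simp_all add: tr)
        then show ?thesis by (simp only: B_def)
      qed
      then show ?thesis by (simp only: sum_mset_linear)
    qed
    ultimately show "((\<lambda>t. f (?V t)) has_vector_derivative f' (?V t)) (at t)"
      unfolding f'_def loop_integrand_def
      by (simp add: sum_distrib_left sum_distrib_right sum.distrib sum_subtractf algebra_simps)
  qed (use g in auto)
  also have "(LINT V|M. f' V) = (\<Sum>c\<in>UNIV. \<Sum>d\<in>UNIV. X $ c $ d * (LINT V|M. loop_integrand j lam mu a b c d V))"
    unfolding f'_def
    by (simp add: Bochner_Integration.integral_sum integrable_M continuous_intros)
  finally show ?thesis .
qed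

lemma integral_sum_mset:
  fixes F :: "'i \<Rightarrow> complex^'m^'m \<Rightarrow> complex"
  assumes "\<And>i. i \<in># q \<Longrightarrow> continuous_on UNIV (F i)"
  shows "(LINT U|M. (\<Sum>i\<in>#q. F i U)) = (\<Sum>i\<in>#q. LINT U|M. F i U)"
  using assms
proof (induction q)
  case (add i q)
  have "continuous_on UNIV (\<lambda>U. \<Sum>i\<in>#q. F i U)"
    by (rule continuous_on_sum_mset) (use add.prems in auto)
  then show ?case using add by (simp add: integrable_M)
qed simp

end

text \<open>Polarization on unit vectors: coordinate vectors give the diagonal, and (e_c + z
  e_d)/sqrt 2 with z = 1 and z = i separates the two off-diagonal entries. In this way rank-one
  projections reach every matrix unit.\<close>

lemma hermitian_form_eq_0:
  fixes I :: "'m::finite \<Rightarrow> 'm \<Rightarrow> complex"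
  assumes I: "\<And>v :: 'm \<Rightarrow> complex. (\<Sum>a\<in>UNIV. v a * cnj (v a)) = 1 \<Longrightarrow>
      (\<Sum>c\<in>UNIV. \<Sum>d\<in>UNIV. v c * cnj (v d) * I c d) = 0"
  shows "I c d = 0"
proof -
  have diag: "I c c = 0" for c
    using I[of "\<lambda>x. if x = c then 1 else 0"]
    by (simp add: if_distrib[of "times _"] if_distrib[of "\<lambda>x. x * _"] if_distrib[of cnj] cong: if_cong)
  show ?thesis
  proof (cases "c = d")
    case False
    define s :: complex where "s = of_real (1 / sqrt 2)"
    have s: "s * s = 1 / 2" "cnj s = s" "s \<noteq> 0"
      by (simp_all add: s_def flip: of_real_mult)
    have two: "(\<Sum>y\<in>UNIV. (if y = c then \<alpha> else if y = d then \<beta> else 0) * F y) = \<alpha> * F c + \<beta> * F d"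
      for \<alpha> \<beta> :: complex and F :: "'m \<Rightarrow> complex"
    proof -
      have "(\<Sum>y\<in>UNIV. (if y = c then \<alpha> else if y = d then \<beta> else 0) * F y)
          = (\<Sum>y\<in>UNIV. (if y = c then \<alpha> * F c else 0) + (if y = d then \<beta> * F d else 0))"
        by (rule sum.cong) (use False in auto)
      then show ?thesis by (simp add: sum.distrib)
    qed
    have rel: "cnj z * I c d + z * I d c = 0" if z: "z * cnj z = 1" for z
    proof -
      let ?v = "\<lambda>x. if x = c then s else if x = d then s * z else 0"
      have cnj_v: "cnj (?v x) = (if x = c then s else if x = d then s * cnj z else 0)" for x
        by (simp add: s)
      have "(\<Sum>a\<in>UNIV. ?v a * cnj (?v a)) = s * s + (s * z) * (s * cnj z)"
        unfolding two cnj_v using False by simp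
      also have "\<dots> = s * s * (1 + z * cnj z)" by (simp add: algebra_simps)
      also have "\<dots> = 1" by (simp add: z s)
      finally have "0 = (\<Sum>x\<in>UNIV. \<Sum>y\<in>UNIV. ?v x * cnj (?v y) * I x y)"
        using I[of ?v] by simp
      also have "\<dots> = (\<Sum>x\<in>UNIV. ?v x * (\<Sum>y\<in>UNIV. cnj (?v y) * I x y))"
        by (simp only: sum_distrib_left mult.assoc)
      also have "\<dots> = s * (s * I c c + s * cnj z * I c d) + s * z * (s * I d c + s * cnj z * I d d)"
        unfolding cnj_v two ..
      also have "\<dots> = s * s * (cnj z * I c d + z * I d c)"
        by (simp add: diag algebra_simps)
      finally show ?thesis by (simp add: s)
    qed
    have "I c d + I d c = 0" "- \<i> * I c d + \<i> * I d c = 0"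
      using rel[of 1] rel[of \<i>] by simp_all
    then have "I c d + I d c = 0" "I c d = I d c" by simp_all
    then show ?thesis by simp
  qed (use diag in simp)
qed

text \<open>For projections P and Q with P Q = Q P = 0 this is exp(it(P - Q)): phase e^{it} on the
  range of P, e^{-it} on the range of Q, and 1 on the rest. The unitary case takes Q = 0; the
  symplectic case needs phases in inverse pairs.\<close>

definition phase_curve :: "complex^'m^'m \<Rightarrow> complex^'m^'m \<Rightarrow> real \<Rightarrow> complex^'m^'m"
  where "phase_curve P Q t = mat 1 + cscale (cis t - 1) P + cscale (cis (- t) - 1) Q"

lemma phase_curve_0 [simp]: "phase_curve P Q 0 = mat 1"
  by (simp add: phase_curve_def vec_eq_iff)

context
  fixes P Q :: "complex^'m^'m"
  assumes proj: "P ** P = P" "Q ** Q = Q" "P ** Q = 0" "Q ** P = 0"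
begin

lemma phase_curve_mult: "phase_curve P Q s ** phase_curve P Q t = phase_curve P Q (s + t)"
proof -
  have "phase_curve P Q s ** phase_curve P Q t = mat 1 + cscale (cis t - 1) P + cscale (cis (- t) - 1) Q
      + cscale (cis s - 1) P + cscale ((cis t - 1) * (cis s - 1)) P
      + cscale (cis (- s) - 1) Q + cscale ((cis (- t) - 1) * (cis (- s) - 1)) Q"
    by (simp add: phase_curve_def matrix_add_ldistrib matrix_add_rdistrib cscale_mult_left cscale_mult_right proj
        cscale_add cscale_cscale add_ac)
  also have "\<dots> = phase_curve P Q (s + t)"
  proof -
    have "cis (s + t) = cis s * cis t" "cis (- (s + t)) = cis (- s) * cis (- t)"
      by (simp_all add: cis_mult)
    then show ?thesis by (simp only: phase_curve_def vec_eq_iff) (simp add: algebra_simps)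
  qed
  finally show ?thesis .
qed

lemma phase_curve_deriv:
  "((\<lambda>t. phase_curve P Q t $ a $ b) has_vector_derivative (cscale \<i> (P - Q) ** phase_curve P Q t) $ a $ b) (at t)"
proof -
  have "cscale \<i> (P - Q) = cscale \<i> P + cscale (- \<i>) Q"
    by (simp add: vec_eq_iff algebra_simps)
  then have "cscale \<i> (P - Q) ** phase_curve P Q t = cscale \<i> P + cscale (- \<i>) Q
      + cscale ((cis t - 1) * \<i>) P + cscale ((cis (- t) - 1) * - \<i>) Q"
    by (simp add: phase_curve_def matrix_add_ldistrib matrix_add_rdistrib cscale_mult_left cscale_mult_right proj
        cscale_add cscale_cscale)
  then have eq: "(cscale \<i> (P - Q) ** phase_curve P Q t) $ a $ b
      = \<i> * cis t * P $ a $ b + (- \<i> * cis (- t)) * Q $ a $ b"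
    by (simp add: algebra_simps)
  have "(cis has_vector_derivative \<i> * cis t) (at t)"
    unfolding has_vector_derivative_def by (auto intro!: derivative_eq_intros)
  moreover have "((\<lambda>t. cis (- t)) has_vector_derivative - \<i> * cis (- t)) (at t)"
    unfolding has_vector_derivative_def by (auto intro!: derivative_eq_intros)
  ultimately have "((\<lambda>t. mat 1 $ a $ b + (cis t - 1) * P $ a $ b + (cis (- t) - 1) * Q $ a $ b) has_vector_derivative
      \<i> * cis t * P $ a $ b + (- \<i> * cis (- t)) * Q $ a $ b) (at t)"
    by (auto intro!: derivative_eq_intros simp del: mult_minus_left)
  then show ?thesis unfolding eq by (simp add: phase_curve_def)
qed

lemma conj_transpose_phase_curve:
  assumes "conj_transpose P = P" "conj_transpose Q = Q"
  shows "conj_transpose (phase_curve P Q t) = phase_curve P Q (- t)"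
proof -
  have "cnj (P $ b $ a) = P $ a $ b" "cnj (Q $ b $ a) = Q $ a $ b" for a b
    using assms conj_transpose_nth by metis+
  then show ?thesis
    by (simp add: phase_curve_def vec_eq_iff mat_def cis_cnj)
qed

lemma phase_curve_unitary:
  assumes "conj_transpose P = P" "conj_transpose Q = Q"
  shows "phase_curve P Q t \<in> unitary_group"
  by (simp add: unitary_group_def conj_transpose_phase_curve[OF assms] phase_curve_mult)

end

definition rank_one :: "('m \<Rightarrow> complex) \<Rightarrow> complex^'m^'m"
  where "rank_one v = (\<chi> a b. v a * cnj (v b))"

lemma rank_one_nth [simp]: "rank_one v $ a $ b = v a * cnj (v b)"
  by (simp add: rank_one_def)

lemma rank_one_proj:
  assumes "(\<Sum>a\<in>UNIV. v a * cnj (v a)) = 1"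
  shows "rank_one v ** rank_one v = rank_one v"
proof -
  have "(\<Sum>c\<in>UNIV. v a * cnj (v c) * (v c * cnj (v b))) = v a * cnj (v b) * (\<Sum>c\<in>UNIV. v c * cnj (v c))" for a b
    by (simp add: sum_distrib_left mult_ac)
  then show ?thesis by (simp add: vec_eq_iff matrix_matrix_mult_def assms)
qed

lemma conj_transpose_rank_one [simp]: "conj_transpose (rank_one v) = rank_one v"
  by (simp add: vec_eq_iff mult.commute)

section \<open>Moments of the unitary group\<close>

lemma one_in_unitary_group: "mat 1 \<in> unitary_group"
  by (simp add: unitary_group_def)

lemma matrix_power_unitary: "V \<in> unitary_group \<Longrightarrow> matrix_power V k \<in> unitary_group"
  by (induction k) (simp_all add: matrix_power_Suc unitary_group_mult one_in_unitary_group)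

lemma trace_power_conj_power:
  fixes V :: "complex^'m^'m"
  assumes "V \<in> unitary_group"
  shows "trace (matrix_power V j ** conj_transpose (matrix_power V m)) =
    (if m < j then trace (matrix_power V (j - m)) else if m = j then of_nat CARD('m)
     else cnj (trace (matrix_power V (m - j))))"
proof -
  have inv: "matrix_power V k ** conj_transpose (matrix_power V k) = mat 1" for k
    using matrix_power_unitary[OF assms, of k] by (simp add: unitary_group_def)
  show ?thesis
  proof (cases "m \<le> j")
    case True
    then have "matrix_power V j = matrix_power V (j - m) ** matrix_power V m"
      by (simp flip: matrix_power_add)
    then have "matrix_power V j ** conj_transpose (matrix_power V m) = matrix_power V (j - m)"
      by (simp flip: matrix_mul_assoc add: inv)
    then show ?thesis using True by (auto simp: trace_I)
  next
    case False
    then have "matrix_power V m = matrix_power V (m - j) ** matrix_power V j"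
      by (simp flip: matrix_power_add)
    then have "matrix_power V j ** conj_transpose (matrix_power V m) = conj_transpose (matrix_power V (m - j))"
      by (simp add: conj_transpose_mult matrix_mul_assoc inv)
    then show ?thesis using False by (simp add: trace_conj_transpose)
  qed
qed

text \<open>Contracting the matrix entry with the direction closes the system on power sums: the
  derivative of the power factors into two traces, while the derivatives of the power sums become
  traces of products.\<close>

lemma sum_loop_integrand:
  fixes V :: "complex^'m^'m"
  shows "(\<Sum>c\<in>UNIV. \<Sum>d\<in>UNIV. loop_integrand j lam mu c d c d V) =
    (\<Sum>k<j. trace (matrix_power V k) * trace (matrix_power V (j - k))) * power_sum lam V * cnj (power_sum mu V)
    + (\<Sum>i\<in>#lam. of_nat i * trace (matrix_power V (i + j)) * power_sum (lam - {#i#}) V) * cnj (power_sum mu V)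
    - power_sum lam V * (\<Sum>m\<in>#mu. of_nat m * trace (matrix_power V j ** conj_transpose (matrix_power V m))
        * cnj (power_sum (mu - {#m#}) V))"
proof -
  let ?W = "matrix_power V"
  let ?S1 = "\<lambda>c d. \<Sum>k<j. ?W k $ c $ c * ?W (j - k) $ d $ d"
  let ?S2 = "\<lambda>c d. \<Sum>i\<in>#lam. of_nat i * ?W i $ d $ c * power_sum (lam - {#i#}) V"
  let ?S3 = "\<lambda>c d. \<Sum>m\<in>#mu. of_nat m * cnj (?W m $ c $ d) * cnj (power_sum (mu - {#m#}) V)"
  have "(\<Sum>c\<in>UNIV. \<Sum>d\<in>UNIV. loop_integrand j lam mu c d c d V)
      = (\<Sum>c\<in>UNIV. \<Sum>d\<in>UNIV. ?S1 c d) * power_sum lam V * cnj (power_sum mu V)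
      + (\<Sum>c\<in>UNIV. \<Sum>d\<in>UNIV. ?W j $ c $ d * ?S2 c d) * cnj (power_sum mu V)
      - power_sum lam V * (\<Sum>c\<in>UNIV. \<Sum>d\<in>UNIV. ?W j $ c $ d * ?S3 c d)"
    unfolding loop_integrand_def sum.distrib sum_subtractf sum_distrib_right sum_distrib_left
    by (simp add: mult_ac)
  also have "(\<Sum>c\<in>UNIV. \<Sum>d\<in>UNIV. ?S1 c d) = (\<Sum>k<j. trace (?W k) * trace (?W (j - k)))"
  proof -
    have "(\<Sum>c\<in>UNIV. \<Sum>d\<in>UNIV. ?S1 c d) = (\<Sum>c\<in>UNIV. \<Sum>k<j. \<Sum>d\<in>UNIV. ?W k $ c $ c * ?W (j - k) $ d $ d)"
      by (rule sum.cong[OF refl], rule sum.swap)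
    also have "\<dots> = (\<Sum>k<j. \<Sum>c\<in>UNIV. \<Sum>d\<in>UNIV. ?W k $ c $ c * ?W (j - k) $ d $ d)"
      by (rule sum.swap)
    finally show ?thesis by (simp add: trace_def sum_product)
  qed
  also have "(\<Sum>c\<in>UNIV. \<Sum>d\<in>UNIV. ?W j $ c $ d * ?S2 c d)
      = (\<Sum>i\<in>#lam. of_nat i * trace (?W (i + j)) * power_sum (lam - {#i#}) V)"
    unfolding sum_mset_linear[symmetric] add.commute[of _ j] matrix_power_add trace_mult_nth ..
  also have "(\<Sum>c\<in>UNIV. \<Sum>d\<in>UNIV. ?W j $ c $ d * ?S3 c d)
      = (\<Sum>m\<in>#mu. of_nat m * trace (?W j ** conj_transpose (?W m)) * cnj (power_sum (mu - {#m#}) V))"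
    unfolding sum_mset_linear[symmetric] trace_mult_nth conj_transpose_nth ..
  finally show ?thesis .
qed

lemma (in unitary_haar) integral_cong_G:
  assumes "\<And>U. U \<in> G \<Longrightarrow> f U = h U"
  shows "(LINT U|M. f U) = (LINT U|M. h U :: complex)"
  by (rule Bochner_Integration.integral_cong) (simp_all add: assms space_M)

lemma sum_mset_subtractf_complex:
  fixes f g :: "'i \<Rightarrow> complex"
  shows "(\<Sum>i\<in>#q. f i - g i) = (\<Sum>i\<in>#q. f i) - (\<Sum>i\<in>#q. g i)"
  by (induction q) simp_all

definition moment :: "(complex^'m^'m) measure \<Rightarrow> nat multiset \<Rightarrow> nat multiset \<Rightarrow> complex"
  where "moment M lam mu = (LINT U|M. power_sum lam U * cnj (power_sum mu U))"

lemma unitary_haar_unitary_group: "haar_prob unitary_group M \<Longrightarrow> unitary_haar unitary_group M"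
  by (simp add: unitary_haar_def unitary_group_mult)

lemma continuous_on_power_sum_product [continuous_intros]:
  "continuous_on S (\<lambda>U. power_sum lam U * cnj (power_sum mu U))"
  by (intro continuous_intros)

lemma unitary_loop_equation:
  fixes M :: "(complex^'m^'m) measure"
  assumes M: "haar_prob unitary_group M" and j: "0 < j"
  shows "of_nat CARD('m) * moment M (add_mset j q) mu
      + (\<Sum>k=1..<j. moment M (add_mset k (add_mset (j - k) q)) mu)
      + (\<Sum>i\<in>#q. of_nat i * moment M (add_mset (i + j) (q - {#i#})) mu)
    = (\<Sum>m\<in>#mu. of_nat m * (if m < j then moment M (add_mset (j - m) q) (mu - {#m#})
           else if m = j then of_nat CARD('m) * moment M q (mu - {#m#})
           else moment M q (add_mset (m - j) (mu - {#m#}))))"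
proof -
  interpret unitary_haar unitary_group M by (rule unitary_haar_unitary_group[OF M])
  \<comment> \<open>The directions i P with P a rank-one projection span all matrices over the
    complex numbers, so the integral for each single pair (c, d) vanishes.\<close>
  have zero: "(LINT V|M. loop_integrand j q mu a b c d V) = 0" for a b c d
  proof (rule hermitian_form_eq_0)
    fix v :: "'m \<Rightarrow> complex" assume v: "(\<Sum>a\<in>UNIV. v a * cnj (v a)) = 1"
    have proj: "rank_one v ** rank_one v = rank_one v" "(0 :: complex^'m^'m) ** 0 = 0"
      "rank_one v ** 0 = 0" "0 ** rank_one v = 0" by (simp_all add: rank_one_proj[OF v])
    have "conj_transpose (0 :: complex^'m^'m) = 0" by (simp add: vec_eq_iff)
    then have "(\<Sum>c\<in>UNIV. \<Sum>d\<in>UNIV. cscale \<i> (rank_one v - 0) $ c $ d * (LINT V|M. loop_integrand j q mu a b c d V)) = 0"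
      by (intro loop_equation_generator[where g = "phase_curve (rank_one v) 0"] phase_curve_unitary
          phase_curve_deriv proj) simp_all
    then have "\<i> * (\<Sum>c\<in>UNIV. \<Sum>d\<in>UNIV. v c * cnj (v d) * (LINT V|M. loop_integrand j q mu a b c d V)) = 0"
      by (simp add: sum_distrib_left mult.assoc)
    then show "(\<Sum>c\<in>UNIV. \<Sum>d\<in>UNIV. v c * cnj (v d) * (LINT V|M. loop_integrand j q mu a b c d V)) = 0"
      by simp
  qed
  let ?h = "\<lambda>lam mu V. power_sum lam V * cnj (power_sum mu V)"
  have "0 = (\<Sum>c\<in>UNIV. \<Sum>d\<in>UNIV. (LINT V|M. loop_integrand j q mu c d c d V))"
    by (simp add: zero)
  also have "\<dots> = (LINT V|M. (\<Sum>c\<in>UNIV. \<Sum>d\<in>UNIV. loop_integrand j q mu c d c d V))"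
    by (simp add: Bochner_Integration.integral_sum integrable_M continuous_intros)
  also have "\<dots> = (LINT V|M. of_nat CARD('m) * ?h (add_mset j q) mu V
      + (\<Sum>k=1..<j. ?h (add_mset k (add_mset (j - k) q)) mu V)
      + (\<Sum>i\<in>#q. of_nat i * ?h (add_mset (i + j) (q - {#i#})) mu V)
      - (\<Sum>m\<in>#mu. of_nat m * (if m < j then ?h (add_mset (j - m) q) (mu - {#m#}) V
           else if m = j then of_nat CARD('m) * ?h q (mu - {#m#}) V
           else ?h q (add_mset (m - j) (mu - {#m#})) V)))" (is "_ = (LINT V|M. ?R V)")
  proof (rule integral_cong_G)
    fix V :: "complex^'m^'m" assume V: "V \<in> unitary_group"
    \<comment> \<open>The term k = 0 contains the trace of the identity; it is the source of the
      leading coefficient \<open>CARD('m)\<close>.\<close>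
    have ins: "{..<j} = insert 0 {1..<j}" using j by auto
    have "(\<Sum>k<j. trace (matrix_power V k) * trace (matrix_power V (j - k))) * power_sum q V * cnj (power_sum mu V)
        = of_nat CARD('m) * ?h (add_mset j q) mu V + (\<Sum>k=1..<j. ?h (add_mset k (add_mset (j - k) q)) mu V)"
      unfolding ins by (simp add: trace_I power_sum_add_mset sum_distrib_right distrib_right mult.assoc)
    moreover have "(\<Sum>i\<in>#q. of_nat i * trace (matrix_power V (i + j)) * power_sum (q - {#i#}) V) * cnj (power_sum mu V)
        = (\<Sum>i\<in>#q. of_nat i * ?h (add_mset (i + j) (q - {#i#})) mu V)"
      unfolding sum_mset_distrib_right by (simp add: power_sum_add_mset mult.assoc)
    moreover have "power_sum q V * (\<Sum>m\<in>#mu. of_nat m * trace (matrix_power V j ** conj_transpose (matrix_power V m))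
          * cnj (power_sum (mu - {#m#}) V))
        = (\<Sum>m\<in>#mu. of_nat m * (if m < j then ?h (add_mset (j - m) q) (mu - {#m#}) V
           else if m = j then of_nat CARD('m) * ?h q (mu - {#m#}) V
           else ?h q (add_mset (m - j) (mu - {#m#})) V))"
      unfolding sum_mset_distrib_left trace_power_conj_power[OF V]
      by (rule arg_cong[where f = sum_mset], rule image_mset_cong)
         (simp add: power_sum_add_mset mult_ac)
    ultimately show "(\<Sum>c\<in>UNIV. \<Sum>d\<in>UNIV. loop_integrand j q mu c d c d V) = ?R V"
      unfolding sum_loop_integrand by simp
  qed
  also have "\<dots> = of_nat CARD('m) * moment M (add_mset j q) mu
      + (\<Sum>k=1..<j. moment M (add_mset k (add_mset (j - k) q)) mu)
      + (\<Sum>i\<in>#q. of_nat i * moment M (add_mset (i + j) (q - {#i#})) mu)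
      - (\<Sum>m\<in>#mu. of_nat m * (if m < j then moment M (add_mset (j - m) q) (mu - {#m#})
           else if m = j then of_nat CARD('m) * moment M q (mu - {#m#})
           else moment M q (add_mset (m - j) (mu - {#m#}))))"
  proof -
    have if_cont: "continuous_on UNIV (\<lambda>V. of_nat m * (if m < j then ?h (add_mset (j - m) q) (mu - {#m#}) V
           else if m = j then of_nat CARD('m) * ?h q (mu - {#m#}) V
           else ?h q (add_mset (m - j) (mu - {#m#})) V))" for m
      by (cases "m < j"; cases "m = j") (auto intro!: continuous_intros)
    have if_int: "(LINT V|M. of_nat m * (if m < j then ?h (add_mset (j - m) q) (mu - {#m#}) V
           else if m = j then of_nat CARD('m) * ?h q (mu - {#m#}) V
           else ?h q (add_mset (m - j) (mu - {#m#})) V))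
      = of_nat m * (if m < j then moment M (add_mset (j - m) q) (mu - {#m#})
           else if m = j then of_nat CARD('m) * moment M q (mu - {#m#})
           else moment M q (add_mset (m - j) (mu - {#m#})))" for m
      by (cases "m < j"; cases "m = j") (auto simp: moment_def)
    have int: "integrable M (\<lambda>V. ?h lam nu V)" for lam nu
      by (intro integrable_M continuous_intros)
    have c2: "continuous_on UNIV (\<lambda>V. \<Sum>i\<in>#q. of_nat i * ?h (add_mset (i + j) (q - {#i#})) mu V)"
      by (intro continuous_intros)
    have c3: "continuous_on UNIV (\<lambda>V. \<Sum>m\<in>#mu. of_nat m * (if m < j then ?h (add_mset (j - m) q) (mu - {#m#}) V
           else if m = j then of_nat CARD('m) * ?h q (mu - {#m#}) V
           else ?h q (add_mset (m - j) (mu - {#m#})) V))"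
      by (rule continuous_on_sum_mset) (rule if_cont)
    have s2: "(LINT V|M. (\<Sum>i\<in>#q. of_nat i * ?h (add_mset (i + j) (q - {#i#})) mu V))
        = (\<Sum>i\<in>#q. of_nat i * moment M (add_mset (i + j) (q - {#i#})) mu)"
      by (subst integral_sum_mset) (auto intro!: continuous_intros simp: moment_def)
    have s3: "(LINT V|M. (\<Sum>m\<in>#mu. of_nat m * (if m < j then ?h (add_mset (j - m) q) (mu - {#m#}) V
           else if m = j then of_nat CARD('m) * ?h q (mu - {#m#}) V
           else ?h q (add_mset (m - j) (mu - {#m#})) V)))
       = (\<Sum>m\<in>#mu. of_nat m * (if m < j then moment M (add_mset (j - m) q) (mu - {#m#})
           else if m = j then of_nat CARD('m) * moment M q (mu - {#m#})
           else moment M q (add_mset (m - j) (mu - {#m#}))))"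
      unfolding integral_sum_mset[OF if_cont] if_int ..
    show ?thesis
      unfolding s2[symmetric] s3[symmetric]
      using integrable_M[OF c2] integrable_M[OF c3] int
      by (simp add: moment_def Bochner_Integration.integral_sum)
  qed
  finally show ?thesis by simp
qed

text \<open>With \<open>mu\<close> fixed, the right-hand side of the loop equation pairs two
  partitions of the common size n - m or n - j, so it is known by induction. The difference of
  moment and candidate then solves the homogeneous equation in \<open>lam\<close>.\<close>

proposition unitary_moment_eq_zdelta:
  fixes M :: "(complex^'m^'m) measure"
  assumes M: "haar_prob unitary_group M"
    and "n \<le> CARD('m)" "lam \<in> partitions_of n" "mu \<in> partitions_of n"
  shows "moment M lam mu = zdelta lam mu"
  using assms(2-)
proof (induction n arbitrary: lam mu rule: less_induct)
  case (less n)
  interpret unitary_haar unitary_group M by (rule unitary_haar_unitary_group[OF M])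
  show ?case
  proof (cases "n = 0")
    case True
    then have "lam = {#}" "mu = {#}"
      using less.prems by (simp_all add: partitions_of_0)
    then show ?thesis
      using prob_space.prob_space[OF prob_space] by (simp add: moment_def zdelta_def)
  next
    case False
    have mu: "is_partition mu" "sum_mset mu = n" using less.prems by (auto simp: partitions_of_def)
    have "moment M lam mu - zdelta lam mu = 0"
    proof (rule cut_join_unique[where n = n and D = "CARD('m)" and e = "\<lambda>lam. moment M lam mu - zdelta lam mu"])
      fix j q assume j: "0 < j" and q: "is_partition q" and s: "j + sum_mset q = n"
      let ?D = "of_nat CARD('m) :: complex"
      have "(\<Sum>m\<in>#mu. of_nat m * (if m < j then moment M (add_mset (j - m) q) (mu - {#m#})
           else if m = j then ?D * moment M q (mu - {#m#})
           else moment M q (add_mset (m - j) (mu - {#m#}))))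
         = (\<Sum>m\<in>#mu. of_nat m * (if m < j then zdelta (add_mset (j - m) q) (mu - {#m#})
           else if m = j then ?D * zdelta q (mu - {#m#})
           else zdelta q (add_mset (m - j) (mu - {#m#}))))"
      proof (rule arg_cong[where f = sum_mset], rule image_mset_cong)
        fix m assume m: "m \<in># mu"
        then have m0: "0 < m" "m \<le> n" using mu le_sum_mset[OF m] by (auto simp: is_partition_def intro: gr0I)
        have sm: "sum_mset (mu - {#m#}) = n - m" using m mu by (simp add: sum_mset_remove1)
        have eq: "moment M l l' = zdelta l l'"
          if "is_partition l" "is_partition l'" "sum_mset l = sum_mset l'" "sum_mset l < n" for l l'
          using less.IH[of "sum_mset l" l l'] less.prems(1) that by (auto simp: partitions_of_def)
        have "m < j \<Longrightarrow> moment M (add_mset (j - m) q) (mu - {#m#}) = zdelta (add_mset (j - m) q) (mu - {#m#})"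
          by (rule eq) (use q mu s m0 sm in auto)
        moreover have "m = j \<Longrightarrow> moment M q (mu - {#m#}) = zdelta q (mu - {#m#})"
          by (rule eq) (use q mu s m0 sm in auto)
        moreover have "j < m \<Longrightarrow> moment M q (add_mset (m - j) (mu - {#m#})) = zdelta q (add_mset (m - j) (mu - {#m#}))"
          by (rule eq) (use q mu s m0 sm j in auto)
        ultimately show "of_nat m * (if m < j then moment M (add_mset (j - m) q) (mu - {#m#})
           else if m = j then ?D * moment M q (mu - {#m#})
           else moment M q (add_mset (m - j) (mu - {#m#})))
         = of_nat m * (if m < j then zdelta (add_mset (j - m) q) (mu - {#m#})
           else if m = j then ?D * zdelta q (mu - {#m#})
           else zdelta q (add_mset (m - j) (mu - {#m#})))"
          by auto
      qed
      then have "?D * moment M (add_mset j q) mu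
          + (\<Sum>k=1..<j. moment M (add_mset k (add_mset (j - k) q)) mu)
          + (\<Sum>i\<in>#q. of_nat i * moment M (add_mset (i + j) (q - {#i#})) mu)
        = ?D * zdelta (add_mset j q) mu
          + (\<Sum>k=1..<j. zdelta (add_mset k (add_mset (j - k) q)) mu)
          + (\<Sum>i\<in>#q. of_nat i * zdelta (add_mset (i + j) (q - {#i#})) mu)"
        unfolding unitary_loop_equation[OF M j] zdelta_loop_equation[OF j q mu(1)] .
      then show "?D * (moment M (add_mset j q) mu - zdelta (add_mset j q) mu)
          + (\<Sum>k=1..<j. moment M (add_mset k (add_mset (j - k) q)) mu - zdelta (add_mset k (add_mset (j - k) q)) mu)
          + (\<Sum>i\<in>#q. of_nat i * (moment M (add_mset (i + j) (q - {#i#})) mu - zdelta (add_mset (i + j) (q - {#i#})) mu)) = 0"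
        by (simp add: sum_subtractf sum_mset_subtractf_complex algebra_simps)
    qed (use less.prems False in auto)
    then show ?thesis by simp
  qed
qed

lemma matrix_power_cscale: "matrix_power (cscale z V) j = cscale (z ^ j) (matrix_power V j)"
proof (induction j)
  case 0
  then show ?case by (simp add: vec_eq_iff)
next
  case (Suc j)
  then show ?case by (simp add: matrix_power_Suc cscale_mult_left cscale_mult_right cscale_cscale mult.commute)
qed

lemma power_sum_cscale: "power_sum lam (cscale z V) = z ^ sum_mset lam * power_sum lam V"
  by (induction lam)
     (simp_all add: power_sum_add_mset matrix_power_cscale power_add trace_def sum_distrib_left sum_distrib_right mult_ac)

lemma unitary_moment_eq_0:
  fixes M :: "(complex^'m^'m) measure"
  assumes M: "haar_prob unitary_group M" and ne: "sum_mset lam \<noteq> sum_mset mu"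
  shows "moment M lam mu = 0"
proof -
  interpret unitary_haar unitary_group M by (rule unitary_haar_unitary_group[OF M])
  \<comment> \<open>Translation by the scalar matrix e^{i\<theta>} multiplies the integrand by
    e^{i\<theta>(|lam| - |mu|)}; this angle makes the factor equal to -1.\<close>
  define \<theta> where "\<theta> = pi / (real (sum_mset lam) - real (sum_mset mu))"
  define g :: "complex^'m^'m" where "g = cscale (cis \<theta>) (mat 1)"
  have "conj_transpose g = cscale (cis (- \<theta>)) (mat 1)"
    by (simp add: g_def vec_eq_iff mat_def cis_cnj)
  then have g: "g \<in> unitary_group"
    by (simp add: unitary_group_def g_def cscale_mult_left cscale_cscale cis_mult) (simp add: vec_eq_iff)
  have "real (sum_mset lam) * \<theta> - real (sum_mset mu) * \<theta> = pi"
    using ne unfolding left_diff_distrib[symmetric] by (simp add: \<theta>_def del: of_nat_sum_mset)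
  then have phase: "cis \<theta> ^ sum_mset lam * cnj (cis \<theta> ^ sum_mset mu) = - 1"
    unfolding Complex.DeMoivre cis_cnj cis_mult by (simp del: of_nat_sum_mset)
  have "moment M lam mu = (LINT U|M. power_sum lam (g ** U) * cnj (power_sum mu (g ** U)))"
    unfolding moment_def by (rule integral_left_mult[symmetric, OF g]) (intro continuous_intros)
  also have "\<dots> = (LINT U|M. - 1 * (power_sum lam U * cnj (power_sum mu U)))"
  proof (rule Bochner_Integration.integral_cong)
    fix U :: "complex^'m^'m"
    have "power_sum lam (g ** U) * cnj (power_sum mu (g ** U))
        = (cis \<theta> ^ sum_mset lam * cnj (cis \<theta> ^ sum_mset mu)) * (power_sum lam U * cnj (power_sum mu U))"
      by (simp add: g_def cscale_mult_left power_sum_cscale mult_ac)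
    then show "power_sum lam (g ** U) * cnj (power_sum mu (g ** U)) = - 1 * (power_sum lam U * cnj (power_sum mu U))"
      by (simp only: phase)
  qed simp
  also have "\<dots> = - moment M lam mu" by (simp add: moment_def)
  finally show ?thesis by simp
qed

section \<open>Moments of the unitary symplectic group\<close>

lemma transpose_symplectic_form: "transpose symplectic_form = - symplectic_form"
  by (auto simp: vec_eq_iff transpose_def symplectic_form_def split: sum.splits)

lemma conj_transpose_symplectic_form: "conj_transpose symplectic_form = - symplectic_form"
  by (auto simp: vec_eq_iff symplectic_form_def split: sum.splits)

lemma symplectic_form_skew: "symplectic_form $ d $ c = - symplectic_form $ c $ d"
  by (auto simp: symplectic_form_def split: sum.splits)

lemma symplectic_form_square:
  "symplectic_form ** symplectic_form = (- mat 1 :: complex^('n::finite + 'n)^('n + 'n))"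
proof -
  have "(\<Sum>c\<in>UNIV. symplectic_form $ a $ c * symplectic_form $ c $ b) = - mat 1 $ a $ b"
    for a b :: "'n + 'n"
    unfolding UNIV_Plus_UNIV[symmetric]
    by (subst sum.Plus, simp, simp, cases a; cases b)
       (simp_all add: symplectic_form_def mat_def if_distrib[of "\<lambda>x. x * _"] if_distrib[of "times _"] cong: if_cong)
  then show ?thesis by (simp add: vec_eq_iff matrix_matrix_mult_def)
qed

lemma symplectic_form_isotropic:
  "(\<Sum>c\<in>UNIV. \<Sum>d\<in>UNIV. symplectic_form $ c $ d * (w c * w d)) = 0"
proof -
  have "(\<Sum>c\<in>UNIV. \<Sum>d\<in>UNIV. symplectic_form $ c $ d * (w c * w d))
      = (\<Sum>c\<in>UNIV. \<Sum>d\<in>UNIV. symplectic_form $ d $ c * (w d * w c))"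
    by (rule sum.swap)
  also have "\<dots> = - (\<Sum>c\<in>UNIV. \<Sum>d\<in>UNIV. symplectic_form $ c $ d * (w c * w d))"
    unfolding sum_negf[symmetric]
    by (intro sum.cong refl) (subst symplectic_form_skew, simp add: mult.commute)
  finally show ?thesis by simp
qed

lemma unitary_symplectic_mult:
  assumes "A \<in> unitary_symplectic_group" "B \<in> unitary_symplectic_group"
  shows "A ** B \<in> unitary_symplectic_group"
proof -
  have "transpose (A ** B) ** symplectic_form ** (A ** B)
      = transpose B ** (transpose A ** symplectic_form ** A) ** B"
    by (simp add: matrix_transpose_mul matrix_mul_assoc)
  then show ?thesis
    using assms by (simp add: unitary_symplectic_group_def unitary_group_mult)
qed

lemma matrix_power_unitary_symplectic:
  "V \<in> unitary_symplectic_group \<Longrightarrow> matrix_power V k \<in> unitary_symplectic_group"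
proof (induction k)
  case 0
  then show ?case by (simp add: unitary_symplectic_group_def one_in_unitary_group)
qed (simp add: matrix_power_Suc unitary_symplectic_mult)

text \<open>On this group the J-twisted transpose is the inverse up to sign, so the transposes in
  the twisted contraction turn into negative powers of U.\<close>

lemma symplectic_transpose:
  assumes "W \<in> unitary_symplectic_group"
  shows "symplectic_form ** transpose W ** symplectic_form = - conj_transpose W"
proof -
  have "transpose W ** symplectic_form ** W = symplectic_form" "W ** conj_transpose W = mat 1"
    using assms by (auto simp: unitary_symplectic_group_def unitary_group_def)
  then have "transpose W ** symplectic_form = symplectic_form ** conj_transpose W"
    by (metis matrix_mul_assoc matrix_mul_rid)
  then show ?thesis
    by (simp add: matrix_mul_assoc[symmetric])
       (simp add: matrix_mul_assoc symplectic_form_square matrix_mult_minus_left)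
qed

lemma trace_transpose: "trace (transpose A) = trace A"
  by (simp add: trace_def transpose_def)

lemma trace_minus: "trace (- A :: 'a::comm_ring_1^'m^'m) = - trace A"
  by (simp add: trace_def sum_negf)

text \<open>W and its inverse have the same trace, since the inverse is conjugate under J to the
  transpose; hence traces of powers are real.\<close>

lemma cnj_trace_symplectic:
  assumes "W \<in> unitary_symplectic_group"
  shows "cnj (trace W) = trace W"
proof -
  have "cnj (trace W) = - trace (symplectic_form ** (transpose W ** symplectic_form))"
    using symplectic_transpose[OF assms] by (simp add: trace_conj_transpose[symmetric] matrix_mul_assoc trace_minus)
  also have "trace (symplectic_form ** (transpose W ** symplectic_form)) = trace (transpose W ** (symplectic_form ** symplectic_form))"
    by (subst trace_mul_sym) (simp add: matrix_mul_assoc)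
  finally show ?thesis
    by (simp add: symplectic_form_square matrix_mult_minus_right trace_minus trace_transpose)
qed

lemma trace_mult_transpose_nth:
  fixes A B :: "complex^'m^'m"
  shows "(\<Sum>c\<in>UNIV. \<Sum>d\<in>UNIV. A $ c $ d * B $ c $ d) = trace (A ** transpose B)"
  by (simp add: trace_mult_nth transpose_def)

text \<open>The contraction of the J-twisted half of the Lie algebra. Instead of two traces it gives
  the single trace of U^(2k - j), and instead of joining i and j it gives the power j - i with a
  minus sign.\<close>

lemma sum_loop_integrand_symplectic:
  fixes V :: "complex^('n::finite + 'n)^('n + 'n)"
  assumes V: "V \<in> unitary_symplectic_group"
  shows "(\<Sum>c\<in>UNIV. \<Sum>d\<in>UNIV. \<Sum>e\<in>UNIV. \<Sum>f\<in>UNIV.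
      symplectic_form $ e $ d * symplectic_form $ c $ f * loop_integrand j lam {#} c d e f V)
    = (\<Sum>k<j. trace (matrix_power V k ** conj_transpose (matrix_power V (j - k)))) * power_sum lam V
      - (\<Sum>i\<in>#lam. of_nat i * trace (matrix_power V j ** conj_transpose (matrix_power V i)) * power_sum (lam - {#i#}) V)"
proof -
  let ?W = "matrix_power V"
  let ?J = "symplectic_form :: complex^('n + 'n)^('n + 'n)"
  \<comment> \<open>For the matrix unit E at position (c, d), this is J E^T J.\<close>
  let ?X = "\<lambda>c d. \<chi> e f. ?J $ e $ d * ?J $ c $ f"
  have "(\<Sum>e\<in>UNIV. \<Sum>f\<in>UNIV. ?J $ e $ d * ?J $ c $ f * loop_integrand j lam {#} c d e f V)
      = (\<Sum>k<j. (?W k ** ?J) $ c $ d * (?J ** ?W (j - k)) $ c $ d) * power_sum lam V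
        + ?W j $ c $ d * (\<Sum>i\<in>#lam. of_nat i * (?J ** ?W i ** ?J) $ c $ d * power_sum (lam - {#i#}) V)" for c d
  proof -
    have "(\<Sum>e\<in>UNIV. \<Sum>f\<in>UNIV. ?J $ e $ d * ?J $ c $ f * loop_integrand j lam {#} c d e f V)
      = (\<Sum>e\<in>UNIV. \<Sum>f\<in>UNIV. \<Sum>k<j. (?W k $ c $ e * ?J $ e $ d) * (?J $ c $ f * ?W (j - k) $ f $ d)) * power_sum lam V
      + ?W j $ c $ d * (\<Sum>e\<in>UNIV. \<Sum>f\<in>UNIV. ?X c d $ e $ f * (\<Sum>i\<in>#lam. of_nat i * ?W i $ f $ e * power_sum (lam - {#i#}) V))"
      unfolding loop_integrand_def sum_distrib_right sum_distrib_left sum.distrib[symmetric]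
      by (intro sum.cong refl) (simp add: sum_distrib_left distrib_left mult_ac)
    also have "(\<Sum>e\<in>UNIV. \<Sum>f\<in>UNIV. \<Sum>k<j. (?W k $ c $ e * ?J $ e $ d) * (?J $ c $ f * ?W (j - k) $ f $ d))
        = (\<Sum>e\<in>UNIV. \<Sum>k<j. \<Sum>f\<in>UNIV. (?W k $ c $ e * ?J $ e $ d) * (?J $ c $ f * ?W (j - k) $ f $ d))"
      by (rule sum.cong[OF refl], rule sum.swap)
    also have "\<dots> = (\<Sum>k<j. \<Sum>e\<in>UNIV. \<Sum>f\<in>UNIV. (?W k $ c $ e * ?J $ e $ d) * (?J $ c $ f * ?W (j - k) $ f $ d))"
      by (rule sum.swap)
    also have "\<dots> = (\<Sum>k<j. (?W k ** ?J) $ c $ d * (?J ** ?W (j - k)) $ c $ d)"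
      by (simp add: matrix_matrix_mult_def sum_product)
    also have "(\<Sum>e\<in>UNIV. \<Sum>f\<in>UNIV. ?X c d $ e $ f * (\<Sum>i\<in>#lam. of_nat i * ?W i $ f $ e * power_sum (lam - {#i#}) V))
        = (\<Sum>i\<in>#lam. of_nat i * (?J ** ?W i ** ?J) $ c $ d * power_sum (lam - {#i#}) V)"
    proof -
      have "(\<Sum>e\<in>UNIV. \<Sum>f\<in>UNIV. ?X c d $ e $ f * ?W i $ f $ e) = (?J ** ?W i ** ?J) $ c $ d" for i
        unfolding matrix_mult_triple_nth by (subst sum.swap) (simp add: mult_ac)
      then show ?thesis unfolding sum_mset_linear[symmetric] by simp
    qed
    finally show ?thesis .
  qed
  then have "(\<Sum>c\<in>UNIV. \<Sum>d\<in>UNIV. \<Sum>e\<in>UNIV. \<Sum>f\<in>UNIV. ?J $ e $ d * ?J $ c $ f * loop_integrand j lam {#} c d e f V)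
    = (\<Sum>c\<in>UNIV. \<Sum>d\<in>UNIV. \<Sum>k<j. (?W k ** ?J) $ c $ d * (?J ** ?W (j - k)) $ c $ d) * power_sum lam V
      + (\<Sum>c\<in>UNIV. \<Sum>d\<in>UNIV. ?W j $ c $ d * (\<Sum>i\<in>#lam. of_nat i * (?J ** ?W i ** ?J) $ c $ d * power_sum (lam - {#i#}) V))"
    by (simp only: sum.distrib sum_distrib_right)
  also have "(\<Sum>c\<in>UNIV. \<Sum>d\<in>UNIV. \<Sum>k<j. (?W k ** ?J) $ c $ d * (?J ** ?W (j - k)) $ c $ d)
      = (\<Sum>k<j. trace (?W k ** conj_transpose (?W (j - k))))"
  proof -
    have "(\<Sum>c\<in>UNIV. \<Sum>d\<in>UNIV. \<Sum>k<j. (?W k ** ?J) $ c $ d * (?J ** ?W (j - k)) $ c $ d)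
        = (\<Sum>c\<in>UNIV. \<Sum>k<j. \<Sum>d\<in>UNIV. (?W k ** ?J) $ c $ d * (?J ** ?W (j - k)) $ c $ d)"
      by (rule sum.cong[OF refl], rule sum.swap)
    also have "\<dots> = (\<Sum>k<j. \<Sum>c\<in>UNIV. \<Sum>d\<in>UNIV. (?W k ** ?J) $ c $ d * (?J ** ?W (j - k)) $ c $ d)"
      by (rule sum.swap)
    also have "\<dots> = (\<Sum>k<j. trace (?W k ** conj_transpose (?W (j - k))))"
    proof (rule sum.cong[OF refl])
      fix k
      have "?W k ** ?J ** transpose (?J ** ?W (j - k)) = - (?W k ** (?J ** transpose (?W (j - k)) ** ?J))"
        by (simp add: matrix_transpose_mul transpose_symplectic_form matrix_mult_minus_right matrix_mul_assoc)
      also have "\<dots> = ?W k ** conj_transpose (?W (j - k))"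
        by (simp add: symplectic_transpose[OF matrix_power_unitary_symplectic[OF V]] matrix_mult_minus_right)
      finally show "(\<Sum>c\<in>UNIV. \<Sum>d\<in>UNIV. (?W k ** ?J) $ c $ d * (?J ** ?W (j - k)) $ c $ d)
          = trace (?W k ** conj_transpose (?W (j - k)))"
        unfolding trace_mult_transpose_nth by simp
    qed
    finally show ?thesis .
  qed
  also have "(\<Sum>c\<in>UNIV. \<Sum>d\<in>UNIV. ?W j $ c $ d * (\<Sum>i\<in>#lam. of_nat i * (?J ** ?W i ** ?J) $ c $ d * power_sum (lam - {#i#}) V))
      = - (\<Sum>i\<in>#lam. of_nat i * trace (?W j ** conj_transpose (?W i)) * power_sum (lam - {#i#}) V)"
  proof -
    have "(\<Sum>c\<in>UNIV. \<Sum>d\<in>UNIV. ?W j $ c $ d * (?J ** ?W i ** ?J) $ c $ d) = - trace (?W j ** conj_transpose (?W i))" for i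
    proof -
      have "transpose (?J ** ?W i ** ?J) = ?J ** transpose (?W i) ** ?J"
        by (simp add: matrix_transpose_mul transpose_symplectic_form matrix_mult_minus_right
            matrix_mult_minus_left matrix_mul_assoc)
      then show ?thesis
        unfolding trace_mult_transpose_nth
        by (simp add: symplectic_transpose[OF matrix_power_unitary_symplectic[OF V]] matrix_mult_minus_right trace_minus)
    qed
    moreover have "(\<Sum>i\<in>#q. - f i) = - (\<Sum>i\<in>#q. f i)" for f :: "nat \<Rightarrow> complex" and q
      by (induction q) simp_all
    ultimately show ?thesis
      unfolding sum_mset_linear[symmetric] by simp
  qed
  finally show ?thesis by simp
qed

text \<open>Q is the projection onto the line of J applied to the conjugate of v, which is
  orthogonal to v because J is skew. Since J Q = P^T J and J P = Q^T J, moving the curve past J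
  transposes it and reverses its phase, so J is preserved.\<close>

lemma symplectic_phase_curve:
  fixes v :: "'n::finite + 'n \<Rightarrow> complex"
  defines "P \<equiv> rank_one v"
  defines "Q \<equiv> - (symplectic_form ** transpose P ** symplectic_form)"
  assumes v: "(\<Sum>a\<in>UNIV. v a * cnj (v a)) = 1"
  shows "P ** P = P" "Q ** Q = Q" "P ** Q = 0" "Q ** P = 0" "conj_transpose Q = Q"
    and "phase_curve P Q t \<in> unitary_symplectic_group"
proof -
  let ?J = "symplectic_form :: complex^('n + 'n)^('n + 'n)"
  show PP: "P ** P = P" unfolding P_def by (rule rank_one_proj[OF v])
  have Pct: "conj_transpose P = P" by (simp add: P_def)
  have PJP: "P ** ?J ** transpose P = 0"
  proof -
    have "(P ** ?J ** transpose P) $ a $ b = v a * v b * (\<Sum>c\<in>UNIV. \<Sum>d\<in>UNIV. ?J $ c $ d * (cnj (v c) * cnj (v d)))" for a b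
      unfolding matrix_mult_triple_nth P_def by (simp add: transpose_def sum_distrib_left mult_ac)
    then show ?thesis by (simp add: vec_eq_iff symplectic_form_isotropic)
  qed
  have PTJP: "transpose P ** ?J ** P = 0"
  proof -
    have "(transpose P ** ?J ** P) $ a $ b = cnj (v a) * cnj (v b) * (\<Sum>c\<in>UNIV. \<Sum>d\<in>UNIV. ?J $ c $ d * (v c * v d))" for a b
      unfolding matrix_mult_triple_nth P_def by (simp add: transpose_def sum_distrib_left mult_ac)
    then show ?thesis by (simp add: vec_eq_iff symplectic_form_isotropic)
  qed
  have "Q ** Q = ?J ** transpose P ** (?J ** ?J) ** transpose P ** ?J"
    by (simp add: Q_def matrix_mult_minus_left matrix_mult_minus_right matrix_mul_assoc)
  also have "\<dots> = - (?J ** transpose (P ** P) ** ?J)"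
    by (simp add: symplectic_form_square matrix_mult_minus_left matrix_mult_minus_right matrix_transpose_mul matrix_mul_assoc)
  finally show QQ: "Q ** Q = Q" by (simp add: PP Q_def)
  have "P ** Q = - (P ** ?J ** transpose P ** ?J)"
    by (simp add: Q_def matrix_mult_minus_right matrix_mul_assoc)
  then show PQ: "P ** Q = 0" by (simp add: PJP)
  have "Q ** P = - (?J ** (transpose P ** ?J ** P))"
    by (simp add: Q_def matrix_mult_minus_left matrix_mul_assoc)
  then show QP: "Q ** P = 0" by (simp add: PTJP)
  have "conj_transpose (transpose P) = transpose P"
    by (simp add: vec_eq_iff P_def transpose_def mult.commute)
  moreover have "conj_transpose (- A) = - conj_transpose A" for A :: "complex^('n + 'n)^('n + 'n)"
    by (simp add: vec_eq_iff)
  ultimately show Qct: "conj_transpose Q = Q"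
    by (simp add: Q_def conj_transpose_mult conj_transpose_symplectic_form matrix_mult_minus_left
        matrix_mult_minus_right matrix_mul_assoc)
  note proj = PP QQ PQ QP
  let ?g = "phase_curve P Q t"
  have unitary: "?g \<in> unitary_group" by (rule phase_curve_unitary[OF proj Pct Qct])
  have JQ: "?J ** Q = transpose P ** ?J"
    by (simp add: Q_def matrix_mult_minus_right matrix_mul_assoc symplectic_form_square matrix_mult_minus_left)
  have "transpose (- A) = - transpose A" for A :: "complex^('n + 'n)^('n + 'n)"
    by (simp add: vec_eq_iff transpose_def)
  then have "transpose Q = - (?J ** P ** ?J)"
    by (simp add: Q_def matrix_transpose_mul transpose_symplectic_form matrix_mult_minus_right
        matrix_mult_minus_left matrix_mul_assoc)
  then have JP: "?J ** P = transpose Q ** ?J"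
    by (simp add: matrix_mult_minus_left matrix_mul_assoc[symmetric] symplectic_form_square matrix_mult_minus_right)
  have tr: "transpose (phase_curve P Q s) = mat 1 + cscale (cis s - 1) (transpose P) + cscale (cis (- s) - 1) (transpose Q)" for s
    by (simp add: phase_curve_def vec_eq_iff transpose_def mat_def)
  have "?J ** ?g = transpose (phase_curve P Q (- t)) ** ?J"
    unfolding tr
    by (simp add: phase_curve_def matrix_add_ldistrib matrix_add_rdistrib cscale_mult_left cscale_mult_right JP JQ)
  then have "transpose ?g ** ?J ** ?g = transpose (phase_curve P Q (- t) ** ?g) ** ?J"
    by (simp add: matrix_transpose_mul matrix_mul_assoc[symmetric])
  also have "\<dots> = ?J" by (simp add: phase_curve_mult[OF proj])
  finally show "?g \<in> unitary_symplectic_group"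
    using unitary by (simp add: unitary_symplectic_group_def)
qed

lemma sum_swap4:
  fixes F :: "'a::finite \<Rightarrow> 'a \<Rightarrow> 'a \<Rightarrow> 'a \<Rightarrow> complex"
  shows "(\<Sum>e\<in>UNIV. \<Sum>f\<in>UNIV. \<Sum>c\<in>UNIV. \<Sum>d\<in>UNIV. F e f c d)
    = (\<Sum>c\<in>UNIV. \<Sum>d\<in>UNIV. \<Sum>e\<in>UNIV. \<Sum>f\<in>UNIV. F e f c d)"
proof -
  have "(\<Sum>e\<in>UNIV. \<Sum>f\<in>UNIV. \<Sum>c\<in>UNIV. \<Sum>d\<in>UNIV. F e f c d)
      = (\<Sum>e\<in>UNIV. \<Sum>c\<in>UNIV. \<Sum>f\<in>UNIV. \<Sum>d\<in>UNIV. F e f c d)"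
    by (rule sum.cong[OF refl], rule sum.swap)
  also have "\<dots> = (\<Sum>c\<in>UNIV. \<Sum>e\<in>UNIV. \<Sum>f\<in>UNIV. \<Sum>d\<in>UNIV. F e f c d)"
    by (rule sum.swap)
  also have "\<dots> = (\<Sum>c\<in>UNIV. \<Sum>e\<in>UNIV. \<Sum>d\<in>UNIV. \<Sum>f\<in>UNIV. F e f c d)"
    by (rule sum.cong[OF refl], rule sum.cong[OF refl], rule sum.swap)
  also have "\<dots> = (\<Sum>c\<in>UNIV. \<Sum>d\<in>UNIV. \<Sum>e\<in>UNIV. \<Sum>f\<in>UNIV. F e f c d)"
    by (rule sum.cong[OF refl], rule sum.swap)
  finally show ?thesis .
qed

lemma unitary_haar_symplectic:
  "haar_prob unitary_symplectic_group M \<Longrightarrow> unitary_haar unitary_symplectic_group M"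
proof -
  have "unitary_symplectic_group \<subseteq> unitary_group" by (auto simp: unitary_symplectic_group_def)
  then show "haar_prob unitary_symplectic_group M \<Longrightarrow> unitary_haar unitary_symplectic_group M"
    by (simp add: unitary_haar_def unitary_symplectic_mult)
qed

text \<open>The Lie algebra of the symplectic group is complex-spanned by the matrices \<open>E + J E\<^sup>T J\<close>; this is
  the equation for the matrix unit \<open>E = E\<^sub>c\<^sub>d\<close>.\<close>

lemma symplectic_integral_loop_integrand:
  fixes M :: "(complex^('n::finite + 'n)^('n + 'n)) measure"
  assumes M: "haar_prob unitary_symplectic_group M"
  shows "(LINT V|M. loop_integrand j q mu a b c d V)
      + (\<Sum>e\<in>UNIV. \<Sum>f\<in>UNIV. symplectic_form $ e $ d * symplectic_form $ c $ f
          * (LINT V|M. loop_integrand j q mu a b e f V)) = 0"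
proof -
  interpret unitary_haar unitary_symplectic_group M by (rule unitary_haar_symplectic[OF M])
  let ?J = "symplectic_form :: complex^('n + 'n)^('n + 'n)"
  let ?L = "\<lambda>c d. LINT V|M. loop_integrand j q mu a b c d V"
  show ?thesis
  proof (rule hermitian_form_eq_0[where I = "\<lambda>c d. ?L c d + (\<Sum>e\<in>UNIV. \<Sum>f\<in>UNIV. ?J $ e $ d * ?J $ c $ f * ?L e f)"])
    fix v :: "'n + 'n \<Rightarrow> complex" assume v: "(\<Sum>a\<in>UNIV. v a * cnj (v a)) = 1"
    define P where "P = rank_one v"
    define Q where "Q = - (?J ** transpose P ** ?J)"
    have proj: "P ** P = P" "Q ** Q = Q" "P ** Q = 0" "Q ** P = 0" and Q: "conj_transpose Q = Q"
      and G: "phase_curve P Q t \<in> unitary_symplectic_group" for t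
      using symplectic_phase_curve[OF v] unfolding P_def Q_def by blast+
    have P: "conj_transpose P = P" by (simp add: P_def)
    have "cnj (P $ d $ c) = P $ c $ d" "cnj (Q $ d $ c) = Q $ c $ d" for c d
      using P Q conj_transpose_nth by metis+
    then have anti: "cnj (cscale \<i> (P - Q) $ c $ d) = - cscale \<i> (P - Q) $ d $ c" for c d
      by simp
    have "(\<Sum>e\<in>UNIV. \<Sum>f\<in>UNIV. cscale \<i> (P - Q) $ e $ f * ?L e f) = 0"
      by (rule loop_equation_generator[where g = "phase_curve P Q", OF G phase_curve_0 phase_curve_deriv[OF proj] anti])
    then have "\<i> * (\<Sum>e\<in>UNIV. \<Sum>f\<in>UNIV. (P - Q) $ e $ f * ?L e f) = 0"
      by (simp add: sum_distrib_left mult.assoc)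
    then have "0 = (\<Sum>e\<in>UNIV. \<Sum>f\<in>UNIV. (P - Q) $ e $ f * ?L e f)" by simp
    also have "\<dots> = (\<Sum>e\<in>UNIV. \<Sum>f\<in>UNIV. v e * cnj (v f) * ?L e f)
        + (\<Sum>e\<in>UNIV. \<Sum>f\<in>UNIV. (?J ** transpose P ** ?J) $ e $ f * ?L e f)"
      by (simp add: P_def Q_def distrib_right sum.distrib)
    \<comment> \<open>Q is written out in the products v_c cnj(v_d), so that the P and Q parts
      together form one Hermitian form in v.\<close>
    also have "(\<Sum>e\<in>UNIV. \<Sum>f\<in>UNIV. (?J ** transpose P ** ?J) $ e $ f * ?L e f)
        = (\<Sum>e\<in>UNIV. \<Sum>f\<in>UNIV. \<Sum>c\<in>UNIV. \<Sum>d\<in>UNIV. v c * cnj (v d) * (?J $ e $ d * ?J $ c $ f * ?L e f))"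
    proof (intro sum.cong refl)
      fix e f
      have "(?J ** transpose P ** ?J) $ e $ f = (\<Sum>c\<in>UNIV. \<Sum>d\<in>UNIV. v c * cnj (v d) * (?J $ e $ d * ?J $ c $ f))"
        unfolding matrix_mult_triple_nth by (subst sum.swap) (simp add: transpose_def P_def)
      then show "(?J ** transpose P ** ?J) $ e $ f * ?L e f
          = (\<Sum>c\<in>UNIV. \<Sum>d\<in>UNIV. v c * cnj (v d) * (?J $ e $ d * ?J $ c $ f * ?L e f))"
        by (simp only: sum_distrib_right mult.assoc)
    qed
    also have "\<dots> = (\<Sum>c\<in>UNIV. \<Sum>d\<in>UNIV. \<Sum>e\<in>UNIV. \<Sum>f\<in>UNIV. v c * cnj (v d) * (?J $ e $ d * ?J $ c $ f * ?L e f))"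
      by (rule sum_swap4)
    also have "(\<Sum>e\<in>UNIV. \<Sum>f\<in>UNIV. v e * cnj (v f) * ?L e f) + \<dots>
        = (\<Sum>c\<in>UNIV. \<Sum>d\<in>UNIV. v c * cnj (v d) * (?L c d + (\<Sum>e\<in>UNIV. \<Sum>f\<in>UNIV. ?J $ e $ d * ?J $ c $ f * ?L e f)))"
      by (simp only: distrib_left sum.distrib sum_distrib_left)
    finally show "(\<Sum>c\<in>UNIV. \<Sum>d\<in>UNIV. v c * cnj (v d)
        * (?L c d + (\<Sum>e\<in>UNIV. \<Sum>f\<in>UNIV. ?J $ e $ d * ?J $ c $ f * ?L e f))) = 0" by simp
  qed
qed

text \<open>The untwisted half of the direction gives the cuts and joins of the unitary case; the
  twisted half gives the terms with the exponents 2k - j and i - j, folded to positive ones because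
  traces are real.\<close>

lemma symplectic_loop_equation:
  fixes M :: "(complex^('n::finite + 'n)^('n + 'n)) measure"
  defines "a \<equiv> \<lambda>lam. LINT U|M. power_sum lam U" and "D \<equiv> of_nat CARD('n + 'n) :: complex"
  assumes M: "haar_prob unitary_symplectic_group M" and j: "0 < j"
  shows "(D + 1) * a (add_mset j q)
      + (\<Sum>k=1..<j. a (add_mset k (add_mset (j - k) q))
          + (if 2 * k = j then D * a q else a (add_mset (if j < 2 * k then 2 * k - j else j - 2 * k) q)))
      + (\<Sum>i\<in>#q. of_nat i * (a (add_mset (i + j) (q - {#i#}))
          - (if i = j then D * a (q - {#i#}) else a (add_mset (if i < j then j - i else i - j) (q - {#i#}))))) = 0"
proof -
  interpret unitary_haar unitary_symplectic_group M by (rule unitary_haar_symplectic[OF M])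
  let ?J = "symplectic_form :: complex^('n + 'n)^('n + 'n)"
  let ?L = "loop_integrand j q {#}"
  let ?p = "\<lambda>lam V. power_sum lam (V :: complex^('n + 'n)^('n + 'n))"
  let ?A = "\<lambda>k V. if 2 * k = j then D * ?p q V else ?p (add_mset (if j < 2 * k then 2 * k - j else j - 2 * k) q) V"
  let ?B = "\<lambda>i V. of_nat i * (?p (add_mset (i + j) (q - {#i#})) V
          - (if i = j then D * ?p (q - {#i#}) V else ?p (add_mset (if i < j then j - i else i - j) (q - {#i#})) V))"
  have int_L: "integrable M (\<lambda>V. ?L a b c d V)" for a b c d
    by (intro integrable_M continuous_intros)
  have "0 = (\<Sum>c\<in>UNIV. \<Sum>d\<in>UNIV. (LINT V|M. ?L c d c d V)
      + (\<Sum>e\<in>UNIV. \<Sum>f\<in>UNIV. ?J $ e $ d * ?J $ c $ f * (LINT V|M. ?L c d e f V)))"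
    by (simp only: symplectic_integral_loop_integrand[OF M] sum.neutral_const)
  also have "\<dots> = (LINT V|M. (\<Sum>c\<in>UNIV. \<Sum>d\<in>UNIV. ?L c d c d V)
      + (\<Sum>c\<in>UNIV. \<Sum>d\<in>UNIV. \<Sum>e\<in>UNIV. \<Sum>f\<in>UNIV. ?J $ e $ d * ?J $ c $ f * ?L c d e f V))"
    by (simp add: Bochner_Integration.integral_sum int_L sum.distrib)
  also have "\<dots> = (LINT V|M. (D + 1) * ?p (add_mset j q) V
      + (\<Sum>k=1..<j. ?p (add_mset k (add_mset (j - k) q)) V + ?A k V) + (\<Sum>i\<in>#q. ?B i V))"
  proof (rule integral_cong_G)
    fix V :: "complex^('n + 'n)^('n + 'n)" assume V: "V \<in> unitary_symplectic_group"
    then have U: "V \<in> unitary_group" by (simp add: unitary_symplectic_group_def)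
    let ?W = "matrix_power V"
    have T: "trace (?W k ** conj_transpose (?W l)) =
      (if l < k then trace (?W (k - l)) else if l = k then D else trace (?W (l - k)))" for k l
      by (simp add: trace_power_conj_power[OF U] D_def cnj_trace_symplectic[OF matrix_power_unitary_symplectic[OF V]])
    have ins: "{..<j} = insert 0 {1..<j}" using j by auto
    have "(\<Sum>k<j. trace (?W k) * trace (?W (j - k))) * ?p q V
        = D * ?p (add_mset j q) V + (\<Sum>k=1..<j. ?p (add_mset k (add_mset (j - k) q)) V)"
      unfolding ins by (simp add: trace_I D_def power_sum_add_mset sum_distrib_right distrib_right mult.assoc)
    moreover have "(\<Sum>k<j. trace (?W k ** conj_transpose (?W (j - k)))) * ?p q V
        = ?p (add_mset j q) V + (\<Sum>k=1..<j. ?A k V)"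
    proof -
      have "(\<Sum>k=1..<j. trace (?W k ** conj_transpose (?W (j - k)))) * ?p q V = (\<Sum>k=1..<j. ?A k V)"
        unfolding sum_distrib_right
      proof (rule sum.cong[OF refl])
        fix k assume "k \<in> {1..<j}"
        then have "j - k < k \<longleftrightarrow> j < 2 * k" "j - k = k \<longleftrightarrow> 2 * k = j" "k - (j - k) = 2 * k - j" "j - k - k = j - 2 * k"
          by auto
        then show "trace (?W k ** conj_transpose (?W (j - k))) * ?p q V = ?A k V"
          unfolding T by (simp add: power_sum_add_mset)
      qed
      \<comment> \<open>The term k = 0 of the twisted half is Tr U^j again; it raises the leading
        coefficient from D to D + 1.\<close>
      moreover have "trace (?W 0 ** conj_transpose (?W (j - 0))) = trace (?W j)"
        unfolding T using j by simp
      ultimately show ?thesis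
        unfolding ins by (simp add: power_sum_add_mset distrib_right)
    qed
    moreover have "(\<Sum>i\<in>#q. of_nat i * trace (?W (i + j)) * ?p (q - {#i#}) V)
        - (\<Sum>i\<in>#q. of_nat i * trace (?W j ** conj_transpose (?W i)) * ?p (q - {#i#}) V) = (\<Sum>i\<in>#q. ?B i V)"
      unfolding sum_mset_subtractf_complex[symmetric] T
      by (rule arg_cong[where f = sum_mset], rule image_mset_cong) (simp add: power_sum_add_mset algebra_simps)
    ultimately show "(\<Sum>c\<in>UNIV. \<Sum>d\<in>UNIV. ?L c d c d V)
        + (\<Sum>c\<in>UNIV. \<Sum>d\<in>UNIV. \<Sum>e\<in>UNIV. \<Sum>f\<in>UNIV. ?J $ e $ d * ?J $ c $ f * ?L c d e f V)
      = (D + 1) * ?p (add_mset j q) V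
        + (\<Sum>k=1..<j. ?p (add_mset k (add_mset (j - k) q)) V + ?A k V) + (\<Sum>i\<in>#q. ?B i V)"
      unfolding sum_loop_integrand sum_loop_integrand_symplectic[OF V] sum.distrib
      by (simp add: algebra_simps)
  qed
  also have "\<dots> = (D + 1) * a (add_mset j q)
      + (\<Sum>k=1..<j. a (add_mset k (add_mset (j - k) q))
          + (if 2 * k = j then D * a q else a (add_mset (if j < 2 * k then 2 * k - j else j - 2 * k) q)))
      + (\<Sum>i\<in>#q. of_nat i * (a (add_mset (i + j) (q - {#i#}))
          - (if i = j then D * a (q - {#i#}) else a (add_mset (if i < j then j - i else i - j) (q - {#i#})))))"
  proof -
    have p: "integrable M (?p lam)" for lam by (intro integrable_M continuous_intros)
    have A: "integrable M (?A k)" "(LINT V|M. ?A k V)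
        = (if 2 * k = j then D * a q else a (add_mset (if j < 2 * k then 2 * k - j else j - 2 * k) q))" for k
      by (cases "2 * k = j"; simp add: a_def p)+
    have B: "continuous_on UNIV (?B i)" for i
      by (cases "i = j"; cases "i < j") (auto intro!: continuous_intros)
    have B': "(LINT V|M. ?B i V) = of_nat i * (a (add_mset (i + j) (q - {#i#}))
          - (if i = j then D * a (q - {#i#}) else a (add_mset (if i < j then j - i else i - j) (q - {#i#}))))" for i
      by (cases "i = j"; cases "i < j") (auto simp: a_def p)
    have BS: "integrable M (\<lambda>V. \<Sum>i\<in>#q. ?B i V)"
      by (intro integrable_M continuous_on_sum_mset B)
    have "(LINT V|M. (\<Sum>k=1..<j. ?p (add_mset k (add_mset (j - k) q)) V + ?A k V))
        = (\<Sum>k=1..<j. a (add_mset k (add_mset (j - k) q))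
          + (if 2 * k = j then D * a q else a (add_mset (if j < 2 * k then 2 * k - j else j - 2 * k) q)))"
      by (subst Bochner_Integration.integral_sum)
         (auto simp only: Bochner_Integration.integral_add[OF p A(1)] A(2) a_def intro!: Bochner_Integration.integrable_add p A(1))
    moreover have "integrable M (\<lambda>V. \<Sum>k=1..<j. ?p (add_mset k (add_mset (j - k) q)) V + ?A k V)"
      by (intro Bochner_Integration.integrable_sum Bochner_Integration.integrable_add p A(1))
    moreover have "(LINT V|M. (\<Sum>i\<in>#q. ?B i V)) = (\<Sum>i\<in>#q. of_nat i * (a (add_mset (i + j) (q - {#i#}))
          - (if i = j then D * a (q - {#i#}) else a (add_mset (if i < j then j - i else i - j) (q - {#i#})))))"
      unfolding integral_sum_mset[OF B] B' ..
    moreover have "(LINT V|M. (D + 1) * ?p (add_mset j q) V) = (D + 1) * a (add_mset j q)"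
      by (simp add: a_def)
    moreover have "integrable M (\<lambda>V. (D + 1) * ?p (add_mset j q) V)" using p by simp
    ultimately show ?thesis
      using BS by (simp only: Bochner_Integration.integral_add Bochner_Integration.integrable_add)
  qed
  finally show ?thesis by simp
qed

text \<open>Only cuts and joins preserve the degree. The twisted terms have lower degree, because |j
  - 2k| < j and |i - j| < i + j, and agree with the candidate by induction; the difference then
  solves the homogeneous equation with constant D + 1.\<close>

proposition symplectic_moment:
  fixes M :: "(complex^('n::finite + 'n)^('n + 'n)) measure"
  assumes M: "haar_prob unitary_symplectic_group M"
    and "n \<le> CARD('n + 'n) + 1" "lam \<in> partitions_of n"
  shows "(LINT U|M. power_sum lam U) = sp_moment lam"
  using assms(2-)
proof (induction n arbitrary: lam rule: less_induct)
  case (less n)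
  interpret unitary_haar unitary_symplectic_group M by (rule unitary_haar_symplectic[OF M])
  let ?a = "\<lambda>lam. LINT U|M. power_sum lam U"
  let ?D = "of_nat CARD('n + 'n) :: complex"
  show ?case
  proof (cases "n = 0")
    case True
    then show ?thesis
      using less.prems prob_space.prob_space[OF prob_space] by (simp add: partitions_of_0)
  next
    case False
    have "?a lam - sp_moment lam = 0"
    proof (rule cut_join_unique[where n = n and D = "CARD('n + 'n) + 1" and e = "\<lambda>lam. ?a lam - sp_moment lam"])
      fix j q assume j: "0 < j" and q: "is_partition q" and s: "j + sum_mset q = n"
      have eq: "?a l = sp_moment l" if "is_partition l" "sum_mset l < n" for l
        using less.IH[of "sum_mset l" l] less.prems(1) that by (auto simp: partitions_of_def)
      let ?C = "\<lambda>a k. if 2 * k = j then ?D * a q else a (add_mset (if j < 2 * k then 2 * k - j else j - 2 * k) q)"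
      let ?E = "\<lambda>a i. if i = j then ?D * a (q - {#i#}) else a (add_mset (if i < j then j - i else i - j) (q - {#i#}))"
      have C: "(\<Sum>k=1..<j. ?C ?a k) = (\<Sum>k=1..<j. ?C sp_moment k)"
      proof (rule sum.cong[OF refl])
        fix k assume k: "k \<in> {1..<j}"
        have "?a q = sp_moment q" by (rule eq[OF q]) (use j s in simp)
        moreover have "?a (add_mset l q) = sp_moment (add_mset l q)" if "0 < l" "l < j" for l
          by (rule eq) (use that q s in auto)
        ultimately show "?C ?a k = ?C sp_moment k" using k by auto
      qed
      have E: "(\<Sum>i\<in>#q. of_nat i * ?E ?a i) = (\<Sum>i\<in>#q. of_nat i * ?E sp_moment i)"
      proof (rule arg_cong[where f = sum_mset], rule image_mset_cong)
        fix i assume i: "i \<in># q"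
        then have i0: "0 < i" "i \<le> sum_mset q" using q le_sum_mset[OF i] by (auto simp: is_partition_def intro: gr0I)
        have si: "sum_mset (q - {#i#}) = sum_mset q - i" using i by (rule sum_mset_remove1)
        have "?a (q - {#i#}) = sp_moment (q - {#i#})"
          by (rule eq) (use q i0 si s j in auto)
        moreover have "?a (add_mset l (q - {#i#})) = sp_moment (add_mset l (q - {#i#}))" if "0 < l" "l < i + j" for l
          by (rule eq) (use that q i0 si s in auto)
        ultimately show "of_nat i * ?E ?a i = of_nat i * ?E sp_moment i" using i0 j by auto
      qed
      have "(?D + 1) * ?a (add_mset j q) + (\<Sum>k=1..<j. ?a (add_mset k (add_mset (j - k) q)))
          + (\<Sum>i\<in>#q. of_nat i * ?a (add_mset (i + j) (q - {#i#})))
          = (\<Sum>i\<in>#q. of_nat i * ?E ?a i) - (\<Sum>k=1..<j. ?C ?a k)"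
        using symplectic_loop_equation[OF M j, of q]
        unfolding sum.distrib right_diff_distrib sum_mset_subtractf_complex by (simp add: algebra_simps)
      also have "\<dots> = (?D + 1) * sp_moment (add_mset j q) + (\<Sum>k=1..<j. sp_moment (add_mset k (add_mset (j - k) q)))
          + (\<Sum>i\<in>#q. of_nat i * sp_moment (add_mset (i + j) (q - {#i#})))"
        using sp_moment_loop_equation[OF j q, of ?D]
        unfolding C E sum.distrib right_diff_distrib sum_mset_subtractf_complex by (simp add: algebra_simps)
      finally show "of_nat (CARD('n + 'n) + 1) * (?a (add_mset j q) - sp_moment (add_mset j q))
          + (\<Sum>k=1..<j. ?a (add_mset k (add_mset (j - k) q)) - sp_moment (add_mset k (add_mset (j - k) q)))
          + (\<Sum>i\<in>#q. of_nat i * (?a (add_mset (i + j) (q - {#i#})) - sp_moment (add_mset (i + j) (q - {#i#})))) = 0"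
        unfolding sum_subtractf right_diff_distrib sum_mset_subtractf_complex of_nat_add of_nat_1
        by (simp only: diff_add_eq add_diff_eq) simp
    qed (use less.prems False in auto)
    then show ?thesis by simp
  qed
qed

section \<open>Pairing power sums with the symplectic kernel\<close>

lemma cnj_zfac: "cnj (zfac lam) = zfac lam"
  by (simp add: zfac_def multiplicity_prod_def)

lemma cnj_sp_moment: "cnj (sp_moment lam) = sp_moment lam"
proof -
  have "cnj (sp_moment_factor j c) = sp_moment_factor j c" for j c
    by (induction j c rule: sp_moment_factor.induct) simp_all
  then show ?thesis by (simp add: sp_moment_def multiplicity_prod_def)
qed

lemma continuous_on_omega_coeff [continuous_intros]: "continuous_on S (\<lambda>U. omega_coeff n U)"
  unfolding omega_coeff_def by (intro continuous_intros)

text \<open>Orthogonality selects the coefficient of \<open>lam\<close> and its norm cancels the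
  denominator \<open>zfac lam\<close>. Degrees other than that of \<open>lam\<close> vanish by the
  phase argument, which holds for arbitrarily large n, as the full series requires.\<close>

lemma unitary_integral_omega_coeff:
  fixes M :: "(complex^'m^'m) measure"
  assumes M: "haar_prob unitary_group M"
    and lam: "is_partition lam" "sum_mset lam \<le> CARD('m)"
  shows "(LINT U|M. power_sum lam U * cnj (omega_coeff n U)) = (if n = sum_mset lam then sp_moment lam else 0)"
proof -
  interpret unitary_haar unitary_group M by (rule unitary_haar_unitary_group[OF M])
  have int: "integrable M (\<lambda>U. power_sum lam U * cnj (power_sum mu U))" for mu
    by (intro integrable_M continuous_intros)
  have "(LINT U|M. power_sum lam U * cnj (omega_coeff n U))
      = (LINT U|M. (\<Sum>mu\<in>partitions_of n. sp_moment mu / zfac mu * (power_sum lam U * cnj (power_sum mu U))))"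
    by (rule Bochner_Integration.integral_cong)
       (simp_all add: omega_coeff_def sum_distrib_left cnj_zfac cnj_sp_moment mult_ac)
  also have "\<dots> = (\<Sum>mu\<in>partitions_of n. sp_moment mu / zfac mu * moment M lam mu)"
    by (simp add: Bochner_Integration.integral_sum int moment_def del: times_divide_eq_left)
  also have "\<dots> = (if n = sum_mset lam then sp_moment lam else 0)"
  proof (cases "n = sum_mset lam")
    case True
    have "(\<Sum>mu\<in>partitions_of n. sp_moment mu / zfac mu * moment M lam mu)
        = (\<Sum>mu\<in>partitions_of n. if mu = lam then sp_moment lam else 0)"
    proof (rule sum.cong[OF refl])
      fix mu assume mu: "mu \<in> partitions_of n"
      have "moment M lam mu = zdelta lam mu"
        by (rule unitary_moment_eq_zdelta[OF M, of n]) (use lam mu True in \<open>auto simp: partitions_of_def\<close>)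
      then show "sp_moment mu / zfac mu * moment M lam mu = (if mu = lam then sp_moment lam else 0)"
        using zfac_nonzero[OF lam(1)] by (simp add: zdelta_def)
    qed
    moreover have "lam \<in> partitions_of n" using True lam by (simp add: partitions_of_def)
    ultimately show ?thesis using True by simp
  next
    case False
    then have "moment M lam mu = 0" if "mu \<in> partitions_of n" for mu
      by (intro unitary_moment_eq_0[OF M]) (use that in \<open>auto simp: partitions_of_def\<close>)
    then show ?thesis using False by simp
  qed
  finally show ?thesis .
qed

text \<open>Below radius 1 the series is dominated uniformly in U, so it may be integrated term by
  term, and only the term of degree \<open>sum_mset lam\<close> is left.\<close>

lemma unitary_integral_omega_Sp:
  fixes M :: "(complex^'m^'m) measure"
  assumes M: "haar_prob unitary_group M"
    and lam: "is_partition lam" "sum_mset lam \<le> CARD('m)" and r: "0 \<le> r" "r < 1"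
  shows "(LINT U|M. power_sum lam U * cnj (omega_Sp (r *\<^sub>R U))) = of_real (r ^ sum_mset lam) * sp_moment lam"
proof -
  interpret unitary_haar unitary_group M by (rule unitary_haar_unitary_group[OF M])
  interpret P: prob_space M by (rule prob_space)
  let ?f = "\<lambda>n U. power_sum lam U * cnj (omega_coeff n (r *\<^sub>R U))"
  obtain b where b: "summable b"
    and le: "\<And>(U :: complex^'m^'m) n. U \<in> unitary_group \<Longrightarrow> norm (omega_coeff n (r *\<^sub>R U)) \<le> b n"
    and sums: "\<And>U :: complex^'m^'m. U \<in> unitary_group \<Longrightarrow> (\<lambda>n. omega_coeff n (r *\<^sub>R U)) sums omega_Sp (r *\<^sub>R U)"
    using omega_Sp_sums[OF r] by blast
  obtain B where B: "0 \<le> B" "\<And>U :: complex^'m^'m. U \<in> unitary_group \<Longrightarrow> norm (power_sum lam U) \<le> B"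
    using bounded_on_G[OF continuous_on_power_sum[of UNIV lam]] by blast
  have f_le: "norm (?f n U) \<le> B * b n" if "U \<in> unitary_group" for n and U :: "complex^'m^'m"
    using B le[OF that] that by (auto simp: norm_mult intro!: mult_mono)
  \<comment> \<open>The order of the eigenvalues is an arbitrary choice, so integrability is
    obtained from the power sum form of each term, which is continuous in U.\<close>
  have int: "integrable M (?f n)" for n
    unfolding omega_coeff_scaleR by (intro integrable_M continuous_intros)
  have "(\<lambda>n. LINT U|M. ?f n U) sums (LINT U|M. (\<Sum>n. ?f n U))"
  proof (rule sums_integral[OF int])
    show "AE U in M. summable (\<lambda>n. norm (?f n U))"
    proof (rule AE_I2)
      fix U assume "U \<in> space M"
      then have "U \<in> unitary_group" by (simp add: space_M)
      then show "summable (\<lambda>n. norm (?f n U))"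
        by (intro summable_comparison_test'[OF summable_mult[OF b, of B], where N = 0]) (simp add: f_le)
    qed
    show "summable (\<lambda>n. LINT U|M. norm (?f n U))"
    proof (rule summable_comparison_test'[OF summable_mult[OF b, of B], where N = 0])
      fix n
      have "(LINT U|M. norm (?f n U)) \<le> (LINT U|M. B * b n)"
        by (rule integral_mono) (use int f_le in \<open>auto simp: space_M\<close>)
      then show "norm (LINT U|M. norm (?f n U)) \<le> B * b n"
        by (simp add: P.prob_space)
    qed
  qed
  also have "(LINT U|M. (\<Sum>n. ?f n U)) = (LINT U|M. power_sum lam U * cnj (omega_Sp (r *\<^sub>R U)))"
  proof (rule integral_cong_G)
    fix U :: "complex^'m^'m" assume "U \<in> unitary_group"
    then have "(\<lambda>n. ?f n U) sums (power_sum lam U * cnj (omega_Sp (r *\<^sub>R U)))"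
      using sums by (intro sums_mult) (simp add: sums_cnj)
    then show "(\<Sum>n. ?f n U) = power_sum lam U * cnj (omega_Sp (r *\<^sub>R U))"
      by (rule sums_unique[symmetric])
  qed
  also have "(\<lambda>n. LINT U|M. ?f n U) = (\<lambda>n. if n = sum_mset lam then of_real (r ^ sum_mset lam) * sp_moment lam else 0)"
  proof
    fix n
    have "(LINT U|M. ?f n U) = (LINT U|M. of_real (r ^ n) * (power_sum lam U * cnj (omega_coeff n U)))"
      by (simp add: omega_coeff_scaleR mult_ac)
    also have "\<dots> = of_real (r ^ n) * (LINT U|M. power_sum lam U * cnj (omega_coeff n U))"
      by (rule integral_mult_right_zero)
    finally show "(LINT U|M. ?f n U) = (if n = sum_mset lam then of_real (r ^ sum_mset lam) * sp_moment lam else 0)"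
      unfolding unitary_integral_omega_coeff[OF M lam] by simp
  qed
  finally have "(\<lambda>n. if n = sum_mset lam then of_real (r ^ sum_mset lam) * sp_moment lam else 0)
      sums (LINT U|M. power_sum lam U * cnj (omega_Sp (r *\<^sub>R U)))" .
  moreover have "(\<lambda>n. if n = sum_mset lam then of_real (r ^ sum_mset lam) * sp_moment lam else 0)
      sums (of_real (r ^ sum_mset lam) * sp_moment lam)"
    by (rule sums_single)
  ultimately show ?thesis by (rule sums_unique2)
qed

theorem theorem1p3:
  fixes \<mu> \<nu> :: "(complex^('n::finite + 'n)^('n + 'n)) measure"
    and lam :: "nat multiset"
  assumes "haar_prob unitary_group \<mu>"
    and "haar_prob unitary_symplectic_group \<nu>"
    and "is_partition lam"
    and "sum_mset lam < 2 * CARD('n)"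
  shows "((\<lambda>r::real. LINT U|\<mu>. power_sum lam U * cnj (omega_Sp (r *\<^sub>R U)))
           \<longlongrightarrow> (LINT U|\<nu>. power_sum lam U)) (at_left 1)"
proof -
  have card: "CARD('n + 'n) = 2 * CARD('n)" by simp
  have "(LINT U|\<nu>. power_sum lam U) = sp_moment lam"
    by (rule symplectic_moment[OF assms(2), of "sum_mset lam"])
       (use assms(3,4) in \<open>auto simp: partitions_of_def card\<close>)
  moreover have "((\<lambda>r::real. of_real (r ^ sum_mset lam) * sp_moment lam) \<longlongrightarrow> of_real (1 ^ sum_mset lam) * sp_moment lam) (at_left 1)"
    by (intro tendsto_intros)
  \<comment> \<open>The identity is exact for every r in (0, 1); the limit only removes the power of
    r.\<close>
  moreover have "\<forall>\<^sub>F r::real in at_left 1. of_real (r ^ sum_mset lam) * sp_moment lam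
      = (LINT U|\<mu>. power_sum lam U * cnj (omega_Sp (r *\<^sub>R U)))"
  proof (rule eventually_mono[OF eventually_at_left_real[of 0 1]])
    fix r :: real assume "r \<in> {0<..<1}"
    then show "of_real (r ^ sum_mset lam) * sp_moment lam
        = (LINT U|\<mu>. power_sum lam U * cnj (omega_Sp (r *\<^sub>R U)))"
      using assms(4) by (intro unitary_integral_omega_Sp[OF assms(1,3), symmetric]) (auto simp: card)
  qed simp
  ultimately show ?thesis
    using Lim_transform_eventually by fastforce
qed

end
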